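(* Let $\mu$ be a doubling measure on $X$ and $\Omega$ supports a local $\Phi$-Poincaré inequality for some N-function $\Phi\in\Delta'\cap\nabla_2$. For every $m\in\mathbb N$, let $(Y_m,d_m)$ be a complete metric space, $K_m\subset Y_m$ compact and $\{u_m\}\subset M^{1,\Phi}(\Omega,Y_m)$. Suppose that $(K_m,d_m)$ is a uniformly compact sequence and \begin{equation*} \sup_{m\in\mathbb N}\left[\|d_m(y_m,u_m)\|_{L^\Phi(\Omega)}+E_H^\Phi(u_m)\right]<\infty \end{equation*} for some and thus every $y_m\in K_m$. Then, after possibly passing to a subsequence, there exist a complete metric space $Z$, isometric embeddings $\varphi_m\colon Y_m\hookrightarrow Z$, a compact subset $K\subset Z$ and $v\in M^{1,\Phi}(\Omega,Z)$ such that $\varphi_m(K_m)\subset K$ for all $m\in\mathbb N$ and $\varphi_m\circ u_m$ converges to $v$ in $L^\Phi(\Omega,Z)$.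
   Context: Setting: $X=(X,d_X,\mu)$ complete metric measure space, $\Omega\subset X$ bounded domain; $\mu$ doubling means $0<\mu(B(x,2r))\le C_d\mu(B(x,r))<\infty$. An N-function is a continuous even convex $\Phi\colon\mathbb R\to[0,\infty)$ with $\Phi(x)=0$ iff $x=0$, $\Phi(x)/x\to0$ as $x\to0$, $\to\infty$ as $x\to\infty$. $\Phi\in\Delta'$: $\Phi(xy)\le C'\Phi(x)\Phi(y)$; $\Phi\in\nabla_2$: $\Phi(x)\le\frac1{2C}\Phi(Cx)$ for some $C>1$. Local $\Phi$-Poincaré inequality: there are $C_\Phi>0,\lambda\ge1$ such that $\frac{1}{\mu(B)}\int_B|u-u_B|\,d\mu\le C_\Phi r\,\Phi^{-1}\!\left(\frac{1}{\mu(\lambda B)}\int_{\lambda B}\Phi(g)\,d\mu\right)$ for every integrable $u$, every upper gradient $g$, and each ball $B=B(x,r)$ with $\lambda B\subset\Omega$, $u_B=\frac1{\mu(B)}\int_Bu\,d\mu$. $L^\Phi$ carries the Luxemburg norm. $M^{1,\Phi}(\Omega,Y)$ consists of measurable $u\in L^\Phi(\Omega,Y)$ for which there exists $0\le g\in L^\Phi(\Omega)$ with $d_Y(u(x),u(x'))\le d_X(x,x')(g(x)+g(x'))$ for all $x,x'$ outside a $\mu$-null set; $E_H^\Phi(u)=\inf_g\|g\|_{L^\Phi(\Omega)}$ over such $g$. Uniformly compact: $\sup_m\operatorname{diam}K_m<\infty$ and for each $\varepsilon>0$ there is $N$ such that every $K_m$ is covered by at most $N$ balls of radius $\varepsilon$.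 *)

theory Defs
  imports "HOL-Analysis.Analysis"
begin

definition doubling_measure :: "'x::metric_space measure \<Rightarrow> bool" where
  "doubling_measure \<mu> \<longleftrightarrow> (\<exists>Cd. \<forall>x r. r > 0 \<longrightarrow>
      0 < emeasure \<mu> (ball x r) \<and> emeasure \<mu> (ball x (2*r)) < \<infinity> \<and>
      emeasure \<mu> (ball x (2*r)) \<le> ennreal Cd * emeasure \<mu> (ball x r))"

definition curve_length :: "(real \<Rightarrow> 'x::metric_space) \<Rightarrow> real \<Rightarrow> real \<Rightarrow> ennreal" where
  "curve_length \<gamma> a b = (SUP p \<in> {(n, t). t 0 = a \<and> t n = b \<and> (\<forall>i<n. t i \<le> t (Suc i))}.
      ennreal (\<Sum>i<fst p. dist (\<gamma> (snd p i)) (\<gamma> (snd p (Suc i)))))"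

definition rectifiable_curve_in :: "'x::metric_space set \<Rightarrow> (real \<Rightarrow> 'x) \<Rightarrow> real \<Rightarrow> real \<Rightarrow> bool" where
  "rectifiable_curve_in \<Omega> \<gamma> a b \<longleftrightarrow> a \<le> b \<and> continuous_on {a..b} \<gamma> \<and> \<gamma> ` {a..b} \<subseteq> \<Omega>
      \<and> curve_length \<gamma> a b < \<infinity>"

definition arclength_fun :: "(real \<Rightarrow> 'x::metric_space) \<Rightarrow> real \<Rightarrow> real \<Rightarrow> real \<Rightarrow> real" where
  "arclength_fun \<gamma> a b = (\<lambda>t. enn2real (curve_length \<gamma> a (max a (min t b))))"

definition line_integral :: "(real \<Rightarrow> 'x::metric_space) \<Rightarrow> real \<Rightarrow> real \<Rightarrow> ('x \<Rightarrow> real) \<Rightarrow> ennreal" where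
  "line_integral \<gamma> a b g = (\<integral>\<^sup>+ t \<in> {a..b}. ennreal (g (\<gamma> t)) \<partial>interval_measure (arclength_fun \<gamma> a b))"

definition upper_gradient :: "'x::metric_space set \<Rightarrow> ('x \<Rightarrow> real) \<Rightarrow> ('x \<Rightarrow> real) \<Rightarrow> bool" where
  "upper_gradient \<Omega> u g \<longleftrightarrow> g \<in> borel_measurable borel \<and> (\<forall>x. 0 \<le> g x) \<and>
     (\<forall>\<gamma> a b. rectifiable_curve_in \<Omega> \<gamma> a b \<longrightarrow>
        ennreal \<bar>u (\<gamma> a) - u (\<gamma> b)\<bar> \<le> line_integral \<gamma> a b g)"

definition N_function :: "(real \<Rightarrow> real) \<Rightarrow> bool" where
  "N_function \<Phi> \<longleftrightarrow> continuous_on UNIV \<Phi> \<and> (\<forall>x. \<Phi> (-x) = \<Phi> x) \<and> convex_on UNIV \<Phi> \<and>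
     (\<forall>x. 0 \<le> \<Phi> x) \<and> (\<forall>x. \<Phi> x = 0 \<longleftrightarrow> x = 0) \<and>
     ((\<lambda>x. \<Phi> x / x) \<longlongrightarrow> 0) (at 0) \<and> filterlim (\<lambda>x. \<Phi> x / x) at_top at_top"

definition Delta_prime :: "(real \<Rightarrow> real) \<Rightarrow> bool" where
  "Delta_prime \<Phi> \<longleftrightarrow> (\<exists>C'. \<forall>x y. \<Phi> (x*y) \<le> C' * \<Phi> x * \<Phi> y)"

definition nabla2 :: "(real \<Rightarrow> real) \<Rightarrow> bool" where
  "nabla2 \<Phi> \<longleftrightarrow> (\<exists>C>1. \<forall>x. \<Phi> x \<le> \<Phi> (C*x) / (2*C))"

definition Phi_inv :: "(real \<Rightarrow> real) \<Rightarrow> real \<Rightarrow> real" where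
  "Phi_inv \<Phi> = the_inv_into {0..} \<Phi>"

definition avg :: "'x measure \<Rightarrow> 'x set \<Rightarrow> ('x \<Rightarrow> real) \<Rightarrow> real" where
  "avg \<mu> B f = (LINT y:B|\<mu>. f y) / measure \<mu> B"

definition supports_Phi_Poincare :: "'x::metric_space measure \<Rightarrow> 'x set \<Rightarrow> (real \<Rightarrow> real) \<Rightarrow> bool" where
  "supports_Phi_Poincare \<mu> \<Omega> \<Phi> \<longleftrightarrow> (\<exists>C\<^sub>\<Phi>>0. \<exists>lam\<ge>1. \<forall>u g x r.
      r > 0 \<and> ball x (lam*r) \<subseteq> \<Omega> \<and> set_integrable \<mu> \<Omega> u \<and> upper_gradient \<Omega> u g \<and>
      (\<integral>\<^sup>+ y \<in> ball x (lam*r). ennreal (\<Phi> (g y)) \<partial>\<mu>) < \<infinity> \<longrightarrow>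
      avg \<mu> (ball x r) (\<lambda>y. \<bar>u y - avg \<mu> (ball x r) u\<bar>)
        \<le> C\<^sub>\<Phi> * r * Phi_inv \<Phi> (enn2real (\<integral>\<^sup>+ y \<in> ball x (lam*r). ennreal (\<Phi> (g y)) \<partial>\<mu>)
                                    / measure \<mu> (ball x (lam*r))))"

text \<open>Luxemburg norm (value \<infinity> if f is not in the Orlicz space)\<close>
definition lux_norm :: "'x measure \<Rightarrow> 'x set \<Rightarrow> (real \<Rightarrow> real) \<Rightarrow> ('x \<Rightarrow> real) \<Rightarrow> ennreal" where
  "lux_norm \<mu> \<Omega> \<Phi> f = (INF k \<in> {k::real. k > 0 \<and> (\<integral>\<^sup>+ x \<in> \<Omega>. ennreal (\<Phi> (\<bar>f x\<bar> / k)) \<partial>\<mu>) \<le> 1}. ennreal k)"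

definition in_LPhi :: "'x measure \<Rightarrow> 'x set \<Rightarrow> (real \<Rightarrow> real) \<Rightarrow> ('x \<Rightarrow> real) \<Rightarrow> bool" where
  "in_LPhi \<mu> \<Omega> \<Phi> f \<longleftrightarrow> f \<in> borel_measurable (restrict_space \<mu> \<Omega>) \<and> lux_norm \<mu> \<Omega> \<Phi> f < \<infinity>"

definition borel_of_metric :: "'y metric \<Rightarrow> 'y measure" where
  "borel_of_metric Y = sigma (mspace Y) {U. openin (mtopology_of Y) U}"

definition in_LPhi_map :: "'x measure \<Rightarrow> 'x set \<Rightarrow> (real \<Rightarrow> real) \<Rightarrow> 'y metric \<Rightarrow> ('x \<Rightarrow> 'y) \<Rightarrow> bool" where
  "in_LPhi_map \<mu> \<Omega> \<Phi> Y u \<longleftrightarrow> u ` \<Omega> \<subseteq> mspace Y \<and>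
     u \<in> measurable (restrict_space \<mu> \<Omega>) (borel_of_metric Y) \<and>
     (\<exists>y0 \<in> mspace Y. lux_norm \<mu> \<Omega> \<Phi> (\<lambda>x. mdist Y y0 (u x)) < \<infinity>)"

definition hajlasz_gradient :: "'x::metric_space measure \<Rightarrow> 'x set \<Rightarrow> (real \<Rightarrow> real) \<Rightarrow> 'y metric \<Rightarrow> ('x \<Rightarrow> 'y) \<Rightarrow> ('x \<Rightarrow> real) \<Rightarrow> bool" where
  "hajlasz_gradient \<mu> \<Omega> \<Phi> Y u g \<longleftrightarrow> (\<forall>x\<in>\<Omega>. 0 \<le> g x) \<and> in_LPhi \<mu> \<Omega> \<Phi> g \<and>
     (\<exists>N \<in> null_sets \<mu>. \<forall>x \<in> \<Omega> - N. \<forall>x' \<in> \<Omega> - N.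
        mdist Y (u x) (u x') \<le> dist x x' * (g x + g x'))"

definition M1Phi :: "'x::metric_space measure \<Rightarrow> 'x set \<Rightarrow> (real \<Rightarrow> real) \<Rightarrow> 'y metric \<Rightarrow> ('x \<Rightarrow> 'y) set" where
  "M1Phi \<mu> \<Omega> \<Phi> Y = {u. in_LPhi_map \<mu> \<Omega> \<Phi> Y u \<and> (\<exists>g. hajlasz_gradient \<mu> \<Omega> \<Phi> Y u g)}"

definition E_H :: "'x::metric_space measure \<Rightarrow> 'x set \<Rightarrow> (real \<Rightarrow> real) \<Rightarrow> 'y metric \<Rightarrow> ('x \<Rightarrow> 'y) \<Rightarrow> ennreal" where
  "E_H \<mu> \<Omega> \<Phi> Y u = (INF g \<in> {g. hajlasz_gradient \<mu> \<Omega> \<Phi> Y u g}. lux_norm \<mu> \<Omega> \<Phi> g)"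

definition uniformly_compact :: "(nat \<Rightarrow> 'y metric) \<Rightarrow> (nat \<Rightarrow> 'y set) \<Rightarrow> bool" where
  "uniformly_compact Y K \<longleftrightarrow>
     (\<exists>D. \<forall>m. \<forall>a\<in>K m. \<forall>b\<in>K m. mdist (Y m) a b \<le> D) \<and>
     (\<forall>\<epsilon>>0. \<exists>N::nat. \<forall>m. \<exists>C. finite C \<and> card C \<le> N \<and> C \<subseteq> K m \<and>
         K m \<subseteq> (\<Union>c\<in>C. mball_of (Y m) c \<epsilon>))"

definition isometric_embedding :: "'y metric \<Rightarrow> 'z metric \<Rightarrow> ('y \<Rightarrow> 'z) \<Rightarrow> bool" where
  "isometric_embedding Y Z \<phi> \<longleftrightarrow> \<phi> ` mspace Y \<subseteq> mspace Z \<and>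
     (\<forall>a\<in>mspace Y. \<forall>b\<in>mspace Y. mdist Z (\<phi> a) (\<phi> b) = mdist Y a b)"

end

theory Submission
  imports Defs
begin

text \<open>
  Partition \<open>\<Omega>\<close>, which is totally bounded because \<open>\<mu>\<close> is doubling, into finitely many cells of
  diameter at most \<open>\<epsilon>\<close>. Replacing \<open>u\<^sub>m\<close> on each cell by its value at a point where the Hajlasz
  gradient and the distance to \<open>y\<^sub>m\<close> are at most average changes \<open>u\<^sub>m\<close> by \<open>O(\<epsilon>)\<close> in \<open>L\<^sup>\<Phi>\<close>,
  uniformly in \<open>m\<close>. For \<open>\<epsilon> = 2\<^sup>-\<^sup>j\<close> the values of these step maps, together with finite nets of
  the \<open>K\<^sub>m\<close>, form countably many labelled points in each \<open>Y\<^sub>m\<close> with mutual distances bounded in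
  \<open>m\<close>. Along a subsequence these distances converge, and the \<open>Y\<^sub>m\<close> can be glued inside a space of
  bounded functions so that each labelled point converges. The step maps then converge, hence so
  do the \<open>u\<^sub>m\<close>, and the closure of the union of the embedded \<open>K\<^sub>m\<close> is compact. A Hajlasz gradient
  of the limit arises as an almost everywhere limit of convex combinations of gradients of the
  \<open>u\<^sub>m\<close>.
\<close>

section \<open>Gluing metric spaces\<close>

abbreviation bounded_functions :: "'a set \<Rightarrow> ('a \<Rightarrow> real) metric" where
  "bounded_functions S \<equiv> funspace S euclidean_metric"

lemma mspace_bounded_functions_iff:
  "f \<in> mspace (bounded_functions S) \<longleftrightarrow> f \<in> extensional S \<and> (\<exists>B. \<forall>x\<in>S. \<bar>f x\<bar> \<le> B)"
proof -
  have "Met_TC.mbounded (f ` S) \<longleftrightarrow> (\<exists>B. \<forall>x\<in>S. \<bar>f x\<bar> \<le> B)"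
    using bounded_iff[of "f ` S"] by (simp add: mbounded_iff_bounded)
  then show ?thesis
    by (simp add: Met_TC.fspace_def)
qed

lemma mdist_bounded_functions_le:
  assumes "f \<in> mspace (bounded_functions S)" "g \<in> mspace (bounded_functions S)"
    and "S \<noteq> {}" "\<And>x. x \<in> S \<Longrightarrow> \<bar>f x - g x\<bar> \<le> a"
  shows "mdist (bounded_functions S) f g \<le> a"
  using assms funspace_mdist_le[of f S euclidean_metric g a] by (simp add: dist_real_def)

lemma abs_diff_le_mdist_bounded_functions:
  assumes "f \<in> mspace (bounded_functions S)" "g \<in> mspace (bounded_functions S)" "x \<in> S"
  shows "\<bar>f x - g x\<bar> \<le> mdist (bounded_functions S) f g"
  using assms funspace_mdist_le[of f S euclidean_metric g "mdist (bounded_functions S) f g"]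
  by (auto simp add: dist_real_def)

lemma mcomplete_of_bounded_functions: "mcomplete_of (bounded_functions S)"
proof -
  have "Met_TC.mcomplete (TYPE(real))"
    by (simp add: mcomplete_iff_complete complete_UNIV)
  then have "mcomplete_of (funspace S (Met_TC.Self :: real metric))"
    by (rule Met_TC.mcomplete_funspace)
  then show ?thesis
    by (simp add: euclidean_metric_def Met_TC.Self_def)
qed

lemma mdist_self: "x \<in> mspace Z \<Longrightarrow> mdist Z x x = 0"
  by simp

lemma isometric_embedding_mspace:
  "isometric_embedding Y Z \<phi> \<Longrightarrow> y \<in> mspace Y \<Longrightarrow> \<phi> y \<in> mspace Z"
  by (auto simp: isometric_embedding_def)

lemma isometric_embedding_mdist:
  "isometric_embedding Y Z \<phi> \<Longrightarrow> y \<in> mspace Y \<Longrightarrow> y' \<in> mspace Y \<Longrightarrow>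
    mdist Z (\<phi> y) (\<phi> y') = mdist Y y y'"
  by (simp add: isometric_embedding_def)

text \<open>The point \<open>p m a\<close> of \<open>Y m\<close> is joined to the point \<open>a\<close> of the pseudometric space \<open>('l, D)\<close> by a
  segment of length \<open>\<eta> m a\<close>. The bound on the defect says that this creates no shortcuts.\<close>

locale metric_correspondence =
  fixes Y :: "'i \<Rightarrow> 'y metric" and p :: "'i \<Rightarrow> 'l \<Rightarrow> 'y"
    and D :: "'l \<Rightarrow> 'l \<Rightarrow> real" and \<eta> :: "'i \<Rightarrow> 'l \<Rightarrow> real"
  assumes point_in: "p m a \<in> mspace (Y m)"
    and D_self: "D a a = 0" and D_commute: "D a b = D b a" and D_triangle: "D a c \<le> D a b + D b c"
    and defect: "\<bar>mdist (Y m) (p m a) (p m b) - D a b\<bar> \<le> \<eta> m a + \<eta> m b"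
begin

lemma D_nonneg: "0 \<le> D a b"
  using D_triangle[of a a b] D_self[of a] D_commute[of a b] by simp

lemma segment_nonneg: "0 \<le> \<eta> m a"
  using defect[of m a a] by simp

definition dist_label :: "'i \<Rightarrow> 'y \<Rightarrow> 'l \<Rightarrow> real" where
  "dist_label m y l = (INF a. mdist (Y m) y (p m a) + \<eta> m a + D a l)"

lemma dist_label_le: "dist_label m y l \<le> mdist (Y m) y (p m a) + \<eta> m a + D a l"
proof -
  have "bdd_below (range (\<lambda>a. mdist (Y m) y (p m a) + \<eta> m a + D a l))"
    by (rule bdd_belowI[of _ 0]) (auto intro!: add_nonneg_nonneg segment_nonneg D_nonneg)
  then show ?thesis
    unfolding dist_label_def by (rule cINF_lower) simp
qed

lemma dist_label_greatest:
  "(\<And>a. c \<le> mdist (Y m) y (p m a) + \<eta> m a + D a l) \<Longrightarrow> c \<le> dist_label m y l"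
  unfolding dist_label_def by (rule cINF_greatest) auto

lemma dist_label_nonneg: "0 \<le> dist_label m y l"
  by (rule dist_label_greatest) (auto intro!: add_nonneg_nonneg segment_nonneg D_nonneg)

lemma dist_label_triangle_label: "dist_label m y l \<le> dist_label m y l' + D l l'"
proof -
  have "dist_label m y l - D l l' \<le> dist_label m y l'"
  proof (rule dist_label_greatest)
    fix a show "dist_label m y l - D l l' \<le> mdist (Y m) y (p m a) + \<eta> m a + D a l'"
      using dist_label_le[of m y l a] D_triangle[of a l l'] D_commute[of l l'] by linarith
  qed
  then show ?thesis by simp
qed

lemma dist_label_triangle:
  assumes "y \<in> mspace (Y m)" "y' \<in> mspace (Y m)"
  shows "dist_label m y l \<le> dist_label m y' l + mdist (Y m) y y'"
proof -
  have "dist_label m y l - mdist (Y m) y y' \<le> dist_label m y' l"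
  proof (rule dist_label_greatest)
    fix a show "dist_label m y l - mdist (Y m) y y' \<le> mdist (Y m) y' (p m a) + \<eta> m a + D a l"
      using dist_label_le[of m y l a] mdist_triangle[OF assms point_in, of a] by linarith
  qed
  then show ?thesis by simp
qed

lemma D_le_dist_label_add:
  assumes y: "y \<in> mspace (Y m)"
  shows "D l l' \<le> dist_label m y l + dist_label m y l'"
proof -
  have "D l l' - (mdist (Y m) y (p m a) + \<eta> m a + D a l) \<le> dist_label m y l'" for a
  proof (rule dist_label_greatest)
    fix b
    show "D l l' - (mdist (Y m) y (p m a) + \<eta> m a + D a l) \<le> mdist (Y m) y (p m b) + \<eta> m b + D b l'"
      using D_triangle[of l l' a] D_triangle[of a l' b] D_commute[of a l] defect[of m a b]
        mdist_triangle[OF point_in y point_in, of a b] mdist_commute[of "Y m" y "p m a"] by linarith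
  qed
  then have "D l l' - dist_label m y l' \<le> dist_label m y l"
    by (intro dist_label_greatest) (simp add: algebra_simps)
  then show ?thesis by simp
qed

lemma mdist_le_dist_label_add:
  assumes "y \<in> mspace (Y m)" "y' \<in> mspace (Y m)"
  shows "mdist (Y m) y y' \<le> dist_label m y l + dist_label m y' l"
proof -
  have "mdist (Y m) y y' - (mdist (Y m) y (p m a) + \<eta> m a + D a l) \<le> dist_label m y' l" for a
  proof (rule dist_label_greatest)
    fix b
    show "mdist (Y m) y y' - (mdist (Y m) y (p m a) + \<eta> m a + D a l)
        \<le> mdist (Y m) y' (p m b) + \<eta> m b + D b l"
      using mdist_triangle[OF assms(1) point_in assms(2), of a] defect[of m a b]
        mdist_triangle[OF point_in point_in assms(2), of a b] D_triangle[of a b l] D_commute[of b l]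
        mdist_commute[of "Y m" y' "p m b"] by linarith
  qed
  then have "mdist (Y m) y y' - dist_label m y' l \<le> dist_label m y l"
    by (intro dist_label_greatest) (simp add: algebra_simps)
  then show ?thesis by simp
qed

definition glued_dist :: "'i \<Rightarrow> 'y \<Rightarrow> 'i \<Rightarrow> 'y \<Rightarrow> real" where
  "glued_dist m z n y =
     (if n = m then mdist (Y m) z y else (INF l. dist_label m z l + dist_label n y l))"

lemma glued_dist_le:
  assumes "n \<noteq> m" shows "glued_dist m z n y \<le> dist_label m z l + dist_label n y l"
proof -
  have "bdd_below (range (\<lambda>l. dist_label m z l + dist_label n y l))"
    by (rule bdd_belowI[of _ 0]) (auto intro!: add_nonneg_nonneg dist_label_nonneg)
  then show ?thesis
    using assms unfolding glued_dist_def by (auto intro: cINF_lower)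
qed

lemma glued_dist_greatest:
  "n \<noteq> m \<Longrightarrow> (\<And>l. c \<le> dist_label m z l + dist_label n y l) \<Longrightarrow> c \<le> glued_dist m z n y"
  unfolding glued_dist_def by (auto intro!: cINF_greatest)

lemma glued_dist_triangle:
  assumes "z \<in> mspace (Y m)" "z' \<in> mspace (Y m)" "y \<in> mspace (Y n)"
  shows "glued_dist m z n y \<le> glued_dist m z' n y + mdist (Y m) z z'"
proof (cases "n = m")
  case True
  then show ?thesis
    using mdist_triangle[of z "Y m" z' y] assms by (simp add: glued_dist_def)
next
  case False
  have "glued_dist m z n y - mdist (Y m) z z' \<le> glued_dist m z' n y"
  proof (rule glued_dist_greatest[OF False])
    fix l show "glued_dist m z n y - mdist (Y m) z z' \<le> dist_label m z' l + dist_label n y l"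
      using glued_dist_le[OF False, of z y l] dist_label_triangle[OF assms(1,2), of l] by linarith
  qed
  then show ?thesis by simp
qed

lemma abs_glued_dist_diff_dist_label_le:
  assumes "z \<in> mspace (Y m)" "y \<in> mspace (Y n)"
  shows "\<bar>glued_dist m z n y - dist_label n y l\<bar> \<le> dist_label m z l"
proof (cases "n = m")
  case True
  then show ?thesis
    using assms mdist_le_dist_label_add[of z m y l] dist_label_triangle[of y m z l]
      mdist_commute[of "Y m" y z] by (simp add: glued_dist_def)
next
  case False
  have "dist_label n y l - dist_label m z l \<le> glued_dist m z n y"
  proof (rule glued_dist_greatest[OF False])
    fix l' show "dist_label n y l - dist_label m z l \<le> dist_label m z l' + dist_label n y l'"
      using D_le_dist_label_add[OF assms(1), of l l'] dist_label_triangle_label[of n y l l']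
      by linarith
  qed
  then show ?thesis using glued_dist_le[OF False, of z y l] by linarith
qed

text \<open>The Kuratowski embedding of the glued space, based at the label \<open>undefined\<close>.\<close>

definition coordinates :: "('i \<times> 'y) set" where
  "coordinates = (SIGMA m:UNIV. mspace (Y m))"

definition glued_embedding :: "'i \<Rightarrow> 'y \<Rightarrow> 'i \<times> 'y \<Rightarrow> real" where
  "glued_embedding m z =
     restrict (\<lambda>(n, y). glued_dist m z n y - dist_label n y undefined) coordinates"

definition label_point :: "'l \<Rightarrow> 'i \<times> 'y \<Rightarrow> real" where
  "label_point l = restrict (\<lambda>(n, y). dist_label n y l - dist_label n y undefined) coordinates"

lemma coordinates_nonempty: "coordinates \<noteq> {}"
  using point_in by (auto simp: coordinates_def)

lemma glued_embedding_in_bounded_functions: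
  "z \<in> mspace (Y m) \<Longrightarrow> glued_embedding m z \<in> mspace (bounded_functions coordinates)"
  unfolding mspace_bounded_functions_iff
  using abs_glued_dist_diff_dist_label_le[of z m _ _ undefined]
  by (auto simp: glued_embedding_def coordinates_def)

lemma label_point_in_bounded_functions: "label_point l \<in> mspace (bounded_functions coordinates)"
  unfolding mspace_bounded_functions_iff
proof (intro conjI exI ballI)
  fix x assume x: "x \<in> coordinates"
  obtain n y where "x = (n, y)" by fastforce
  then show "\<bar>label_point l x\<bar> \<le> D l undefined"
    using dist_label_triangle_label[of n y l undefined]
      dist_label_triangle_label[of n y undefined l]
      D_commute[of l undefined] x by (simp add: label_point_def abs_le_iff)
qed (simp add: label_point_def)

lemma isometric_embedding_glued_embedding:
  "isometric_embedding (Y m) (bounded_functions coordinates) (glued_embedding m)"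
  unfolding isometric_embedding_def
proof (intro conjI ballI)
  show "glued_embedding m ` mspace (Y m) \<subseteq> mspace (bounded_functions coordinates)"
    using glued_embedding_in_bounded_functions by auto
  fix z z' assume z: "z \<in> mspace (Y m)" "z' \<in> mspace (Y m)"
  note embed_in = glued_embedding_in_bounded_functions[OF z(1)]
      glued_embedding_in_bounded_functions[OF z(2)]
  show "mdist (bounded_functions coordinates) (glued_embedding m z) (glued_embedding m z') =
      mdist (Y m) z z'"
  proof (rule antisym)
    show "mdist (bounded_functions coordinates) (glued_embedding m z) (glued_embedding m z')
        \<le> mdist (Y m) z z'"
    proof (rule mdist_bounded_functions_le[OF embed_in coordinates_nonempty])
      fix x assume "x \<in> coordinates"
      then obtain n y where x: "x = (n, y)" "y \<in> mspace (Y n)" by (auto simp: coordinates_def)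
      show "\<bar>glued_embedding m z x - glued_embedding m z' x\<bar> \<le> mdist (Y m) z z'"
        using glued_dist_triangle[OF z x(2)] glued_dist_triangle[OF z(2,1) x(2)]
          mdist_commute[of "Y m" z z'] \<open>x \<in> coordinates\<close>
            by (simp add: glued_embedding_def x(1) abs_le_iff)
    qed
    have "(m, z') \<in> coordinates" using z by (simp add: coordinates_def)
    then show "mdist (Y m) z z'
        \<le> mdist (bounded_functions coordinates) (glued_embedding m z) (glued_embedding m z')"
      using abs_diff_le_mdist_bounded_functions[OF embed_in, of "(m, z')"] mdist_self[OF z(2)]
      by (simp add: glued_embedding_def glued_dist_def)
  qed
qed

lemma mdist_glued_embedding_label_point_le:
  "mdist (bounded_functions coordinates) (glued_embedding m (p m a)) (label_point a) \<le> \<eta> m a"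
proof -
  have "mdist (bounded_functions coordinates) (glued_embedding m (p m a)) (label_point a)
      \<le> dist_label m (p m a) a"
  proof (rule mdist_bounded_functions_le[OF glued_embedding_in_bounded_functions[OF point_in]
        label_point_in_bounded_functions coordinates_nonempty])
    fix x assume "x \<in> coordinates"
    then obtain n y where x: "x = (n, y)" "y \<in> mspace (Y n)" by (auto simp: coordinates_def)
    show "\<bar>glued_embedding m (p m a) x - label_point a x\<bar> \<le> dist_label m (p m a) a"
      using abs_glued_dist_diff_dist_label_le[OF point_in x(2)] \<open>x \<in> coordinates\<close>
      by (simp add: glued_embedding_def label_point_def x(1))
  qed
  also have "\<dots> \<le> \<eta> m a"
    using dist_label_le[of m "p m a" a a] by (simp add: mdist_self[OF point_in] D_self)
  finally show ?thesis .
qed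

end

lemma gluing_along_converging_distances:
  fixes Y :: "nat \<Rightarrow> 'y metric" and p :: "nat \<Rightarrow> 'l::countable \<Rightarrow> 'y"
  assumes p: "\<And>m a. p m a \<in> mspace (Y m)"
    and lim: "\<And>a b. (\<lambda>m. mdist (Y m) (p m a) (p m b)) \<longlonglongrightarrow> D a b"
  obtains Z :: "(nat \<times> 'y \<Rightarrow> real) metric" and \<phi> \<psi> where "mcomplete_of Z"
    "\<And>m. isometric_embedding (Y m) Z (\<phi> m)" "\<And>a. \<psi> a \<in> mspace Z"
    "\<And>a. (\<lambda>m. mdist Z (\<phi> m (p m a)) (\<psi> a)) \<longlonglongrightarrow> 0"
proof -
  define \<eta> where "\<eta> m a = (\<Sum>b | to_nat b \<le> to_nat a. \<bar>mdist (Y m) (p m a) (p m b) - D a b\<bar>)" for m a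
  have D_commute: "D a b = D b a" for a b
    using LIMSEQ_unique[OF lim[of a b]] lim[of b a] by (simp add: mdist_commute)
  have \<eta>_lim: "(\<lambda>m. \<eta> m a) \<longlonglongrightarrow> 0" for a
  proof -
    have "(\<lambda>m. \<eta> m a) \<longlonglongrightarrow> (\<Sum>b | to_nat b \<le> to_nat a. \<bar>D a b - D a b\<bar>)"
      unfolding \<eta>_def by (intro tendsto_intros lim)
    then show ?thesis by simp
  qed
  interpret metric_correspondence Y p D \<eta>
  proof
    show "D a a = 0" for a
      using LIMSEQ_unique[OF lim[of a a]] by (simp add: mdist_self[OF p])
    show "D a c \<le> D a b + D b c" for a b c
      by (rule LIMSEQ_le[OF lim[of a c] tendsto_add[OF lim[of a b] lim[of b c]]])
        (auto intro: mdist_triangle p)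
    fix m a b
    have finite_below: "finite {b :: 'l. to_nat b \<le> N}" for N
      using finite_vimageI[OF finite_atMost inj_to_nat, of N] by (simp add: vimage_def)
    have le_\<eta>: "\<bar>mdist (Y m) (p m a) (p m b) - D a b\<bar> \<le> \<eta> m a" if "to_nat b \<le> to_nat a" for a b
      unfolding \<eta>_def by (rule member_le_sum) (use that finite_below in auto)
    have \<eta>_nonneg: "0 \<le> \<eta> m a" for a
      by (simp add: \<eta>_def sum_nonneg)
    show "\<bar>mdist (Y m) (p m a) (p m b) - D a b\<bar> \<le> \<eta> m a + \<eta> m b"
      using le_\<eta>[of a b] le_\<eta>[of b a] \<eta>_nonneg[of a] \<eta>_nonneg[of b]
        mdist_commute[of "Y m" "p m a" "p m b"] D_commute[of a b]
      by (cases "to_nat b \<le> to_nat a") auto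
  qed (rule p D_commute)+
  show ?thesis
  proof
    show "(\<lambda>m. mdist (bounded_functions coordinates) (glued_embedding m (p m a)) (label_point a))
        \<longlonglongrightarrow> 0" for a
      by (rule tendsto_sandwich[OF _ _ tendsto_const \<eta>_lim])
        (auto intro!: always_eventually mdist_glued_embedding_label_point_le
          simp del: mdist_funspace)
  qed (rule mcomplete_of_bounded_functions isometric_embedding_glued_embedding
      label_point_in_bounded_functions)+
qed

lemma bounded_family_convergent_subseq:
  fixes f :: "nat \<Rightarrow> 'l::countable \<Rightarrow> real"
  assumes "\<And>l. \<exists>B. \<forall>m. \<bar>f m l\<bar> \<le> B"
  obtains \<sigma> :: "nat \<Rightarrow> nat" and F where "strict_mono \<sigma>" "\<And>l. (\<lambda>k. f (\<sigma> k) l) \<longlonglongrightarrow> F l"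
proof -
  obtain B where B: "\<And>l m. \<bar>f m l\<bar> \<le> B l" using assms by metis
  have "compact (PiE UNIV (\<lambda>l. {- B l..B l}))"
    using compactin_PiE[of "\<lambda>_. euclidean" UNIV "\<lambda>l. {- B l..B l}"]
    by (simp add: euclidean_product_topology)
  moreover have "f m \<in> PiE UNIV (\<lambda>l. {- B l..B l})" for m
    using B[of m] by (auto simp: abs_le_iff minus_le_iff)
  ultimately obtain F \<sigma> where \<sigma>: "strict_mono \<sigma>" and lim: "(f \<circ> \<sigma>) \<longlonglongrightarrow> F"
    using compact_imp_seq_compact seq_compactE by metis
  have "(\<lambda>k. f (\<sigma> k) l) \<longlonglongrightarrow> F l" for l
    using continuous_on_tendsto_compose[OF continuous_on_product_coordinates lim, of l] by simp
  then show ?thesis using that \<sigma> by blast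
qed

lemma gluing_subsequence:
  fixes Y :: "nat \<Rightarrow> 'y metric" and p :: "nat \<Rightarrow> 'l::countable \<Rightarrow> 'y"
  assumes p: "\<And>m a. p m a \<in> mspace (Y m)"
    and bounded: "\<And>a b. \<exists>B. \<forall>m. mdist (Y m) (p m a) (p m b) \<le> B"
  obtains \<sigma> :: "nat \<Rightarrow> nat" and Z :: "(nat \<times> 'y \<Rightarrow> real) metric" and \<phi> \<psi> where
    "strict_mono \<sigma>" "mcomplete_of Z" "\<And>k. isometric_embedding (Y (\<sigma> k)) Z (\<phi> k)"
    "\<And>a. \<psi> a \<in> mspace Z" "\<And>a. (\<lambda>k. mdist Z (\<phi> k (p (\<sigma> k) a)) (\<psi> a)) \<longlonglongrightarrow> 0"
proof -
  have "\<exists>B. \<forall>m. \<bar>case ab of (a, b) \<Rightarrow> mdist (Y m) (p m a) (p m b)\<bar> \<le> B" for ab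
    using bounded by (cases ab) auto
  then obtain \<sigma> :: "nat \<Rightarrow> nat" and D where \<sigma>: "strict_mono \<sigma>"
    and D: "\<And>ab. (\<lambda>k. case ab of (a, b) \<Rightarrow> mdist (Y (\<sigma> k)) (p (\<sigma> k) a) (p (\<sigma> k) b)) \<longlonglongrightarrow> D ab"
    by (rule bounded_family_convergent_subseq[of "\<lambda>m (a, b). mdist (Y m) (p m a) (p m b)"])
      (rule that)
  have "(\<lambda>k. mdist (Y (\<sigma> k)) (p (\<sigma> k) a) (p (\<sigma> k) b)) \<longlonglongrightarrow> D (a, b)" for a b
    using D[of "(a, b)"] by simp
  from p this show ?thesis
    by (rule gluing_along_converging_distances[of "\<lambda>k. p (\<sigma> k)" "\<lambda>k. Y (\<sigma> k)"]) (rule that[OF \<sigma>])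
qed

section \<open>The Luxemburg norm\<close>

lemma N_function_nonneg: "N_function \<Phi> \<Longrightarrow> 0 \<le> \<Phi> x"
  by (simp add: N_function_def)

lemma N_function_zero: "N_function \<Phi> \<Longrightarrow> \<Phi> 0 = 0"
  by (simp add: N_function_def)

lemma N_function_pos: "N_function \<Phi> \<Longrightarrow> x \<noteq> 0 \<Longrightarrow> 0 < \<Phi> x"
  unfolding N_function_def by (metis less_eq_real_def)

lemma N_function_abs: "N_function \<Phi> \<Longrightarrow> \<Phi> \<bar>x\<bar> = \<Phi> x"
  by (simp add: N_function_def abs_if)

lemma N_function_convex:
  assumes "N_function \<Phi>" "0 \<le> t" "t \<le> 1"
  shows "\<Phi> ((1 - t) * x + t * y) \<le> (1 - t) * \<Phi> x + t * \<Phi> y"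
proof -
  have "convex_on UNIV \<Phi>" using assms(1) by (simp add: N_function_def)
  then show ?thesis using convex_onD[of UNIV \<Phi> t x y] assms(2,3) by simp
qed

lemma N_function_scale:
  assumes "N_function \<Phi>" "0 \<le> t" "t \<le> 1"
  shows "\<Phi> (t * x) \<le> t * \<Phi> x"
  using N_function_convex[OF assms, of 0 x] by (simp add: N_function_zero[OF assms(1)])

lemma N_function_mono:
  assumes \<Phi>: "N_function \<Phi>" and abs_le: "\<bar>a\<bar> \<le> \<bar>b\<bar>"
  shows "\<Phi> a \<le> \<Phi> b"
proof (cases "b = 0")
  case False
  have "\<Phi> (\<bar>a\<bar> / \<bar>b\<bar> * \<bar>b\<bar>) \<le> \<bar>a\<bar> / \<bar>b\<bar> * \<Phi> \<bar>b\<bar>"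
    using abs_le False by (intro N_function_scale[OF \<Phi>]) auto
  also have "\<dots> \<le> 1 * \<Phi> \<bar>b\<bar>"
    using abs_le False by (intro mult_right_mono N_function_nonneg[OF \<Phi>]) auto
  finally show ?thesis using False by (simp add: N_function_abs[OF \<Phi>])
qed (use abs_le in auto)

lemma N_function_linear_bound:
  assumes \<Phi>: "N_function \<Phi>"
  shows "\<bar>t\<bar> \<le> 1 + \<Phi> t / \<Phi> 1"
proof (cases "\<bar>t\<bar> \<le> 1")
  case True
  have "0 \<le> \<Phi> t / \<Phi> 1" by (simp add: N_function_nonneg[OF \<Phi>])
  then show ?thesis using True by linarith
next
  case False
  have "\<Phi> (1 / \<bar>t\<bar> * \<bar>t\<bar>) \<le> 1 / \<bar>t\<bar> * \<Phi> \<bar>t\<bar>"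
    using False by (intro N_function_scale[OF \<Phi>]) auto
  then have "\<bar>t\<bar> \<le> \<Phi> t / \<Phi> 1"
    using False N_function_pos[OF \<Phi>, of 1] N_function_abs[OF \<Phi>, of t]
    by (simp add: field_simps split: if_splits)
  then show ?thesis by simp
qed

lemma N_function_bound_of_mass:
  assumes \<Phi>: "N_function \<Phi>" and "0 < c" "0 < m" and mass: "\<Phi> (t / c) * m \<le> 1"
  shows "\<bar>t\<bar> \<le> c * (1 + 1 / (\<Phi> 1 * m))"
proof -
  have "\<Phi> (t / c) / \<Phi> 1 \<le> 1 / m / \<Phi> 1"
    using mass \<open>0 < m\<close>
    by (intro divide_right_mono N_function_nonneg[OF \<Phi>]) (simp add: pos_le_divide_eq)
  then have "\<bar>t / c\<bar> \<le> 1 + 1 / (\<Phi> 1 * m)"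
    using N_function_linear_bound[OF \<Phi>, of "t / c"] by (simp add: mult.commute)
  then show ?thesis using \<open>0 < c\<close> by (simp add: pos_divide_le_eq mult.commute)
qed

lemma N_function_isCont: "N_function \<Phi> \<Longrightarrow> isCont \<Phi> t"
  by (simp add: N_function_def continuous_on_eq_continuous_at)

lemma N_function_measurable: "N_function \<Phi> \<Longrightarrow> \<Phi> \<in> borel_measurable borel"
  by (intro borel_measurable_continuous_onI) (simp add: N_function_def)

definition modular :: "'a measure \<Rightarrow> (real \<Rightarrow> real) \<Rightarrow> ('a \<Rightarrow> real) \<Rightarrow> ennreal" where
  "modular M \<Phi> f = (\<integral>\<^sup>+x. ennreal (\<Phi> (f x)) \<partial>M)"

lemma modular_mono:
  assumes "N_function \<Phi>" "AE x in M. \<bar>f x\<bar> \<le> \<bar>g x\<bar>"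
  shows "modular M \<Phi> f \<le> modular M \<Phi> g"
  unfolding modular_def using assms(2)
  by (intro nn_integral_mono_AE)
    (auto elim!: eventually_mono intro!: ennreal_leI N_function_mono[OF assms(1)])

lemma modular_convex:
  assumes \<Phi>: "N_function \<Phi>" and f: "f \<in> borel_measurable M" and g: "g \<in> borel_measurable M"
    and t: "0 \<le> t" "t \<le> 1"
  shows "modular M \<Phi> (\<lambda>x. (1 - t) * f x + t * g x)
    \<le> ennreal (1 - t) * modular M \<Phi> f + ennreal t * modular M \<Phi> g"
proof -
  note [measurable] = N_function_measurable[OF \<Phi>] f g
  have "modular M \<Phi> (\<lambda>x. (1 - t) * f x + t * g x)
      \<le> (\<integral>\<^sup>+x. ennreal (1 - t) * ennreal (\<Phi> (f x)) + ennreal t * ennreal (\<Phi> (g x)) \<partial>M)"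
    unfolding modular_def
  proof (rule nn_integral_mono)
    fix x
    have "ennreal (\<Phi> ((1 - t) * f x + t * g x)) \<le> ennreal ((1 - t) * \<Phi> (f x) + t * \<Phi> (g x))"
      by (rule ennreal_leI[OF N_function_convex[OF \<Phi> t]])
    also have "\<dots> = ennreal (1 - t) * ennreal (\<Phi> (f x)) + ennreal t * ennreal (\<Phi> (g x))"
      using t by (simp add: ennreal_plus ennreal_mult N_function_nonneg[OF \<Phi>])
    finally show "ennreal (\<Phi> ((1 - t) * f x + t * g x)) \<le> \<dots>" .
  qed
  also have "\<dots> = ennreal (1 - t) * modular M \<Phi> f + ennreal t * modular M \<Phi> g"
    unfolding modular_def by (simp add: nn_integral_add nn_integral_cmult)
  finally show ?thesis .
qed

lemma modular_convex_le_one: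
  assumes "N_function \<Phi>" "f \<in> borel_measurable M" "g \<in> borel_measurable M" "0 \<le> t" "t \<le> 1"
    and "modular M \<Phi> f \<le> 1" "modular M \<Phi> g \<le> 1"
  shows "modular M \<Phi> (\<lambda>x. (1 - t) * f x + t * g x) \<le> 1"
proof -
  have "modular M \<Phi> (\<lambda>x. (1 - t) * f x + t * g x)
      \<le> ennreal (1 - t) * modular M \<Phi> f + ennreal t * modular M \<Phi> g"
    by (rule modular_convex[OF assms(1-5)])
  also have "\<dots> \<le> ennreal (1 - t) * 1 + ennreal t * 1"
    by (intro add_mono mult_left_mono assms) auto
  also have "\<dots> = 1" using assms(4,5) by (simp flip: ennreal_plus)
  finally show ?thesis .
qed

lemma modular_scale:
  assumes "N_function \<Phi>" "f \<in> borel_measurable M" "0 \<le> t" "t \<le> 1"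
  shows "modular M \<Phi> (\<lambda>x. t * f x) \<le> ennreal t * modular M \<Phi> f"
  using modular_convex[OF assms(1) _ assms(2-4), of "\<lambda>_. 0"]
  by (simp add: modular_def N_function_zero[OF assms(1)])

lemma modular_Fatou:
  assumes \<Phi>: "N_function \<Phi>" and f: "\<And>n. f n \<in> borel_measurable M"
    and lim: "AE x in M. (\<lambda>n. f n x) \<longlonglongrightarrow> F x"
    and modular_le: "\<forall>\<^sub>F n in sequentially. modular M \<Phi> (f n) \<le> C"
  shows "modular M \<Phi> F \<le> C"
proof -
  note [measurable] = N_function_measurable[OF \<Phi>] f
  have "modular M \<Phi> F \<le> (\<integral>\<^sup>+x. liminf (\<lambda>n. ennreal (\<Phi> (f n x))) \<partial>M)"
    unfolding modular_def
  proof (rule nn_integral_mono_AE, use lim in eventually_elim)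
    case (elim x)
    have "(\<lambda>n. ennreal (\<Phi> (f n x))) \<longlonglongrightarrow> ennreal (\<Phi> (F x))"
      by (intro tendsto_ennrealI isCont_tendsto_compose[OF N_function_isCont[OF \<Phi>] elim])
    then show ?case by (simp add: lim_imp_Liminf)
  qed
  also have "\<dots> \<le> liminf (\<lambda>n. modular M \<Phi> (f n))"
    unfolding modular_def by (rule nn_integral_liminf) measurable
  also have "\<dots> \<le> C"
    using modular_le by (intro Liminf_le) auto
  finally show ?thesis .
qed

definition luxemburg_norm :: "'a measure \<Rightarrow> (real \<Rightarrow> real) \<Rightarrow> ('a \<Rightarrow> real) \<Rightarrow> ennreal" where
  "luxemburg_norm M \<Phi> f = (INF k \<in> {k. 0 < k \<and> modular M \<Phi> (\<lambda>x. f x / k) \<le> 1}. ennreal k)"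

lemma lux_norm_eq_luxemburg_norm:
  assumes \<Phi>: "N_function \<Phi>" and \<Omega>: "\<Omega> \<in> sets \<mu>"
  shows "lux_norm \<mu> \<Omega> \<Phi> f = luxemburg_norm (restrict_space \<mu> \<Omega>) \<Phi> f"
proof -
  have "(\<integral>\<^sup>+x\<in>\<Omega>. ennreal (\<Phi> (\<bar>f x\<bar> / k)) \<partial>\<mu>) = modular (restrict_space \<mu> \<Omega>) \<Phi> (\<lambda>x. f x / k)"
    if "0 < k" for k
    using that N_function_abs[OF \<Phi>, of "f _ / k"] \<Omega>
    by (simp add: modular_def nn_integral_restrict_space)
  then show ?thesis
    unfolding lux_norm_def luxemburg_norm_def by (intro INF_cong) auto
qed

lemma luxemburg_norm_le_of_modular:
  "0 < k \<Longrightarrow> modular M \<Phi> (\<lambda>x. f x / k) \<le> 1 \<Longrightarrow> luxemburg_norm M \<Phi> f \<le> ennreal k"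
  unfolding luxemburg_norm_def by (rule INF_lower) simp

lemma luxemburg_norm_leI:
  assumes "\<And>k. 0 < k \<Longrightarrow> C < ennreal k \<Longrightarrow> modular M \<Phi> (\<lambda>x. f x / k) \<le> 1"
  shows "luxemburg_norm M \<Phi> f \<le> C"
proof (rule dense_ge)
  fix c assume "C < c"
  then obtain c' where c': "C < c'" "c' < c" using dense by blast
  then obtain k where "c' = ennreal k" "0 \<le> k" by (cases c') auto
  with c' show "luxemburg_norm M \<Phi> f \<le> c"
    using luxemburg_norm_le_of_modular[of k M \<Phi> f] assms[of k]
    by (metis ennreal_0 le_less not_less_zero order_trans)
qed

lemma modular_le_one_of_luxemburg_norm_less:
  assumes \<Phi>: "N_function \<Phi>" and "luxemburg_norm M \<Phi> f < ennreal k"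
  shows "modular M \<Phi> (\<lambda>x. f x / k) \<le> 1"
proof -
  obtain l where l: "0 < l" "modular M \<Phi> (\<lambda>x. f x / l) \<le> 1" "l < k"
    using assms(2) unfolding luxemburg_norm_def by (auto simp: INF_less_iff ennreal_less_iff)
  then have "modular M \<Phi> (\<lambda>x. f x / k) \<le> modular M \<Phi> (\<lambda>x. f x / l)"
    by (intro modular_mono[OF \<Phi>] AE_I2) (auto simp: abs_divide intro!: divide_left_mono)
  then show ?thesis using l(2) by simp
qed

lemma modular_le_inverse_of_luxemburg_norm_less:
  assumes \<Phi>: "N_function \<Phi>" and f: "f \<in> borel_measurable M"
    and less: "luxemburg_norm M \<Phi> f < ennreal k"
    and t: "1 \<le> t"
  shows "modular M \<Phi> (\<lambda>x. f x / (t * k)) \<le> ennreal (1 / t)"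
proof -
  have "modular M \<Phi> (\<lambda>x. 1 / t * (f x / k)) \<le> ennreal (1 / t) * modular M \<Phi> (\<lambda>x. f x / k)"
    using f t by (intro modular_scale[OF \<Phi>]) auto
  also have "\<dots> \<le> ennreal (1 / t) * 1"
    by (intro mult_left_mono modular_le_one_of_luxemburg_norm_less[OF \<Phi> less]) simp
  finally show ?thesis by simp
qed

lemma luxemburg_norm_mono:
  assumes \<Phi>: "N_function \<Phi>" and abs_le: "AE x in M. \<bar>f x\<bar> \<le> \<bar>g x\<bar>"
  shows "luxemburg_norm M \<Phi> f \<le> luxemburg_norm M \<Phi> g"
proof (rule luxemburg_norm_leI)
  fix k :: real assume k: "0 < k" "luxemburg_norm M \<Phi> g < ennreal k"
  have "AE x in M. \<bar>f x / k\<bar> \<le> \<bar>g x / k\<bar>"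
    using abs_le k(1) by (auto elim!: eventually_mono intro!: divide_right_mono simp: abs_divide)
  then have "modular M \<Phi> (\<lambda>x. f x / k) \<le> modular M \<Phi> (\<lambda>x. g x / k)"
    by (rule modular_mono[OF \<Phi>])
  also have "\<dots> \<le> 1" by (rule modular_le_one_of_luxemburg_norm_less[OF \<Phi> k(2)])
  finally show "modular M \<Phi> (\<lambda>x. f x / k) \<le> 1" .
qed

lemma luxemburg_norm_triangle:
  assumes \<Phi>: "N_function \<Phi>" and f: "f \<in> borel_measurable M" and g: "g \<in> borel_measurable M"
    and abs_le: "AE x in M. \<bar>s x\<bar> \<le> \<bar>f x\<bar> + \<bar>g x\<bar>"
  shows "luxemburg_norm M \<Phi> s \<le> luxemburg_norm M \<Phi> f + luxemburg_norm M \<Phi> g"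
proof (rule luxemburg_norm_leI)
  fix k :: real
  assume k: "0 < k" and less: "luxemburg_norm M \<Phi> f + luxemburg_norm M \<Phi> g < ennreal k"
  obtain \<alpha> \<beta> where \<alpha>\<beta>: "luxemburg_norm M \<Phi> f = ennreal \<alpha>" "0 \<le> \<alpha>"
    "luxemburg_norm M \<Phi> g = ennreal \<beta>" "0 \<le> \<beta>"
    using less by (cases "luxemburg_norm M \<Phi> f"; cases "luxemburg_norm M \<Phi> g") auto
  then have "\<alpha> + \<beta> < k" using less by (simp add: ennreal_less_iff flip: ennreal_plus)
  define a b where "a = (k + \<alpha> - \<beta>) / 2" and "b = (k + \<beta> - \<alpha>) / 2"
  have ab: "\<alpha> < a" "\<beta> < b" "a + b = k"
    using \<open>\<alpha> + \<beta> < k\<close> by (simp_all add: a_def b_def field_simps)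
  have modular_ab: "modular M \<Phi> (\<lambda>x. \<bar>f x\<bar> / a) \<le> 1" "modular M \<Phi> (\<lambda>x. \<bar>g x\<bar> / b) \<le> 1"
    using ab \<alpha>\<beta> modular_le_one_of_luxemburg_norm_less[OF \<Phi>, of M f a]
      modular_le_one_of_luxemburg_norm_less[OF \<Phi>, of M g b]
      N_function_abs[OF \<Phi>, of "f _ / a"] N_function_abs[OF \<Phi>, of "g _ / b"]
    by (auto simp: ennreal_less_iff modular_def)
  have average: "(1 - b / k) * (\<bar>f x\<bar> / a) + b / k * (\<bar>g x\<bar> / b) = (\<bar>f x\<bar> + \<bar>g x\<bar>) / k" for x
  proof -
    have "1 - b / k = a / k" using ab k by (simp add: field_simps)
    then show ?thesis using ab \<alpha>\<beta> by (simp add: add_divide_distrib)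
  qed
  have "modular M \<Phi> (\<lambda>x. s x / k) \<le> modular M \<Phi> (\<lambda>x. (\<bar>f x\<bar> + \<bar>g x\<bar>) / k)"
    using abs_le k
    by (intro modular_mono[OF \<Phi>])
      (auto elim!: eventually_mono intro!: divide_right_mono simp: abs_divide)
  also have "\<dots> \<le> 1"
    unfolding average[symmetric] using f g ab \<alpha>\<beta> k
    by (intro modular_convex_le_one[OF \<Phi>] modular_ab) auto
  finally show "modular M \<Phi> (\<lambda>x. s x / k) \<le> 1" .
qed

lemma luxemburg_norm_Fatou:
  assumes \<Phi>: "N_function \<Phi>" and f: "\<And>n. f n \<in> borel_measurable M"
    and lim: "AE x in M. (\<lambda>n. f n x) \<longlonglongrightarrow> F x"
    and norm_le: "\<forall>\<^sub>F n in sequentially. luxemburg_norm M \<Phi> (f n) \<le> C"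
  shows "luxemburg_norm M \<Phi> F \<le> C"
proof (rule luxemburg_norm_leI)
  fix k :: real assume k: "0 < k" "C < ennreal k"
  show "modular M \<Phi> (\<lambda>x. F x / k) \<le> 1"
  proof (rule modular_Fatou[OF \<Phi>])
    show "(\<lambda>x. f n x / k) \<in> borel_measurable M" for n using f by simp
    show "AE x in M. (\<lambda>n. f n x / k) \<longlonglongrightarrow> F x / k"
      using lim k by (auto elim!: eventually_mono intro!: tendsto_intros)
    show "\<forall>\<^sub>F n in sequentially. modular M \<Phi> (\<lambda>x. f n x / k) \<le> 1"
      using norm_le
      by eventually_elim (use k in \<open>auto intro!: modular_le_one_of_luxemburg_norm_less[OF \<Phi>]\<close>)
  qed
qed

lemma (in finite_measure) luxemburg_norm_le_const:
  assumes \<Phi>: "N_function \<Phi>" and f: "\<And>x. x \<in> space M \<Longrightarrow> \<bar>f x\<bar> \<le> \<delta>" and "0 \<le> \<delta>"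
  shows "luxemburg_norm M \<Phi> f \<le> ennreal (\<delta> * (1 + \<Phi> 1 * measure M (space M)))"
proof (rule luxemburg_norm_leI)
  define A where "A = 1 + \<Phi> 1 * measure M (space M)"
  have A: "1 \<le> A" by (simp add: A_def N_function_nonneg[OF \<Phi>])
  fix k :: real assume k: "0 < k" "ennreal (\<delta> * (1 + \<Phi> 1 * measure M (space M))) < ennreal k"
  then have "\<delta> * A < k" using A \<open>0 \<le> \<delta>\<close> by (simp add: A_def ennreal_less_iff)
  have "modular M \<Phi> (\<lambda>x. f x / k) \<le> (\<integral>\<^sup>+x. ennreal (\<Phi> 1 / A) \<partial>M)"
    unfolding modular_def
  proof (rule nn_integral_mono, rule ennreal_leI)
    fix x assume "x \<in> space M"
    then have "\<bar>f x / k\<bar> \<le> \<delta> / k"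
      using k f by (auto simp: abs_divide intro!: divide_right_mono)
    also have "\<dots> \<le> 1 / A" using \<open>\<delta> * A < k\<close> k A by (simp add: field_simps)
    finally have "\<Phi> (f x / k) \<le> \<Phi> (1 / A * 1)"
      using A by (intro N_function_mono[OF \<Phi>]) auto
    also have "\<dots> \<le> 1 / A * \<Phi> 1"
      using A by (intro N_function_scale[OF \<Phi>]) auto
    finally show "\<Phi> (f x / k) \<le> \<Phi> 1 / A" by simp
  qed
  also have "\<dots> = ennreal (\<Phi> 1 / A * measure M (space M))"
    using A N_function_nonneg[OF \<Phi>, of 1] by (simp add: emeasure_eq_measure flip: ennreal_mult)
  also have "\<dots> \<le> ennreal 1"
    using A by (intro ennreal_leI) (simp add: A_def field_simps)
  finally show "modular M \<Phi> (\<lambda>x. f x / k) \<le> 1" by simp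
qed

lemma nn_integral_le_of_modular:
  assumes \<Phi>: "N_function \<Phi>" and f: "f \<in> borel_measurable M" and k: "0 < k"
    and modular_le: "modular M \<Phi> (\<lambda>x. f x / k) \<le> 1"
  shows "(\<integral>\<^sup>+x. ennreal \<bar>f x\<bar> \<partial>M) \<le> ennreal k * (emeasure M (space M) + ennreal (1 / \<Phi> 1))"
proof -
  note [measurable] = N_function_measurable[OF \<Phi>] f
  have \<Phi>_nonneg: "0 \<le> \<Phi> x" for x by (rule N_function_nonneg[OF \<Phi>])
  have "(\<integral>\<^sup>+x. ennreal \<bar>f x\<bar> \<partial>M)
      \<le> (\<integral>\<^sup>+x. ennreal k * (1 + ennreal (1 / \<Phi> 1) * ennreal (\<Phi> (f x / k))) \<partial>M)"
  proof (rule nn_integral_mono)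
    fix x
    have "\<bar>f x\<bar> \<le> k * (1 + 1 / \<Phi> 1 * \<Phi> (f x / k))"
      using N_function_linear_bound[OF \<Phi>, of "f x / k"] k by (simp add: abs_divide field_simps)
    then have "ennreal \<bar>f x\<bar> \<le> ennreal (k * (1 + 1 / \<Phi> 1 * \<Phi> (f x / k)))"
      by (rule ennreal_leI)
    also have "\<dots> = ennreal k * (ennreal 1 + ennreal (1 / \<Phi> 1 * \<Phi> (f x / k)))"
      using k \<Phi>_nonneg by (simp add: ennreal_mult add_nonneg_nonneg)
    also have "ennreal (1 / \<Phi> 1 * \<Phi> (f x / k)) = ennreal (1 / \<Phi> 1) * ennreal (\<Phi> (f x / k))"
      using \<Phi>_nonneg by (intro ennreal_mult) auto
    finally show "ennreal \<bar>f x\<bar> \<le> ennreal k * (1 + ennreal (1 / \<Phi> 1) * ennreal (\<Phi> (f x / k)))"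
      by simp
  qed
  also have "\<dots> = ennreal k * (emeasure M (space M) + ennreal (1 / \<Phi> 1) * modular M \<Phi> (\<lambda>x. f x / k))"
    unfolding modular_def by (simp add: nn_integral_cmult nn_integral_add)
  also have "\<dots> \<le> ennreal k * (emeasure M (space M) + ennreal (1 / \<Phi> 1) * 1)"
    using modular_le by (intro mult_left_mono add_left_mono) auto
  finally show ?thesis by simp
qed

lemma (in finite_measure) nn_integral_le_luxemburg_norm:
  assumes \<Phi>: "N_function \<Phi>" and f: "f \<in> borel_measurable M"
  shows "(\<integral>\<^sup>+x. ennreal \<bar>f x\<bar> \<partial>M) \<le> luxemburg_norm M \<Phi> f * ennreal (measure M (space M) + 1 / \<Phi> 1)"
proof -
  define A where "A = measure M (space M) + 1 / \<Phi> 1"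
  have A: "0 < A"
    using N_function_pos[OF \<Phi>, of 1] by (simp add: A_def add_nonneg_pos)
  have bound: "(\<integral>\<^sup>+x. ennreal \<bar>f x\<bar> \<partial>M) \<le> ennreal (k * A)"
    if "luxemburg_norm M \<Phi> f < ennreal k" for k
  proof -
    have "0 < k" using that by (metis ennreal_eq_0_iff not_less not_less_zero)
    then have "(\<integral>\<^sup>+x. ennreal \<bar>f x\<bar> \<partial>M) \<le> ennreal k * (emeasure M (space M) + ennreal (1 / \<Phi> 1))"
      by (intro nn_integral_le_of_modular[OF \<Phi> f] modular_le_one_of_luxemburg_norm_less[OF \<Phi> that])
    also have "\<dots> = ennreal (k * A)"
      using \<open>0 < k\<close> A N_function_pos[OF \<Phi>, of 1]
      by (simp add: A_def emeasure_eq_measure ennreal_mult flip: ennreal_plus)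
    finally show ?thesis .
  qed
  show ?thesis
  proof (cases "luxemburg_norm M \<Phi> f")
    case (real a)
    have "(\<integral>\<^sup>+x. ennreal \<bar>f x\<bar> \<partial>M) \<le> ennreal (a * A) + ennreal e" if "0 < e" for e
      using bound[of "a + e / A"] that A real
      by (simp add: ennreal_less_iff distrib_right flip: ennreal_plus)
    then have "(\<integral>\<^sup>+x. ennreal \<bar>f x\<bar> \<partial>M) \<le> ennreal (a * A)"
      by (rule ennreal_le_epsilon)
    then show ?thesis using real A by (simp add: A_def ennreal_mult)
  next
    case top
    then show ?thesis using A by (simp add: A_def[symmetric] ennreal_top_mult)
  qed
qed

lemma (in finite_measure) AE_summable_of_luxemburg_norm:
  assumes \<Phi>: "N_function \<Phi>" and f: "\<And>j. f j \<in> borel_measurable M"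
    and sum: "(\<Sum>j. luxemburg_norm M \<Phi> (f j)) < \<infinity>"
  shows "AE x in M. summable (\<lambda>j. \<bar>f j x\<bar>)"
proof -
  note [measurable] = f
  define A where "A = ennreal (measure M (space M) + 1 / \<Phi> 1)"
  have "(\<integral>\<^sup>+x. (\<Sum>j. ennreal \<bar>f j x\<bar>) \<partial>M) = (\<Sum>j. \<integral>\<^sup>+x. ennreal \<bar>f j x\<bar> \<partial>M)"
    by (rule nn_integral_suminf) measurable
  also have "\<dots> \<le> (\<Sum>j. luxemburg_norm M \<Phi> (f j) * A)"
    unfolding A_def by (intro suminf_le nn_integral_le_luxemburg_norm[OF \<Phi> f]) auto
  also have "\<dots> = (\<Sum>j. luxemburg_norm M \<Phi> (f j)) * A"
    by (rule ennreal_suminf_multc)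
  also have "\<dots> < \<infinity>" using sum by (simp add: A_def ennreal_mult_less_top)
  finally have "AE x in M. (\<Sum>j. ennreal \<bar>f j x\<bar>) \<noteq> \<infinity>"
    by (intro nn_integral_PInf_AE) (auto simp: less_top)
  then show ?thesis
    by (auto elim!: eventually_mono intro: summable_suminf_not_top)
qed

lemma (in finite_measure) AE_liminf_finite_of_luxemburg_norm:
  assumes \<Phi>: "N_function \<Phi>" and f: "\<And>n. f n \<in> borel_measurable M"
    and norm_le: "\<And>n. luxemburg_norm M \<Phi> (f n) \<le> C" and C: "C < \<infinity>"
  shows "AE x in M. liminf (\<lambda>n. ennreal \<bar>f n x\<bar>) \<noteq> \<infinity>"
proof (rule nn_integral_PInf_AE)
  note [measurable] = f
  define A where "A = ennreal (measure M (space M) + 1 / \<Phi> 1)"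
  have "(\<integral>\<^sup>+x. liminf (\<lambda>n. ennreal \<bar>f n x\<bar>) \<partial>M) \<le> liminf (\<lambda>n. \<integral>\<^sup>+x. ennreal \<bar>f n x\<bar> \<partial>M)"
    by (rule nn_integral_liminf) measurable
  also have "\<dots> \<le> C * A"
  proof (intro Liminf_le always_eventually allI)
    fix n
    have "(\<integral>\<^sup>+x. ennreal \<bar>f n x\<bar> \<partial>M) \<le> luxemburg_norm M \<Phi> (f n) * A"
      unfolding A_def by (rule nn_integral_le_luxemburg_norm[OF \<Phi> f])
    also have "\<dots> \<le> C * A" by (intro mult_right_mono norm_le) simp
    finally show "(\<integral>\<^sup>+x. ennreal \<bar>f n x\<bar> \<partial>M) \<le> C * A" .
  qed simp
  also have "\<dots> < \<infinity>" using C by (simp add: A_def ennreal_mult_less_top)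
  finally show "(\<integral>\<^sup>+x. liminf (\<lambda>n. ennreal \<bar>f n x\<bar>) \<partial>M) \<noteq> \<infinity>" by simp
qed (use f in measurable)

lemma (in finite_measure) AE_tendsto_subseq_of_luxemburg_norm:
  assumes \<Phi>: "N_function \<Phi>" and f: "\<And>k. f k \<in> borel_measurable M"
    and lim: "(\<lambda>k. luxemburg_norm M \<Phi> (f k)) \<longlonglongrightarrow> 0"
  obtains r :: "nat \<Rightarrow> nat" where "strict_mono r" "AE x in M. (\<lambda>n. f (r n) x) \<longlonglongrightarrow> 0"
proof -
  have small: "\<exists>k>k0. luxemburg_norm M \<Phi> (f k) < ennreal ((1/2) ^ n)" for k0 n
  proof -
    have "\<forall>\<^sub>F k in sequentially. luxemburg_norm M \<Phi> (f k) < ennreal ((1/2) ^ n)"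
      by (rule order_tendstoD(2)[OF lim]) simp
    then have "\<forall>\<^sub>F k in sequentially. k0 < k \<and> luxemburg_norm M \<Phi> (f k) < ennreal ((1/2) ^ n)"
      by (intro eventually_conj eventually_gt_at_top)
    then show ?thesis by (auto dest: eventually_happens)
  qed
  obtain r where r: "\<And>n. luxemburg_norm M \<Phi> (f (r n)) < ennreal ((1/2) ^ n)" "\<And>n. r n < r (Suc n)"
    using small dependent_nat_choice[of "\<lambda>n k. luxemburg_norm M \<Phi> (f k) < ennreal ((1/2) ^ n)"
        "\<lambda>_ k k'. k < k'"] by metis
  have "(\<Sum>n. luxemburg_norm M \<Phi> (f (r n))) \<le> (\<Sum>n. ennreal ((1/2) ^ n))"
    using r(1) by (intro suminf_le) (auto intro: less_imp_le)
  also have "\<dots> < \<infinity>" by (simp add: suminf_ennreal2 summable_geometric)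
  finally have "AE x in M. summable (\<lambda>n. \<bar>f (r n) x\<bar>)"
    by (intro AE_summable_of_luxemburg_norm[OF \<Phi> f])
  then have "AE x in M. (\<lambda>n. f (r n) x) \<longlonglongrightarrow> 0"
    by eventually_elim (auto dest: summable_LIMSEQ_zero simp: tendsto_rabs_zero_iff)
  moreover have "strict_mono r" using r(2) by (simp add: strict_mono_Suc_iff)
  ultimately show ?thesis using that by blast
qed

section \<open>Almost everywhere limits of convex combinations\<close>

inductive_set midpoint_hull :: "('a \<Rightarrow> real) set \<Rightarrow> ('a \<Rightarrow> real) set" for A where
  base: "a \<in> A \<Longrightarrow> a \<in> midpoint_hull A"
| midpoint: "a \<in> midpoint_hull A \<Longrightarrow> b \<in> midpoint_hull A \<Longrightarrow> (\<lambda>x. (a x + b x) / 2) \<in> midpoint_hull A"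

lemma midpoint_hull_mono: "A \<subseteq> B \<Longrightarrow> midpoint_hull A \<subseteq> midpoint_hull B"
proof
  fix a assume "A \<subseteq> B" "a \<in> midpoint_hull A"
  from this(2,1) show "a \<in> midpoint_hull B"
    by induction (auto intro: midpoint_hull.intros)
qed

lemma midpoint_hull_measurable:
  assumes "a \<in> midpoint_hull A" "\<And>a. a \<in> A \<Longrightarrow> a \<in> borel_measurable M"
  shows "a \<in> borel_measurable M"
  using assms by induction auto

lemma midpoint_hull_affine_ge:
  assumes "a \<in> midpoint_hull A" "\<And>a. a \<in> A \<Longrightarrow> c \<le> L a"
    and "\<And>a b. L (\<lambda>x. (a x + b x) / 2) = (L a + L b) / (2::real)"
  shows "c \<le> L a"
  using assms(1,2) by induction (auto simp: assms(3))

lemma midpoint_hull_limit_affine_ge: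
  fixes L :: "('a \<Rightarrow> real) \<Rightarrow> real"
  assumes H: "\<And>n. H n \<in> midpoint_hull (g ` {n..})"
    and affine: "\<And>a b. L (\<lambda>x. (a x + b x) / 2) = (L a + L b) / 2"
    and L_lim: "(\<lambda>n. L (H n)) \<longlonglongrightarrow> l" and F_lim: "F \<longlonglongrightarrow> f" and F_le: "\<And>i. F i \<le> L (g i)"
  shows "f \<le> l"
proof (rule field_le_epsilon)
  fix e :: real assume "0 < e"
  then have "\<forall>\<^sub>F i in sequentially. f - e < F i"
    by (intro order_tendstoD(1)[OF F_lim]) simp
  then obtain n where n: "\<And>i. n \<le> i \<Longrightarrow> f - e < F i"
    by (auto simp: eventually_sequentially)
  have "f - e \<le> L (H m)" if "n \<le> m" for m
    using H[of m]
  proof (rule midpoint_hull_affine_ge)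
    fix a assume "a \<in> g ` {m..}"
    then obtain i where "m \<le> i" "a = g i" by blast
    then show "f - e \<le> L a" using n[of i] F_le[of i] that by simp
  qed (rule affine)
  then have "f - e \<le> l" by (intro LIMSEQ_le_const[OF L_lim]) blast
  then show "f \<le> l + e" by simp
qed

lemma midpoint_hull_luxemburg_norm_le:
  assumes hull: "a \<in> midpoint_hull A" and \<Phi>: "N_function \<Phi>"
    and meas: "\<And>a. a \<in> A \<Longrightarrow> a \<in> borel_measurable M"
    and norm_le: "\<And>a. a \<in> A \<Longrightarrow> luxemburg_norm M \<Phi> a \<le> C"
  shows "luxemburg_norm M \<Phi> a \<le> C"
  using hull
proof induction
  case (midpoint a b)
  note [measurable] = midpoint_hull_measurable[OF midpoint.hyps(1) meas]
      midpoint_hull_measurable[OF midpoint.hyps(2) meas]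
  show ?case
  proof (rule luxemburg_norm_leI)
    fix k :: real assume "0 < k" "C < ennreal k"
    then have "luxemburg_norm M \<Phi> a < ennreal k" "luxemburg_norm M \<Phi> b < ennreal k"
      using midpoint.IH by auto
    then have "modular M \<Phi> (\<lambda>x. (1 - 1/2) * (a x / k) + 1/2 * (b x / k)) \<le> 1"
      by (intro modular_convex_le_one[OF \<Phi>] modular_le_one_of_luxemburg_norm_less[OF \<Phi>]) auto
    then show "modular M \<Phi> (\<lambda>x. (a x + b x) / 2 / k) \<le> 1"
      by (simp add: add_divide_distrib mult.commute)
  qed
qed (rule norm_le)

lemma minimizing_sequence_midpoint_defect:
  fixes E :: "'a \<Rightarrow> real" and A :: "nat \<Rightarrow> 'a set" and mid :: "'a \<Rightarrow> 'a \<Rightarrow> 'a"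
  assumes "decseq A" and nonempty: "\<And>n. A n \<noteq> {}"
    and mid: "\<And>n a b. a \<in> A n \<Longrightarrow> b \<in> A n \<Longrightarrow> mid a b \<in> A n"
    and nonneg: "\<And>a. a \<in> A 0 \<Longrightarrow> 0 \<le> E a" and E_le: "\<And>a. a \<in> A 0 \<Longrightarrow> E a \<le> B"
  obtains H where "\<And>n. H n \<in> A n"
    "\<And>e. 0 < e \<Longrightarrow> \<exists>N. \<forall>i\<ge>N. \<forall>j\<ge>N. E (H i) + E (H j) - 2 * E (mid (H i) (H j)) < e"
proof -
  define J where "J n = Inf (E ` A n)" for n
  have A_mono: "A n \<subseteq> A m" if "m \<le> n" for m n
    using \<open>decseq A\<close> that by (rule decseqD)
  have bdd: "bdd_below (E ` A n)" for n
    using nonneg A_mono[of 0 n] by (intro bdd_belowI[of _ 0]) auto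
  have J_le: "J n \<le> E a" if "a \<in> A n" for n a
    unfolding J_def by (rule cINF_lower[OF bdd that])
  have "\<exists>a\<in>A n. E a < J n + 1 / Suc n" for n
    using cInf_lessD[of "E ` A n" "J n + 1 / Suc n"] nonempty[of n] by (simp add: J_def)
  then obtain H where H: "\<And>n. H n \<in> A n" and E_H: "\<And>n. E (H n) < J n + 1 / Suc n"
    by metis
  have "incseq J"
    unfolding J_def by (intro incseq_SucI cINF_superset_mono nonempty bdd A_mono) auto
  moreover have "J n \<le> B" for n
    using J_le[OF H, of n] E_le[of "H n"] H[of n] A_mono[of 0 n] by auto
  ultimately obtain L where L: "J \<longlonglongrightarrow> L" "\<And>n. J n \<le> L"
    using incseq_convergent by metis
  have defect: "E (H i) + E (H j) - 2 * E (mid (H i) (H j)) \<le> 2 * (L + 1 / Suc N - J N)"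
    if "N \<le> i" "N \<le> j" for i j N
  proof -
    have "J N \<le> E (mid (H i) (H j))"
      using H A_mono that by (intro J_le mid) auto
    moreover have "E (H k) \<le> L + 1 / Suc N" if "N \<le> k" for k
    proof -
      have "1 / real (Suc k) \<le> 1 / Suc N" using that by (simp add: frac_le)
      then show ?thesis using E_H[of k] L(2)[of k] by linarith
    qed
    ultimately show ?thesis using that by (smt (verit))
  qed
  have "(\<lambda>N. 2 * (L + 1 / Suc N - J N)) \<longlonglongrightarrow> 2 * (L + 0 - L)"
    by (intro tendsto_intros L LIMSEQ_Suc[OF lim_1_over_n])
  then have "\<exists>N. 2 * (L + 1 / Suc N - J N) < e" if "0 < e" for e
    using order_tendstoD(2)[of _ 0 sequentially e] that by (auto simp: eventually_sequentially)
  then have "\<exists>N. \<forall>i\<ge>N. \<forall>j\<ge>N. E (H i) + E (H j) - 2 * E (mid (H i) (H j)) < e" if "0 < e" for e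
    using that defect by (meson le_less_trans)
  then show ?thesis using that H by blast
qed

lemma (in finite_measure) integral_abs_square_le:
  fixes f :: "'a \<Rightarrow> real"
  assumes [measurable]: "f \<in> borel_measurable M" and square: "integrable M (\<lambda>x. (f x)\<^sup>2)"
  shows "(\<integral>x. \<bar>f x\<bar> \<partial>M)\<^sup>2 \<le> measure M (space M) * (\<integral>x. (f x)\<^sup>2 \<partial>M)"
proof -
  have "integrable M f"
    by (rule square_integrable_imp_integrable[OF _ square]) measurable
  then have "ennreal ((\<integral>x. \<bar>f x\<bar> \<partial>M)\<^sup>2) = (\<integral>\<^sup>+x. ennreal \<bar>f x\<bar> * 1 \<partial>M)\<^sup>2"
    by (simp add: nn_integral_eq_integral ennreal_power)
  also have "\<dots> \<le> (\<integral>\<^sup>+x. ennreal \<bar>f x\<bar> ^ 2 \<partial>M) * (\<integral>\<^sup>+x. 1 ^ 2 \<partial>M)"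
    by (rule Cauchy_Schwarz_nn_integral) measurable
  also have "\<dots> = ennreal (measure M (space M) * (\<integral>x. (f x)\<^sup>2 \<partial>M))"
    using square
    by (simp add: ennreal_power nn_integral_eq_integral emeasure_eq_measure ennreal_mult'
        mult.commute)
  finally show ?thesis by (simp add: ennreal_le_iff)
qed

lemma (in finite_measure) integral_abs_less_of_square:
  fixes f :: "'a \<Rightarrow> real"
  assumes "f \<in> borel_measurable M" "integrable M (\<lambda>x. (f x)\<^sup>2)" and "0 < e"
    and square_less: "(\<integral>x. (f x)\<^sup>2 \<partial>M) < e\<^sup>2 / (measure M (space M) + 1)"
  shows "(\<integral>x. \<bar>f x\<bar> \<partial>M) < e"
proof (rule power2_less_imp_less)
  define m where "m = measure M (space M)"
  have "0 \<le> m" by (simp add: m_def)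
  have "(\<integral>x. \<bar>f x\<bar> \<partial>M)\<^sup>2 \<le> m * (\<integral>x. (f x)\<^sup>2 \<partial>M)"
    unfolding m_def by (rule integral_abs_square_le[OF assms(1,2)])
  also have "\<dots> \<le> m * (e\<^sup>2 / (m + 1))"
    using square_less by (intro mult_left_mono) (auto simp: m_def)
  also have "\<dots> < e\<^sup>2" using \<open>0 < e\<close> \<open>0 \<le> m\<close> by (simp add: pos_divide_less_eq distrib_left)
  finally show "(\<integral>x. \<bar>f x\<bar> \<partial>M)\<^sup>2 < e\<^sup>2" .
qed (use \<open>0 < e\<close> in simp)

lemma exp_diff_square:
  fixes a b :: real
  shows "(exp (- a) - exp (- b))\<^sup>2 = exp (- 2 * a) + exp (- 2 * b) - 2 * exp (- 2 * ((a + b) / 2))"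
proof -
  have "exp (- 2 * ((a + b) / 2)) = exp (- a) * exp (- b)" by (simp flip: exp_add)
  then show ?thesis using exp_double[of "- a"] exp_double[of "- b"] by (simp add: power2_diff)
qed

text \<open>The convexity defect of \<open>\<integral> exp (- 2 a)\<close> is the square of an \<open>L\<^sup>2\<close> distance, so that minimising
  sequences are Cauchy.\<close>

lemma (in finite_measure) L1_Cauchy_exp_minimizing_sequence:
  fixes A :: "nat \<Rightarrow> ('a \<Rightarrow> real) set"
  assumes A: "decseq A" "\<And>n. A n \<noteq> {}" "\<And>n a b. a \<in> A n \<Longrightarrow> b \<in> A n \<Longrightarrow> (\<lambda>x. (a x + b x) / 2) \<in> A n"
    and meas: "\<And>a. a \<in> A 0 \<Longrightarrow> a \<in> borel_measurable M"
    and nonneg: "\<And>a x. a \<in> A 0 \<Longrightarrow> x \<in> space M \<Longrightarrow> 0 \<le> a x"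
  obtains H where "\<And>n. H n \<in> A n"
    "\<And>e. 0 < e \<Longrightarrow> \<exists>N. \<forall>i\<ge>N. \<forall>j\<ge>N. (\<integral>x. \<bar>exp (- H i x) - exp (- H j x)\<bar> \<partial>M) < e"
proof -
  define E :: "('a \<Rightarrow> real) \<Rightarrow> real" where "E a = (\<integral>x. exp (- 2 * a x) \<partial>M)" for a
  have integrable_exp: "integrable M (\<lambda>x. exp (- 2 * a x))" if "a \<in> A 0" for a
    using meas[OF that] nonneg[OF that] by (intro integrable_const_bound[where B = 1]) auto
  have E_le: "E a \<le> measure M (space M)" if "a \<in> A 0" for a
  proof -
    have "E a \<le> (\<integral>x. 1 \<partial>M)"
      unfolding E_def by (intro integral_mono integrable_exp that) (auto simp: nonneg[OF that])
    then show ?thesis by simp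
  qed
  obtain H where H: "\<And>n. H n \<in> A n" and defect: "\<And>e. 0 < e \<Longrightarrow>
      \<exists>N. \<forall>i\<ge>N. \<forall>j\<ge>N. E (H i) + E (H j) - 2 * E (\<lambda>x. (H i x + H j x) / 2) < e"
  proof (rule minimizing_sequence_midpoint_defect[OF A(1,2), of "\<lambda>a b x. (a x + b x) / 2" E])
    show "(\<lambda>x. (a x + b x) / 2) \<in> A n" if "a \<in> A n" "b \<in> A n" for n a b by (rule A(3)[OF that])
    show "0 \<le> E a" for a by (simp add: E_def)
  qed (use E_le that in blast)+
  have H0: "H n \<in> A 0" for n using H[of n] decseqD[OF A(1), of 0 n] by auto
  note [measurable] = meas[OF H0]
  have square: "integrable M (\<lambda>x. (exp (- H i x) - exp (- H j x))\<^sup>2)"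
    "(\<integral>x. (exp (- H i x) - exp (- H j x))\<^sup>2 \<partial>M)
        = E (H i) + E (H j) - 2 * E (\<lambda>x. (H i x + H j x) / 2)" for i j
    using integrable_exp[OF H0[of i]] integrable_exp[OF H0[of j]]
      integrable_exp[OF A(3)[OF H0[of i] H0[of j]]]
    by (simp_all add: exp_diff_square E_def)
  show ?thesis
  proof (rule that[OF H])
    fix e :: real assume "0 < e"
    then have "0 < e\<^sup>2 / (measure M (space M) + 1)" by (simp add: add_nonneg_pos)
    then obtain N where N: "\<And>i j. N \<le> i \<Longrightarrow> N \<le> j \<Longrightarrow>
        (\<integral>x. (exp (- H i x) - exp (- H j x))\<^sup>2 \<partial>M) < e\<^sup>2 / (measure M (space M) + 1)"
      unfolding square(2) using defect by meson
    have "(\<integral>x. \<bar>exp (- H i x) - exp (- H j x)\<bar> \<partial>M) < e" if "N \<le> i" "N \<le> j" for i j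
      by (rule integral_abs_less_of_square[OF _ square(1) \<open>0 < e\<close> N[OF that]]) measurable
    then show "\<exists>N. \<forall>i\<ge>N. \<forall>j\<ge>N. (\<integral>x. \<bar>exp (- H i x) - exp (- H j x)\<bar> \<partial>M) < e" by blast
  qed
qed

lemma convergent_of_Cauchy_exp:
  fixes a :: "nat \<Rightarrow> real"
  assumes "Cauchy (\<lambda>n. exp (- a n))" and bounded: "liminf (\<lambda>n. ennreal \<bar>a n\<bar>) \<noteq> \<infinity>"
  shows "convergent a"
proof -
  obtain l where l: "(\<lambda>n. exp (- a n)) \<longlonglongrightarrow> l"
    using assms(1) Cauchy_convergent convergent_def by blast
  have "0 \<le> l" by (rule LIMSEQ_le_const[OF l]) auto
  moreover have "l \<noteq> 0"
  proof
    assume "l = 0"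
    obtain c where c: "0 \<le> c" "liminf (\<lambda>n. ennreal \<bar>a n\<bar>) = ennreal c"
      using bounded by (cases "liminf (\<lambda>n. ennreal \<bar>a n\<bar>)") auto
    have "\<forall>\<^sub>F n in sequentially. exp (- a n) < exp (- (c + 1))"
      using l \<open>l = 0\<close> by (intro order_tendstoD(2)) auto
    then have "\<forall>\<^sub>F n in sequentially. ennreal (c + 1) \<le> ennreal \<bar>a n\<bar>"
      by eventually_elim (auto intro!: ennreal_leI)
    then have "ennreal (c + 1) \<le> ennreal c" unfolding c(2)[symmetric] by (rule Liminf_bounded)
    then show False using c(1) by (simp add: ennreal_le_iff)
  qed
  ultimately have "(\<lambda>n. - ln (exp (- a n))) \<longlonglongrightarrow> - ln l"
    by (intro tendsto_intros l) auto
  then show ?thesis by (auto simp: convergent_def)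
qed

lemma (in finite_measure) AE_convergent_midpoint_hull:
  assumes \<Phi>: "N_function \<Phi>" and g: "\<And>i. g i \<in> borel_measurable M"
    and nonneg: "\<And>i x. x \<in> space M \<Longrightarrow> 0 \<le> g i x"
    and norm_le: "\<And>i. luxemburg_norm M \<Phi> (g i) \<le> C" and C: "C < \<infinity>"
  obtains H h where "\<And>n. H n \<in> midpoint_hull (g ` {n..})" "h \<in> borel_measurable M" "\<And>x. 0 \<le> h x"
    "AE x in M. (\<lambda>n. H n x) \<longlonglongrightarrow> h x"
proof -
  define A where "A n = midpoint_hull (g ` {n..})" for n
  have A_decseq: "decseq A"
    unfolding A_def by (intro decseq_SucI midpoint_hull_mono) auto
  have A_meas: "a \<in> borel_measurable M" if "a \<in> A n" for a n
    using that unfolding A_def by (rule midpoint_hull_measurable) (auto simp: g)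
  have A_nonneg: "0 \<le> a x" if "a \<in> A n" "x \<in> space M" for a n x
    using that(1) unfolding A_def by (rule midpoint_hull_affine_ge) (auto simp: nonneg[OF that(2)])
  have A_norm: "luxemburg_norm M \<Phi> a \<le> C" if "a \<in> A n" for a n
    using that unfolding A_def
    by (rule midpoint_hull_luxemburg_norm_le[OF _ \<Phi>]) (auto simp: g norm_le)
  obtain H where H: "\<And>n. H n \<in> A n" and Cauchy: "\<And>e. 0 < e \<Longrightarrow>
      \<exists>N. \<forall>i\<ge>N. \<forall>j\<ge>N. (\<integral>x. \<bar>exp (- H i x) - exp (- H j x)\<bar> \<partial>M) < e"
  proof (rule L1_Cauchy_exp_minimizing_sequence[OF A_decseq])
    show "A n \<noteq> {}" for n unfolding A_def using midpoint_hull.base[of "g n" "g ` {n..}"] by auto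
    show "a \<in> A n \<Longrightarrow> b \<in> A n \<Longrightarrow> (\<lambda>x. (a x + b x) / 2) \<in> A n" for n a b
      unfolding A_def by (rule midpoint_hull.midpoint)
  qed (use A_meas A_nonneg that in blast)+
  note H_meas [measurable] = A_meas[OF H]
  have "integrable M (\<lambda>x. exp (- H n x))" for n
    using A_nonneg[OF H] by (intro integrable_const_bound[where B = 1]) auto
  then obtain r where r: "strict_mono r" and Cauchy_r: "AE x in M. Cauchy (\<lambda>i. exp (- H (r i) x))"
    using cauchy_L1_AE_cauchy_subseq[of M "\<lambda>n x. exp (- H n x)"] Cauchy by auto
  have "AE x in M. liminf (\<lambda>n. ennreal \<bar>H (r n) x\<bar>) \<noteq> \<infinity>"
    by (rule AE_liminf_finite_of_luxemburg_norm[OF \<Phi> H_meas A_norm[OF H] C])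
  with Cauchy_r have convergent: "AE x in M. convergent (\<lambda>n. H (r n) x)"
    by eventually_elim (rule convergent_of_Cauchy_exp)
  define h where "h x = \<bar>lim (\<lambda>n. H (r n) x)\<bar>" for x
  have "AE x in M. (\<lambda>n. H (r n) x) \<longlonglongrightarrow> h x"
    using convergent AE_space
  proof eventually_elim
    case (elim x)
    then have lim: "(\<lambda>n. H (r n) x) \<longlonglongrightarrow> lim (\<lambda>n. H (r n) x)"
      by (simp add: convergent_LIMSEQ_iff)
    moreover have "0 \<le> lim (\<lambda>n. H (r n) x)"
      using A_nonneg[OF H elim(2)] by (intro LIMSEQ_le_const[OF lim]) auto
    ultimately show ?case by (simp add: h_def)
  qed
  moreover have "h \<in> borel_measurable M" unfolding h_def by measurable
  moreover have "H (r n) \<in> midpoint_hull (g ` {n..})" for n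
    using H[of "r n"] decseqD[OF A_decseq seq_suble[OF r], of n] by (auto simp: A_def)
  ultimately show ?thesis using that[of "\<lambda>n. H (r n)" h] by (simp add: h_def)
qed

section \<open>Bounded sets under a doubling measure\<close>

lemma doubling_measureE:
  assumes "doubling_measure \<mu>"
  obtains C where "0 \<le> C" "\<And>x r. 0 < r \<Longrightarrow> emeasure \<mu> (ball x r) < \<infinity>"
    "\<And>x r. 0 < r \<Longrightarrow> 0 < measure \<mu> (ball x r)"
    "\<And>x r. 0 < r \<Longrightarrow> measure \<mu> (ball x (2 * r)) \<le> C * measure \<mu> (ball x r)"
proof -
  obtain C where pos: "\<And>x r. 0 < r \<Longrightarrow> 0 < emeasure \<mu> (ball x r)"
    and fin: "\<And>x r. 0 < r \<Longrightarrow> emeasure \<mu> (ball x (2 * r)) < \<infinity>"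
    and doubling: "\<And>x r. 0 < r \<Longrightarrow> emeasure \<mu> (ball x (2 * r)) \<le> ennreal C * emeasure \<mu> (ball x r)"
    using assms unfolding doubling_measure_def by blast
  have finite: "emeasure \<mu> (ball x r) < \<infinity>" if "0 < r" for x r
    using fin[of "r / 2" x] that by simp
  then have emeasure: "emeasure \<mu> (ball x r) = ennreal (measure \<mu> (ball x r))" if "0 < r" for x r
    using that by (intro emeasure_eq_ennreal_measure) (simp add: less_top)
  show ?thesis
  proof (rule that[of "max 0 C"])
    fix x :: 'a and r :: real assume r: "0 < r"
    show "0 < measure \<mu> (ball x r)" using pos[OF r, of x] emeasure[OF r, of x] by simp
    have "ennreal C = ennreal (max 0 C)" by (simp add: max_def ennreal_neg)
    then have "ennreal (measure \<mu> (ball x (2 * r)))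
        \<le> ennreal (max 0 C) * ennreal (measure \<mu> (ball x r))"
      using doubling[OF r, of x] emeasure[of r x] emeasure[of "2 * r" x] r by simp
    then show "measure \<mu> (ball x (2 * r)) \<le> max 0 C * measure \<mu> (ball x r)"
      by (simp flip: ennreal_mult)
  qed (use finite in auto)
qed

lemma doubling_measure_bounded_emeasure_finite:
  assumes sets: "sets \<mu> = sets borel" and doubling: "doubling_measure \<mu>" and "bounded S"
  shows "emeasure \<mu> S < \<infinity>"
proof -
  obtain x R where R: "0 < R" "S \<subseteq> ball x R"
    using bounded_subset_ballD[OF \<open>bounded S\<close>, of undefined] by blast
  then have "emeasure \<mu> S \<le> emeasure \<mu> (ball x R)"
    by (intro emeasure_mono) (auto simp: sets)
  also have "\<dots> < \<infinity>" using doubling_measureE[OF doubling] R(1) by metis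
  finally show ?thesis .
qed

lemma totally_bounded_of_separated_card_bound:
  fixes S :: "'x::metric_space set"
  assumes "\<And>\<epsilon>. 0 < \<epsilon> \<Longrightarrow> \<exists>N. \<forall>F. finite F \<longrightarrow> F \<subseteq> S \<longrightarrow> pairwise (\<lambda>x y. \<epsilon> \<le> dist x y) F \<longrightarrow> card F \<le> N"
  shows "totally_bounded S"
  unfolding totally_bounded_metric
proof (intro allI impI)
  fix \<epsilon> :: real assume "0 < \<epsilon>"
  define separated where "separated F \<longleftrightarrow> finite F \<and> F \<subseteq> S \<and> pairwise (\<lambda>x y. \<epsilon> \<le> dist x y) F" for F
  obtain N where "\<And>F. separated F \<Longrightarrow> card F \<le> N"
    using assms[OF \<open>0 < \<epsilon>\<close>] unfolding separated_def by blast
  moreover have "separated {}" by (simp add: separated_def)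
  ultimately obtain F where F: "separated F" and maximal: "\<And>F'. separated F' \<Longrightarrow> card F' \<le> card F"
    using ex_has_greatest_nat[of separated "{}" card "Suc N"] by (auto simp: less_Suc_eq_le)
  have "S \<subseteq> (\<Union>x\<in>F. {y. dist x y < \<epsilon>})"
  proof (rule ccontr)
    assume "\<not> S \<subseteq> (\<Union>x\<in>F. {y. dist x y < \<epsilon>})"
    then obtain z where z: "z \<in> S" "\<And>x. x \<in> F \<Longrightarrow> \<epsilon> \<le> dist x z" by force
    then have "z \<notin> F" using \<open>0 < \<epsilon>\<close> by force
    moreover have "separated (insert z F)"
      using F z by (auto simp: separated_def pairwise_insert dist_commute)
    ultimately show False using maximal[of "insert z F"] F by (simp add: separated_def)
  qed
  then show "\<exists>F. finite F \<and> S \<subseteq> (\<Union>x\<in>F. {y. dist x y < \<epsilon>})"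
    using F by (auto simp: separated_def)
qed

lemma doubling_measure_comparable_balls:
  fixes \<mu> :: "'x::metric_space measure"
  assumes sets: "sets \<mu> = sets borel" and doubling: "doubling_measure \<mu>" and "0 < r" "0 < R"
  obtains C where "0 \<le> C" "\<And>x y. dist x y < R \<Longrightarrow> measure \<mu> (ball x R) \<le> C * measure \<mu> (ball y r)"
proof -
  obtain C where C: "0 \<le> C" and finite: "\<And>x r. 0 < r \<Longrightarrow> emeasure \<mu> (ball x r) < \<infinity>"
    and doubling: "\<And>x r. 0 < r \<Longrightarrow> measure \<mu> (ball x (2 * r)) \<le> C * measure \<mu> (ball x r)"
    using doubling_measureE[OF doubling] by metis
  have doubling_power: "measure \<mu> (ball y (2 ^ p * r)) \<le> C ^ p * measure \<mu> (ball y r)" for y p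
  proof (induction p)
    case (Suc p)
    have "measure \<mu> (ball y (2 ^ Suc p * r)) \<le> C * measure \<mu> (ball y (2 ^ p * r))"
      using doubling[of "2 ^ p * r" y] \<open>0 < r\<close> by (simp add: mult.assoc)
    also have "\<dots> \<le> C * (C ^ p * measure \<mu> (ball y r))"
      by (intro mult_left_mono Suc C)
    finally show ?case by (simp add: mult.assoc)
  qed simp
  obtain p :: nat where "2 * R / r < 2 ^ p"
    using real_arch_pow[of 2] by auto
  then have p: "2 * R < 2 ^ p * r"
    using \<open>0 < r\<close> by (simp add: pos_divide_less_eq)
  have "measure \<mu> (ball x R) \<le> C ^ p * measure \<mu> (ball y r)" if "dist x y < R" for x y
  proof -
    have "ball x R \<subseteq> ball y (2 ^ p * r)"
    proof
      fix z assume "z \<in> ball x R"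
      then show "z \<in> ball y (2 ^ p * r)"
        using that p dist_triangle3[of y z x] by simp
    qed
    then have "measure \<mu> (ball x R) \<le> measure \<mu> (ball y (2 ^ p * r))"
      using finite \<open>0 < r\<close> by (intro measure_mono_fmeasurable fmeasurableI) (auto simp: sets)
    also have "\<dots> \<le> C ^ p * measure \<mu> (ball y r)" by (rule doubling_power)
    finally show ?thesis .
  qed
  then show ?thesis using that[of "C ^ p"] C by simp
qed

lemma doubling_measure_separated_card_bound:
  fixes \<mu> :: "'x::metric_space measure" and x :: 'x
  assumes sets: "sets \<mu> = sets borel" and doubling: "doubling_measure \<mu>" and "0 < \<epsilon>" "0 < R"
  obtains N :: nat where
    "\<And>F. finite F \<Longrightarrow> F \<subseteq> ball x R \<Longrightarrow> pairwise (\<lambda>y z. \<epsilon> \<le> dist y z) F \<Longrightarrow> card F \<le> N"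
proof -
  have finite: "emeasure \<mu> (ball y r) < \<infinity>" and pos: "0 < measure \<mu> (ball y r)" if "0 < r" for y r
    using doubling_measureE[OF doubling] that by metis+
  define B where "B = ball x (R + \<epsilon>)"
  have B: "B \<in> fmeasurable \<mu>" "0 < measure \<mu> B"
    using finite pos \<open>0 < R\<close> \<open>0 < \<epsilon>\<close> by (auto simp: B_def sets intro!: fmeasurableI)
  obtain C where C: "0 \<le> C"
    and comparable: "\<And>y. dist x y < R + \<epsilon> \<Longrightarrow> measure \<mu> B \<le> C * measure \<mu> (ball y (\<epsilon> / 2))"
    using doubling_measure_comparable_balls[OF sets doubling, of "\<epsilon> / 2" "R + \<epsilon>"] \<open>0 < R\<close> \<open>0 < \<epsilon>\<close>
    unfolding B_def by (metis add_pos_pos half_gt_zero)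
  obtain N :: nat where N: "C \<le> real N" using real_arch_simple by blast
  show ?thesis
  proof (rule that)
    fix F assume F: "finite F" "F \<subseteq> ball x R" "pairwise (\<lambda>y z. \<epsilon> \<le> dist y z) F"
    have "(\<Sum>y\<in>F. measure \<mu> B) \<le> (\<Sum>y\<in>F. C * measure \<mu> (ball y (\<epsilon> / 2)))"
      using F(2) \<open>0 < \<epsilon>\<close> by (intro sum_mono comparable) force
    also have "\<dots> = C * (\<Sum>y\<in>F. measure \<mu> (ball y (\<epsilon> / 2)))"
      by (simp add: sum_distrib_left)
    also have "(\<Sum>y\<in>F. measure \<mu> (ball y (\<epsilon> / 2))) = measure \<mu> (\<Union>y\<in>F. ball y (\<epsilon> / 2))"
    proof (rule measure_finite_Union[symmetric])
      have "ball y (\<epsilon> / 2) \<inter> ball z (\<epsilon> / 2) = {}" if "y \<in> F" "z \<in> F" "y \<noteq> z" for y z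
        using F(3) that by (intro disjoint_ballI) (auto simp: pairwise_def)
      then show "disjoint_family_on (\<lambda>y. ball y (\<epsilon> / 2)) F"
        by (simp add: disjoint_family_on_def)
    qed (use F(1) finite \<open>0 < \<epsilon>\<close> in \<open>auto simp: sets less_top\<close>)
    also have "C * measure \<mu> (\<Union>y\<in>F. ball y (\<epsilon> / 2)) \<le> C * measure \<mu> B"
    proof (intro mult_left_mono measure_mono_fmeasurable B)
      show "(\<Union>y\<in>F. ball y (\<epsilon> / 2)) \<subseteq> B"
      proof
        fix z assume "z \<in> (\<Union>y\<in>F. ball y (\<epsilon> / 2))"
        then obtain y where "y \<in> F" "dist y z < \<epsilon> / 2" by auto
        moreover from \<open>y \<in> F\<close> have "dist x y < R" using F(2) by auto
        ultimately show "z \<in> B" using \<open>0 < \<epsilon>\<close> dist_triangle[of x z y] by (simp add: B_def)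
      qed
    qed (use C in \<open>auto simp: sets intro!: borel_open\<close>)
    finally show "card F \<le> N" using B(2) N by simp
  qed
qed

lemma doubling_measure_bounded_imp_totally_bounded:
  fixes \<mu> :: "'x::metric_space measure" and S :: "'x set"
  assumes sets: "sets \<mu> = sets borel" and doubling: "doubling_measure \<mu>" and "bounded S"
  shows "totally_bounded S"
proof (rule totally_bounded_of_separated_card_bound)
  fix \<epsilon> :: real assume "0 < \<epsilon>"
  obtain x R where R: "0 < R" "S \<subseteq> ball x R"
    using bounded_subset_ballD[OF \<open>bounded S\<close>, of undefined] by blast
  obtain N :: nat where
    "\<And>F. finite F \<Longrightarrow> F \<subseteq> ball x R \<Longrightarrow> pairwise (\<lambda>x y. \<epsilon> \<le> dist x y) F \<Longrightarrow> card F \<le> N"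
    by (rule doubling_measure_separated_card_bound[OF sets doubling \<open>0 < \<epsilon>\<close> R(1), of x]) (rule that)
  then show "\<exists>N. \<forall>F. finite F \<longrightarrow> F \<subseteq> S \<longrightarrow> pairwise (\<lambda>x y. \<epsilon> \<le> dist x y) F \<longrightarrow> card F \<le> N"
    using R(2) by (intro exI[of _ N]) (auto dest: order_trans)
qed

lemma doubling_measure_restrict_bounded:
  fixes \<mu> :: "'x::metric_space measure"
  assumes borel: "sets \<mu> = sets borel" and doubling: "doubling_measure \<mu>"
    and \<Omega>: "\<Omega> \<in> sets \<mu>" and bounded: "bounded \<Omega>"
  shows "finite_measure (restrict_space \<mu> \<Omega>)" "totally_bounded (space (restrict_space \<mu> \<Omega>))"
    "{y \<in> space (restrict_space \<mu> \<Omega>). dist x y < r} \<in> sets (restrict_space \<mu> \<Omega>)"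
proof -
  have space: "space (restrict_space \<mu> \<Omega>) = \<Omega>"
    using sets.sets_into_space[OF \<Omega>] by (auto simp: space_restrict_space)
  show "finite_measure (restrict_space \<mu> \<Omega>)"
    using doubling_measure_bounded_emeasure_finite[OF borel doubling bounded] \<Omega>
    by (intro finite_measureI) (simp add: space emeasure_restrict_space)
  show "totally_bounded (space (restrict_space \<mu> \<Omega>))"
    unfolding space
    by (rule doubling_measure_bounded_imp_totally_bounded[OF borel doubling bounded])
  have "{y \<in> space (restrict_space \<mu> \<Omega>). dist x y < r} = \<Omega> \<inter> ball x r"
    by (auto simp: space)
  also have "\<dots> \<in> sets (restrict_space \<mu> \<Omega>)"
    using \<Omega> by (auto simp: sets_restrict_space borel)
  finally show "{y \<in> space (restrict_space \<mu> \<Omega>). dist x y < r} \<in> sets (restrict_space \<mu> \<Omega>)" .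
qed

definition fine_partition :: "'x::metric_space measure \<Rightarrow> real \<Rightarrow> ('x \<Rightarrow> nat) \<Rightarrow> nat \<Rightarrow> bool" where
  "fine_partition M \<epsilon> I n \<longleftrightarrow> I \<in> measurable M (count_space UNIV) \<and> (\<forall>x\<in>space M. I x < n) \<and>
     (\<forall>x\<in>space M. \<forall>y\<in>space M. I x = I y \<longrightarrow> dist x y \<le> \<epsilon>)"

lemma totally_bounded_imp_fine_partition:
  fixes M :: "'x::metric_space measure"
  assumes "totally_bounded (space M)" and balls: "\<And>x r. {y \<in> space M. dist x y < r} \<in> sets M"
    and "0 < \<epsilon>"
  shows "\<exists>I n. fine_partition M \<epsilon> I n"
proof -
  obtain F where F: "finite F" "space M \<subseteq> (\<Union>x\<in>F. {y. dist x y < \<epsilon> / 2})"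
    using assms(1)[unfolded totally_bounded_metric] half_gt_zero[OF \<open>0 < \<epsilon>\<close>] by blast
  obtain c and n :: nat where c: "F = c ` {i. i < n}"
    using \<open>finite F\<close> by (metis finite_imp_nat_seg_image_inj_on)
  define I where "I x = (LEAST i. dist (c i) x < \<epsilon> / 2)" for x
  have ex: "\<exists>i<n. dist (c i) x < \<epsilon> / 2" if "x \<in> space M" for x
    using F(2) that unfolding c by blast
  have near: "dist (c (I x)) x < \<epsilon> / 2" if "x \<in> space M" for x
    using ex[OF that] unfolding I_def by (auto intro: LeastI)
  have "I \<in> measurable M (count_space UNIV)"
    unfolding I_def by (rule measurable_Least) (unfold pred_def, rule balls)
  moreover have "I x < n" if "x \<in> space M" for x
    using ex[OF that] unfolding I_def by (auto intro: le_less_trans[OF Least_le])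
  moreover have "dist x y \<le> \<epsilon>" if "x \<in> space M" "y \<in> space M" "I x = I y" for x y
    using near[OF that(1)] near[OF that(2)] that(3) dist_triangle3[of x y "c (I y)"] by simp
  ultimately have "fine_partition M \<epsilon> I n" by (simp add: fine_partition_def)
  then show ?thesis by blast
qed

section \<open>Measurable maps into metric spaces\<close>

lemma space_borel_of_metric [simp]: "space (borel_of_metric Y) = mspace Y"
  unfolding borel_of_metric_def by (subst space_measure_of) (auto dest!: openin_subset)

lemma openin_sets_borel_of_metric:
  "openin (mtopology_of Y) U \<Longrightarrow> U \<in> sets (borel_of_metric Y)"
  unfolding borel_of_metric_def by (subst sets_measure_of) (use openin_subset in fastforce)+

lemma measurable_borel_of_metricI:
  assumes "\<And>x. x \<in> space M \<Longrightarrow> f x \<in> mspace Y"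
    and "\<And>U. openin (mtopology_of Y) U \<Longrightarrow> f -` U \<inter> space M \<in> sets M"
  shows "f \<in> measurable M (borel_of_metric Y)"
  unfolding borel_of_metric_def
proof (rule measurable_measure_of)
  show "{U. openin (mtopology_of Y) U} \<subseteq> Pow (mspace Y)" by (auto dest!: openin_subset)
qed (use assms in auto)

lemma measurable_borel_of_metric_mspace:
  "f \<in> measurable M (borel_of_metric Y) \<Longrightarrow> x \<in> space M \<Longrightarrow> f x \<in> mspace Y"
  using measurable_space[of f M "borel_of_metric Y" x] by simp

lemma openin_mball_of: "openin (mtopology_of Y) (mball_of Y y r)"
  using Metric_space.openin_mball[OF Metric_space_mspace_mdist]
  by (simp add: mtopology_of_def mball_of_def)

lemma openin_mtopology_of_ball:
  assumes "openin (mtopology_of Y) U" "y \<in> U"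
  obtains r where "0 < r" "mball_of Y y r \<subseteq> U"
  using assms Metric_space.openin_mtopology[OF Metric_space_mspace_mdist, of Y U]
  by (auto simp: mtopology_of_def mball_of_def)

lemma measurable_mdist_const:
  assumes f: "f \<in> measurable M (borel_of_metric Y)" and y: "y \<in> mspace Y"
  shows "(\<lambda>x. mdist Y y (f x)) \<in> borel_measurable M"
proof (rule borel_measurableI_less)
  fix r
  have "f -` mball_of Y y r \<inter> space M \<in> sets M"
    by (rule measurable_sets[OF f openin_sets_borel_of_metric[OF openin_mball_of]])
  also have "f -` mball_of Y y r \<inter> space M = {x \<in> space M. mdist Y y (f x) < r}"
    using measurable_borel_of_metric_mspace[OF f] y by (auto simp: in_mball_of)
  finally show "{x \<in> space M. mdist Y y (f x) < r} \<in> sets M" .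
qed

lemma isometric_embedding_measurable:
  assumes "isometric_embedding Y Z \<phi>"
  shows "\<phi> \<in> measurable (borel_of_metric Y) (borel_of_metric Z)"
proof (rule measurable_borel_of_metricI)
  show "\<phi> y \<in> mspace Z" if "y \<in> space (borel_of_metric Y)" for y
    using isometric_embedding_mspace[OF assms] that by simp
  have "Lipschitz_continuous_map Y Z \<phi>"
    unfolding Lipschitz_continuous_map_def
    using isometric_embedding_mspace[OF assms] isometric_embedding_mdist[OF assms]
    by (intro conjI exI[of _ 1]) auto
  then have continuous: "continuous_map (mtopology_of Y) (mtopology_of Z) \<phi>"
    by (rule Lipschitz_continuous_imp_continuous_map)
  fix U assume "openin (mtopology_of Z) U"
  then have "openin (mtopology_of Y) {y \<in> mspace Y. \<phi> y \<in> U}"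
    using openin_continuous_map_preimage[OF continuous] by simp
  then show "\<phi> -` U \<inter> space (borel_of_metric Y) \<in> sets (borel_of_metric Y)"
    using openin_sets_borel_of_metric by (simp add: vimage_def Int_def conj_commute)
qed

lemma limit_in_open_iff_eventually_away_from_complement:
  assumes U: "openin (mtopology_of Z) U" and w: "\<And>j. w j \<in> mspace Z" and v: "v \<in> mspace Z"
    and lim: "(\<lambda>j. mdist Z (w j) v) \<longlonglongrightarrow> 0"
  shows "v \<in> U \<longleftrightarrow> (\<exists>k n. \<forall>j\<ge>n. w j \<notin> (\<Union>z\<in>mspace Z - U. mball_of Z z (1 / Suc k)))"
proof
  have close: "\<exists>n. \<forall>j\<ge>n. mdist Z (w j) v < 1 / Suc k" for k
    using order_tendstoD(2)[OF lim, of "1 / Suc k"] by (simp add: eventually_sequentially)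
  {
    assume "v \<in> U"
    then obtain r where r: "0 < r" "mball_of Z v r \<subseteq> U"
      using openin_mtopology_of_ball[OF U] by blast
    obtain k where k: "1 / real (Suc k) < r / 2"
      using nat_approx_posE[of "r / 2"] r by auto
    obtain n where n: "\<And>j. n \<le> j \<Longrightarrow> mdist Z (w j) v < 1 / Suc k" using close by blast
    have "w j \<notin> mball_of Z z (1 / Suc k)" if "n \<le> j" "z \<in> mspace Z - U" for j z
    proof
      assume "w j \<in> mball_of Z z (1 / Suc k)"
      then have "mdist Z v z < r"
        using mdist_triangle[OF v w, of z j] n[OF that(1)] k that(2) by (simp add: mdist_commute)
      then show False using r(2) that(2) v by auto
    qed
    then show "\<exists>k n. \<forall>j\<ge>n. w j \<notin> (\<Union>z\<in>mspace Z - U. mball_of Z z (1 / Suc k))" by blast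
  next
    assume "\<exists>k n. \<forall>j\<ge>n. w j \<notin> (\<Union>z\<in>mspace Z - U. mball_of Z z (1 / Suc k))"
    then obtain k n where n: "\<And>j. n \<le> j \<Longrightarrow> w j \<notin> (\<Union>z\<in>mspace Z - U. mball_of Z z (1 / Suc k))"
      by blast
    obtain n' where "\<And>j. n' \<le> j \<Longrightarrow> mdist Z (w j) v < 1 / Suc k" using close by blast
    then have "mdist Z v (w (max n n')) < 1 / Suc k" by (simp add: mdist_commute)
    then show "v \<in> U" using n[of "max n n'"] w v by auto
  }
qed

lemma measurable_borel_of_metric_limit:
  assumes w: "\<And>j. w j \<in> measurable M (borel_of_metric Z)"
    and v: "\<And>x. x \<in> space M \<Longrightarrow> v x \<in> mspace Z"
    and lim: "\<And>x. x \<in> space M \<Longrightarrow> (\<lambda>j. mdist Z (w j x) (v x)) \<longlonglongrightarrow> 0"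
  shows "v \<in> measurable M (borel_of_metric Z)"
proof (rule measurable_borel_of_metricI[OF v])
  fix U assume U: "openin (mtopology_of Z) U"
  define T where "T k = (\<Union>z\<in>mspace Z - U. mball_of Z z (1 / Suc k))" for k
  have "openin (mtopology_of Z) (T k)" for k
    unfolding T_def by (rule openin_Union) (auto simp: openin_mball_of)
  then have "T k \<in> sets (borel_of_metric Z)" for k by (rule openin_sets_borel_of_metric)
  then have [measurable]: "Measurable.pred M (\<lambda>x. w j x \<in> T k)" for j k
    using w by measurable
  have "v x \<in> U \<longleftrightarrow> (\<exists>k n. \<forall>j\<ge>n. w j x \<notin> T k)" if "x \<in> space M" for x
    unfolding T_def
    by (intro limit_in_open_iff_eventually_away_from_complement[OF U] lim v that
        measurable_borel_of_metric_mspace[OF w that])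
  then have "v -` U \<inter> space M = {x \<in> space M. \<exists>k n. \<forall>j\<ge>n. w j x \<notin> T k}" by auto
  also have "\<dots> \<in> sets M" by measurable
  finally show "v -` U \<inter> space M \<in> sets M" .
qed

lemma tendsto_mdist:
  assumes "\<And>j. a j \<in> mspace Z" "\<And>j. b j \<in> mspace Z" "a' \<in> mspace Z" "b' \<in> mspace Z"
    and a: "(\<lambda>j. mdist Z (a j) a') \<longlonglongrightarrow> 0" and b: "(\<lambda>j. mdist Z (b j) b') \<longlonglongrightarrow> 0"
  shows "(\<lambda>j. mdist Z (a j) (b j)) \<longlonglongrightarrow> mdist Z a' b'"
proof -
  have diff_le: "norm (mdist Z (a j) (b j) - mdist Z a' b') \<le> mdist Z (a j) a' + mdist Z (b j) b'"
    for j
    using mdist_triangle[of "a j" Z a' "b j"] mdist_triangle[of a' Z b' "b j"]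
      mdist_triangle[of a' Z "a j" b'] mdist_triangle[of "a j" Z "b j" b'] assms(1-4)
      mdist_commute[of Z a' "a j"] mdist_commute[of Z b' "b j"] by auto
  have "(\<lambda>j. mdist Z (a j) a' + mdist Z (b j) b') \<longlonglongrightarrow> 0"
    using tendsto_add[OF a b] by simp
  with always_eventually[OF allI[OF diff_le]] have "(\<lambda>j. mdist Z (a j) (b j) - mdist Z a' b') \<longlonglongrightarrow> 0"
    by (rule Lim_null_comparison)
  then show ?thesis by (rule LIM_zero_cancel)
qed

text \<open>The distance of two Borel maps need not be measurable when the target is not separable. It is
  measurable as soon as one of the maps is strongly measurable in the sense of Bochner.\<close>

definition countably_valued :: "'a measure \<Rightarrow> 'z metric \<Rightarrow> ('a \<Rightarrow> 'z) \<Rightarrow> bool" where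
  "countably_valued M Z w \<longleftrightarrow>
     (\<exists>C. countable C \<and> C \<subseteq> mspace Z \<and> w \<in> measurable M (count_space C))"

lemma countably_valued_compose:
  fixes P :: "nat \<Rightarrow> 'z"
  assumes "\<And>i. P i \<in> mspace Z" "I \<in> measurable M (count_space UNIV)"
  shows "countably_valued M Z (\<lambda>x. P (I x))"
  unfolding countably_valued_def
proof (intro exI conjI)
  show "(\<lambda>x. P (I x)) \<in> measurable M (count_space (range P))"
    by (rule measurable_compose[OF assms(2)]) simp
qed (use assms(1) in auto)

lemma countably_valued_If:
  assumes w: "countably_valued M Z w" and w': "countably_valued M Z w'" and S: "S \<in> sets M"
  shows "countably_valued M Z (\<lambda>x. if x \<in> S then w x else w' x)"
proof -
  obtain C C' where C: "countable C" "C \<subseteq> mspace Z" "w \<in> measurable M (count_space C)"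
    and C': "countable C'" "C' \<subseteq> mspace Z" "w' \<in> measurable M (count_space C')"
    using w w' unfolding countably_valued_def by metis
  have "w \<in> measurable M (count_space (C \<union> C'))" "w' \<in> measurable M (count_space (C \<union> C'))"
    by (rule measurable_compose[OF C(3)], simp, rule measurable_compose[OF C'(3)], simp)
  then have "(\<lambda>x. if x \<in> S then w x else w' x) \<in> measurable M (count_space (C \<union> C'))"
    using S by (intro measurable_If_set) auto
  then show ?thesis
    unfolding countably_valued_def using C(1,2) C'(1,2) by (intro exI[of _ "C \<union> C'"]) auto
qed

lemma countably_valued_measurable:
  assumes "countably_valued M Z w"
  shows "w \<in> measurable M (borel_of_metric Z)"
proof -
  obtain C where C: "C \<subseteq> mspace Z" "w \<in> measurable M (count_space C)"
    using assms unfolding countably_valued_def by blast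
  show ?thesis by (rule measurable_compose[OF C(2)]) (use C(1) in auto)
qed

lemma countably_valued_mspace: "countably_valued M Z w \<Longrightarrow> x \<in> space M \<Longrightarrow> w x \<in> mspace Z"
  by (rule measurable_borel_of_metric_mspace[OF countably_valued_measurable])

lemma countably_valued_measurable_mdist:
  assumes f: "f \<in> measurable M (borel_of_metric Z)" and "countably_valued M Z w"
  shows "(\<lambda>x. mdist Z (f x) (w x)) \<in> borel_measurable M"
proof -
  obtain C where C: "countable C" "C \<subseteq> mspace Z" "w \<in> measurable M (count_space C)"
    using assms(2) unfolding countably_valued_def by blast
  show ?thesis
    using measurable_compose_countable'[of C "\<lambda>c x. mdist Z c (f x)", OF _ C(3,1)]
      measurable_mdist_const[OF f] C(2) by (auto simp: mdist_commute)
qed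

definition strongly_measurable :: "'a measure \<Rightarrow> 'z metric \<Rightarrow> ('a \<Rightarrow> 'z) \<Rightarrow> bool" where
  "strongly_measurable M Z v \<longleftrightarrow> (\<forall>x\<in>space M. v x \<in> mspace Z) \<and>
     (\<exists>w. (\<forall>j. countably_valued M Z (w j)) \<and> (\<forall>x\<in>space M. (\<lambda>j. mdist Z (w j x) (v x)) \<longlonglongrightarrow> 0))"

lemma strongly_measurable_measurable:
  assumes "strongly_measurable M Z v"
  shows "v \<in> measurable M (borel_of_metric Z)"
proof -
  obtain w where "\<And>j. countably_valued M Z (w j)" and "\<And>x. x \<in> space M \<Longrightarrow> v x \<in> mspace Z"
    and "\<And>x. x \<in> space M \<Longrightarrow> (\<lambda>j. mdist Z (w j x) (v x)) \<longlonglongrightarrow> 0"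
    using assms unfolding strongly_measurable_def by auto
  then show ?thesis
    by (rule measurable_borel_of_metric_limit[of w, OF countably_valued_measurable])
qed

lemma strongly_measurable_mspace: "strongly_measurable M Z v \<Longrightarrow> x \<in> space M \<Longrightarrow> v x \<in> mspace Z"
  by (simp add: strongly_measurable_def)

lemma strongly_measurable_measurable_mdist:
  assumes f: "f \<in> measurable M (borel_of_metric Z)" and v: "strongly_measurable M Z v"
  shows "(\<lambda>x. mdist Z (f x) (v x)) \<in> borel_measurable M"
proof -
  obtain w where w: "\<And>j. countably_valued M Z (w j)"
    and lim: "\<And>x. x \<in> space M \<Longrightarrow> (\<lambda>j. mdist Z (w j x) (v x)) \<longlonglongrightarrow> 0"
    using v unfolding strongly_measurable_def by blast
  show ?thesis
  proof (rule borel_measurable_LIMSEQ_real)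
    show "(\<lambda>x. mdist Z (f x) (w j x)) \<in> borel_measurable M" for j
      by (rule countably_valued_measurable_mdist[OF f w])
    fix x assume x: "x \<in> space M"
    have fx: "f x \<in> mspace Z" by (rule measurable_borel_of_metric_mspace[OF f x])
    show "(\<lambda>j. mdist Z (f x) (w j x)) \<longlonglongrightarrow> mdist Z (f x) (v x)"
      by (rule tendsto_mdist)
        (simp_all add: fx mdist_self lim[OF x] countably_valued_mspace[OF w x]
            strongly_measurable_mspace[OF v x])
  qed
qed

lemma MCauchy_of_summable:
  assumes w: "\<And>j. w j \<in> mspace Z" and "summable (\<lambda>j. mdist Z (w j) (w (Suc j)))"
  shows "Metric_space.MCauchy (mspace Z) (mdist Z) w"
proof -
  define S where "S n = (\<Sum>j<n. mdist Z (w j) (w (Suc j)))" for n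
  have dist_le: "mdist Z (w m) (w n) \<le> S n - S m" if "m \<le> n" for m n
    using that
  proof (induction n rule: dec_induct)
    case base
    show ?case by (simp add: mdist_self[OF w])
  next
    case (step n)
    then show ?case using mdist_triangle[OF w[of m] w[of n] w[of "Suc n"]] by (simp add: S_def)
  qed
  have dist_le_abs: "mdist Z (w m) (w n) \<le> \<bar>S m - S n\<bar>" for m n
    using dist_le[of m n] dist_le[of n m] mdist_commute[of Z "w m" "w n"] by (cases "m \<le> n") auto
  have "convergent S" using assms(2) unfolding S_def by (simp add: summable_iff_convergent)
  then have "Cauchy S" by (rule convergent_Cauchy)
  then show ?thesis
    unfolding Metric_space.MCauchy_def[OF Metric_space_mspace_mdist] Cauchy_def dist_real_def
    using w dist_le_abs by (metis image_subset_iff le_less_trans)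
qed

lemma mcomplete_of_summable_limit:
  assumes Z: "mcomplete_of Z" and w: "\<And>j. w j \<in> mspace Z"
    and summable: "summable (\<lambda>j. mdist Z (w j) (w (Suc j)))"
  shows "\<exists>z\<in>mspace Z. (\<lambda>j. mdist Z (w j) z) \<longlonglongrightarrow> 0"
proof -
  interpret Z: Metric_space "mspace Z" "mdist Z" by (rule Metric_space_mspace_mdist)
  obtain z where "limitin Z.mtopology w z sequentially"
    using Z MCauchy_of_summable[OF w summable] unfolding mcomplete_of_def Z.mcomplete_def by blast
  then show ?thesis unfolding Z.limitin_metric_dist_null by blast
qed

lemma AE_summable_imp_strongly_measurable_limit:
  assumes Z: "mcomplete_of Z" and w: "\<And>j. countably_valued M Z (w j)"
    and summable: "AE x in M. summable (\<lambda>j. mdist Z (w j x) (w (Suc j) x))"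
  obtains v where "strongly_measurable M Z v" "AE x in M. (\<lambda>j. mdist Z (w j x) (v x)) \<longlonglongrightarrow> 0"
proof -
  obtain S where summable': "\<And>x. x \<in> space M - S \<Longrightarrow> summable (\<lambda>j. mdist Z (w j x) (w (Suc j) x))"
    and S: "S \<in> null_sets M"
    by (rule AE_E3[OF summable]) (rule that)
  have wZ: "w j x \<in> mspace Z" if "x \<in> space M" for j x
    by (rule countably_valued_mspace[OF w that])
  have "\<exists>z\<in>mspace Z. (\<lambda>j. mdist Z (w j x) z) \<longlonglongrightarrow> 0" if "x \<in> space M - S" for x
    using that by (intro mcomplete_of_summable_limit[OF Z] summable' wZ) auto
  then obtain l where l: "\<And>x. x \<in> space M - S \<Longrightarrow> l x \<in> mspace Z"
      "\<And>x. x \<in> space M - S \<Longrightarrow> (\<lambda>j. mdist Z (w j x) (l x)) \<longlonglongrightarrow> 0"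
    by metis
  define v where "v x = (if x \<in> S then w 0 x else l x)" for x
  define w' where "w' j x = (if x \<in> S then w 0 x else w j x)" for j x
  have "strongly_measurable M Z v"
    unfolding strongly_measurable_def
  proof (intro conjI ballI exI[of _ w'] allI)
    show "countably_valued M Z (w' j)" for j
      unfolding w'_def using S by (intro countably_valued_If w) auto
    show "v x \<in> mspace Z" "(\<lambda>j. mdist Z (w' j x) (v x)) \<longlonglongrightarrow> 0" if "x \<in> space M" for x
      using l[of x] wZ[OF that, of 0] that by (auto simp: v_def w'_def mdist_self)
  qed
  moreover have "AE x in M. (\<lambda>j. mdist Z (w j x) (v x)) \<longlonglongrightarrow> 0"
    using AE_not_in[OF S] AE_space by eventually_elim (simp add: v_def l(2))
  ultimately show ?thesis by (rule that)
qed

abbreviation Orlicz_dist ::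
  "'a measure \<Rightarrow> (real \<Rightarrow> real) \<Rightarrow> 'z metric \<Rightarrow> ('a \<Rightarrow> 'z) \<Rightarrow> ('a \<Rightarrow> 'z) \<Rightarrow> ennreal" where
  "Orlicz_dist M \<Phi> Z f g \<equiv> luxemburg_norm M \<Phi> (\<lambda>x. mdist Z (f x) (g x))"

lemma (in finite_measure) Orlicz_complete:
  assumes \<Phi>: "N_function \<Phi>" and Z: "mcomplete_of Z" and w: "\<And>j. countably_valued M Z (w j)"
    and "summable \<epsilon>" "\<And>j. 0 \<le> \<epsilon> j"
    and cauchy: "\<And>i j. j \<le> i \<Longrightarrow> Orlicz_dist M \<Phi> Z (w j) (w i) \<le> ennreal (\<epsilon> j)"
  obtains v where "strongly_measurable M Z v"
    "\<And>j. Orlicz_dist M \<Phi> Z (w j) v \<le> ennreal (\<epsilon> j)"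
proof -
  have meas: "(\<lambda>x. mdist Z (w j x) (w i x)) \<in> borel_measurable M" for i j
    by (intro countably_valued_measurable_mdist countably_valued_measurable w)
  have "(\<Sum>j. Orlicz_dist M \<Phi> Z (w j) (w (Suc j))) \<le> (\<Sum>j. ennreal (\<epsilon> j))"
    by (intro suminf_le cauchy) auto
  also have "\<dots> < \<infinity>" using assms(4,5) by (simp add: suminf_ennreal2)
  finally have "AE x in M. summable (\<lambda>j. \<bar>mdist Z (w j x) (w (Suc j) x)\<bar>)"
    by (intro AE_summable_of_luxemburg_norm[OF \<Phi> meas])
  then have "AE x in M. summable (\<lambda>j. mdist Z (w j x) (w (Suc j) x))" by simp
  then obtain v where v: "strongly_measurable M Z v"
    and lim: "AE x in M. (\<lambda>j. mdist Z (w j x) (v x)) \<longlonglongrightarrow> 0"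
    by (rule AE_summable_imp_strongly_measurable_limit[OF Z w])
  have "Orlicz_dist M \<Phi> Z (w j) v \<le> ennreal (\<epsilon> j)" for j
  proof (rule luxemburg_norm_Fatou[OF \<Phi> meas[of j]])
    show "AE x in M. (\<lambda>i. mdist Z (w j x) (w i x)) \<longlonglongrightarrow> mdist Z (w j x) (v x)"
      using lim AE_space
    proof eventually_elim
      case (elim x)
      note in_Z = countably_valued_mspace[OF w elim(2)] strongly_measurable_mspace[OF v elim(2)]
      show ?case by (rule tendsto_mdist) (simp_all add: in_Z mdist_self elim(1))
    qed
    show "\<forall>\<^sub>F i in sequentially. Orlicz_dist M \<Phi> Z (w j) (w i) \<le> ennreal (\<epsilon> j)"
      using eventually_ge_at_top[of j] by eventually_elim (rule cauchy)
  qed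
  then show ?thesis using that v by blast
qed

section \<open>Hajlasz gradients\<close>

definition hajlasz_inequality ::
  "'x::metric_space measure \<Rightarrow> 'y metric \<Rightarrow> ('x \<Rightarrow> 'y) \<Rightarrow> ('x \<Rightarrow> real) \<Rightarrow> bool" where
  "hajlasz_inequality M Y u g \<longleftrightarrow> g \<in> borel_measurable M \<and> (\<forall>x\<in>space M. 0 \<le> g x) \<and>
     (\<exists>S\<in>null_sets M. \<forall>x\<in>space M - S. \<forall>x'\<in>space M - S.
        mdist Y (u x) (u x') \<le> dist x x' * (g x + g x'))"

lemma hajlasz_inequalityE:
  assumes "hajlasz_inequality M Y u g"
  obtains S where "g \<in> borel_measurable M" "\<And>x. x \<in> space M \<Longrightarrow> 0 \<le> g x" "S \<in> null_sets M"
    "\<And>x x'. x \<in> space M - S \<Longrightarrow> x' \<in> space M - S \<Longrightarrow> mdist Y (u x) (u x') \<le> dist x x' * (g x + g x')"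
  using assms unfolding hajlasz_inequality_def by blast

lemma hajlasz_gradient_iff:
  assumes \<Phi>: "N_function \<Phi>" and \<Omega>: "\<Omega> \<in> sets \<mu>"
  shows "hajlasz_gradient \<mu> \<Omega> \<Phi> Y u g \<longleftrightarrow>
    hajlasz_inequality (restrict_space \<mu> \<Omega>) Y u g \<and> luxemburg_norm (restrict_space \<mu> \<Omega>) \<Phi> g < \<infinity>"
proof -
  have space: "space (restrict_space \<mu> \<Omega>) = \<Omega>"
    using sets.sets_into_space[OF \<Omega>] by (auto simp: space_restrict_space)
  have null: "S \<in> null_sets (restrict_space \<mu> \<Omega>) \<longleftrightarrow> S \<subseteq> \<Omega> \<and> S \<in> null_sets \<mu>" for S
    using \<Omega> by (simp add: null_sets_restrict_space)
  have "(\<exists>S\<in>null_sets (restrict_space \<mu> \<Omega>). \<forall>x\<in>\<Omega> - S. \<forall>x'\<in>\<Omega> - S. P x x') \<longleftrightarrow>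
      (\<exists>S\<in>null_sets \<mu>. \<forall>x\<in>\<Omega> - S. \<forall>x'\<in>\<Omega> - S. P x x')" for P
  proof
    assume "\<exists>S\<in>null_sets \<mu>. \<forall>x\<in>\<Omega> - S. \<forall>x'\<in>\<Omega> - S. P x x'"
    then obtain S where "S \<in> null_sets \<mu>" "\<forall>x\<in>\<Omega> - S. \<forall>x'\<in>\<Omega> - S. P x x'" by blast
    then show "\<exists>S\<in>null_sets (restrict_space \<mu> \<Omega>). \<forall>x\<in>\<Omega> - S. \<forall>x'\<in>\<Omega> - S. P x x'"
      using \<Omega> null_set_Int1[of S \<mu> \<Omega>] by (intro bexI[of _ "\<Omega> \<inter> S"]) (auto simp: null)
  qed (use null in blast)
  then show ?thesis
    by (auto simp: hajlasz_gradient_def hajlasz_inequality_def in_LPhi_def space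
        lux_norm_eq_luxemburg_norm[OF \<Phi> \<Omega>])
qed

lemma M1Phi_iff:
  assumes \<Phi>: "N_function \<Phi>" and \<Omega>: "\<Omega> \<in> sets \<mu>"
  shows "u \<in> M1Phi \<mu> \<Omega> \<Phi> Y \<longleftrightarrow> u \<in> measurable (restrict_space \<mu> \<Omega>) (borel_of_metric Y) \<and>
    (\<exists>y\<in>mspace Y. Orlicz_dist (restrict_space \<mu> \<Omega>) \<Phi> Y (\<lambda>_. y) u < \<infinity>) \<and>
    (\<exists>g. hajlasz_inequality (restrict_space \<mu> \<Omega>) Y u g \<and>
       luxemburg_norm (restrict_space \<mu> \<Omega>) \<Phi> g < \<infinity>)"
proof -
  have "space (restrict_space \<mu> \<Omega>) = \<Omega>"
    using sets.sets_into_space[OF \<Omega>] by (auto simp: space_restrict_space)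
  then have "u ` \<Omega> \<subseteq> mspace Y" if "u \<in> measurable (restrict_space \<mu> \<Omega>) (borel_of_metric Y)"
    using measurable_borel_of_metric_mspace[OF that] by auto
  then show ?thesis
    by (auto simp: M1Phi_def in_LPhi_map_def hajlasz_gradient_iff[OF \<Phi> \<Omega>]
        lux_norm_eq_luxemburg_norm[OF \<Phi> \<Omega>])
qed

lemma E_H_less_imp_hajlasz_inequality:
  assumes \<Phi>: "N_function \<Phi>" and \<Omega>: "\<Omega> \<in> sets \<mu>" and less: "E_H \<mu> \<Omega> \<Phi> Y u < C"
  shows "\<exists>g. hajlasz_inequality (restrict_space \<mu> \<Omega>) Y u g \<and>
    luxemburg_norm (restrict_space \<mu> \<Omega>) \<Phi> g < C"
  using less unfolding E_H_def
  by (auto simp: INF_less_iff hajlasz_gradient_iff[OF \<Phi> \<Omega>] lux_norm_eq_luxemburg_norm[OF \<Phi> \<Omega>])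

lemma bounded_energies_imp_hajlasz_gradients:
  assumes \<Phi>: "N_function \<Phi>" and \<Omega>: "\<Omega> \<in> sets \<mu>"
    and bound: "(SUP m. A m + E_H \<mu> \<Omega> \<Phi> (Y m) (u m)) < \<infinity>"
  obtains s g where "0 < s" "\<And>m. A m < ennreal s"
    "\<And>m. hajlasz_inequality (restrict_space \<mu> \<Omega>) (Y m) (u m) (g m)"
    "\<And>m. luxemburg_norm (restrict_space \<mu> \<Omega>) \<Phi> (g m) < ennreal s"
proof -
  obtain t where t: "(SUP m. A m + E_H \<mu> \<Omega> \<Phi> (Y m) (u m)) = ennreal t" "0 \<le> t"
    using bound by (cases "SUP m. A m + E_H \<mu> \<Omega> \<Phi> (Y m) (u m)") auto
  have less: "A m + E_H \<mu> \<Omega> \<Phi> (Y m) (u m) < ennreal (t + 1)" for m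
  proof -
    have "A m + E_H \<mu> \<Omega> \<Phi> (Y m) (u m) \<le> ennreal t"
      unfolding t(1)[symmetric] by (rule SUP_upper) simp
    also have "\<dots> < ennreal (t + 1)" using t(2) by (simp add: ennreal_less_iff)
    finally show ?thesis .
  qed
  have A: "A m < ennreal (t + 1)" and E: "E_H \<mu> \<Omega> \<Phi> (Y m) (u m) < ennreal (t + 1)" for m
    by (rule le_less_trans[OF _ less[of m]], simp)+
  have "\<exists>g. hajlasz_inequality (restrict_space \<mu> \<Omega>) (Y m) (u m) g \<and>
      luxemburg_norm (restrict_space \<mu> \<Omega>) \<Phi> g < ennreal (t + 1)" for m
    by (rule E_H_less_imp_hajlasz_inequality[OF \<Phi> \<Omega> E])
  then obtain g where "\<And>m. hajlasz_inequality (restrict_space \<mu> \<Omega>) (Y m) (u m) (g m) \<and>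
      luxemburg_norm (restrict_space \<mu> \<Omega>) \<Phi> (g m) < ennreal (t + 1)"
    by metis
  then show ?thesis using t(2) A by (intro that[of "t + 1" g]) auto
qed

lemma hajlasz_inequality_isometric_embedding:
  assumes \<phi>: "isometric_embedding Y Z \<phi>" and u: "\<And>x. x \<in> space M \<Longrightarrow> u x \<in> mspace Y"
    and g: "hajlasz_inequality M Y u g"
  shows "hajlasz_inequality M Z (\<lambda>x. \<phi> (u x)) g"
proof -
  have "mdist Z (\<phi> (u x)) (\<phi> (u x')) = mdist Y (u x) (u x')"
    if "x \<in> space M" "x' \<in> space M" for x x'
    using isometric_embedding_mdist[OF \<phi>] u that by simp
  then show ?thesis using g unfolding hajlasz_inequality_def by simp
qed

lemma hajlasz_inequality_limit:
  fixes M :: "'x::metric_space measure"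
  assumes "finite_measure M" and \<Phi>: "N_function \<Phi>"
    and f: "\<And>i x. x \<in> space M \<Longrightarrow> f i x \<in> mspace Z" and v: "\<And>x. x \<in> space M \<Longrightarrow> v x \<in> mspace Z"
    and lim: "AE x in M. (\<lambda>i. mdist Z (f i x) (v x)) \<longlonglongrightarrow> 0"
    and g: "\<And>i. hajlasz_inequality M Z (f i) (g i)" and norm_le: "\<And>i. luxemburg_norm M \<Phi> (g i) \<le> C"
    and C: "C < \<infinity>"
  obtains h where "hajlasz_inequality M Z v h" "luxemburg_norm M \<Phi> h \<le> C"
proof -
  interpret finite_measure M by fact
  have g_meas: "g i \<in> borel_measurable M" and g_nonneg: "x \<in> space M \<Longrightarrow> 0 \<le> g i x" for i x
    using g[of i] by (auto simp: hajlasz_inequality_def)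
  have "\<exists>S\<in>null_sets M. \<forall>x\<in>space M - S. \<forall>x'\<in>space M - S.
      mdist Z (f i x) (f i x') \<le> dist x x' * (g i x + g i x')" for i
    using g[of i] by (simp add: hajlasz_inequality_def)
  then obtain S where S: "\<And>i. S i \<in> null_sets M" and hajlasz: "\<And>i x x'. x \<in> space M - S i \<Longrightarrow>
      x' \<in> space M - S i \<Longrightarrow> mdist Z (f i x) (f i x') \<le> dist x x' * (g i x + g i x')"
    by metis
  obtain H h where H: "\<And>n. H n \<in> midpoint_hull (g ` {n..})"
    and h: "h \<in> borel_measurable M" "\<And>x. 0 \<le> h x" and H_lim: "AE x in M. (\<lambda>n. H n x) \<longlonglongrightarrow> h x"
    by (rule AE_convergent_midpoint_hull[OF \<Phi>, of g C, OF g_meas _ norm_le C])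
      (use g_nonneg that in blast)+
  obtain T where T: "\<And>x. x \<in> space M - T \<Longrightarrow>
      (\<lambda>i. mdist Z (f i x) (v x)) \<longlonglongrightarrow> 0 \<and> (\<lambda>n. H n x) \<longlonglongrightarrow> h x" and "T \<in> null_sets M"
    by (rule AE_E3[OF AE_conjI[OF lim H_lim]]) (rule that)
  have "mdist Z (v x) (v x') \<le> dist x x' * (h x + h x')"
    if x: "x \<in> space M - (T \<union> (\<Union>i. S i))" and x': "x' \<in> space M - (T \<union> (\<Union>i. S i))" for x x'
  proof (rule midpoint_hull_limit_affine_ge[OF H, of "\<lambda>a. dist x x' * (a x + a x')"])
    show "(\<lambda>n. dist x x' * (H n x + H n x')) \<longlonglongrightarrow> dist x x' * (h x + h x')"
      using T x x' by (intro tendsto_intros) auto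
    show "(\<lambda>i. mdist Z (f i x) (f i x')) \<longlonglongrightarrow> mdist Z (v x) (v x')"
      using x x' T by (intro tendsto_mdist f v) auto
    show "mdist Z (f i x) (f i x') \<le> dist x x' * (g i x + g i x')" for i
      using hajlasz x x' by auto
  qed (auto simp: algebra_simps add_divide_distrib)
  moreover have "T \<union> (\<Union>i. S i) \<in> null_sets M"
    using \<open>T \<in> null_sets M\<close> S by (auto intro: null_sets_UN)
  ultimately have "hajlasz_inequality M Z v h"
    unfolding hajlasz_inequality_def using h by (intro conjI bexI[of _ "T \<union> (\<Union>i. S i)"]) blast+
  moreover have "luxemburg_norm M \<Phi> h \<le> C"
  proof (rule luxemburg_norm_Fatou[OF \<Phi> _ H_lim])
    show "H n \<in> borel_measurable M" for n
      using H[of n] by (rule midpoint_hull_measurable) (auto simp: g_meas)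
    show "\<forall>\<^sub>F n in sequentially. luxemburg_norm M \<Phi> (H n) \<le> C"
      by (intro always_eventually allI midpoint_hull_luxemburg_norm_le[OF H \<Phi>])
        (auto simp: g_meas norm_le)
  qed
  ultimately show ?thesis by (rule that)
qed

section \<open>Approximation by step maps\<close>

lemma nn_integral_finite_partition:
  fixes I :: "'a \<Rightarrow> nat"
  assumes [measurable]: "f \<in> borel_measurable M" "I \<in> measurable M (count_space UNIV)"
    and I: "\<And>x. x \<in> space M \<Longrightarrow> I x < n"
  shows "(\<integral>\<^sup>+x. f x \<partial>M) = (\<Sum>i<n. \<integral>\<^sup>+x\<in>{x \<in> space M. I x = i}. f x \<partial>M)"
proof -
  have "(\<integral>\<^sup>+x. f x \<partial>M) = (\<integral>\<^sup>+x. (\<Sum>i<n. f x * indicator {x \<in> space M. I x = i} x) \<partial>M)"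
  proof (rule nn_integral_cong)
    fix x assume x: "x \<in> space M"
    have "(\<Sum>i<n. f x * indicator {x \<in> space M. I x = i} x) = (\<Sum>i<n. if i = I x then f x else 0)"
      using x by (intro sum.cong) (auto simp: indicator_def)
    then show "f x = (\<Sum>i<n. f x * indicator {x \<in> space M. I x = i} x)" using I[OF x] by simp
  qed
  also have "\<dots> = (\<Sum>i<n. \<integral>\<^sup>+x\<in>{x \<in> space M. I x = i}. f x \<partial>M)"
    by (rule nn_integral_sum) measurable
  finally show ?thesis .
qed

lemma nn_integral_cellwise_mono:
  fixes I :: "'a \<Rightarrow> nat"
  assumes f: "(\<lambda>x. f (I x) x) \<in> borel_measurable M" and h: "h \<in> borel_measurable M"
    and I: "I \<in> measurable M (count_space UNIV)" "\<And>x. x \<in> space M \<Longrightarrow> I x < n"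
    and cell_le: "\<And>i. (\<integral>\<^sup>+x\<in>{x \<in> space M. I x = i}. f i x \<partial>M)
      \<le> (\<integral>\<^sup>+x\<in>{x \<in> space M. I x = i}. h x \<partial>M)"
  shows "(\<integral>\<^sup>+x. f (I x) x \<partial>M) \<le> (\<integral>\<^sup>+x. h x \<partial>M)"
proof -
  have "(\<integral>\<^sup>+x. f (I x) x \<partial>M) = (\<Sum>i<n. \<integral>\<^sup>+x\<in>{x \<in> space M. I x = i}. f (I x) x \<partial>M)"
    by (rule nn_integral_finite_partition[OF f I])
  also have "\<dots> = (\<Sum>i<n. \<integral>\<^sup>+x\<in>{x \<in> space M. I x = i}. f i x \<partial>M)"
    by (intro sum.cong nn_integral_cong) (auto simp: indicator_def)
  also have "\<dots> \<le> (\<Sum>i<n. \<integral>\<^sup>+x\<in>{x \<in> space M. I x = i}. h x \<partial>M)"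
    by (intro sum_mono cell_le)
  also have "\<dots> = (\<integral>\<^sup>+x. h x \<partial>M)"
    by (rule nn_integral_finite_partition[OF h I, symmetric])
  finally show ?thesis .
qed

lemma exists_le_set_average:
  fixes G :: "'a \<Rightarrow> ennreal"
  assumes [measurable]: "G \<in> borel_measurable M" "Q \<in> sets M"
    and Q: "0 < emeasure M Q" "emeasure M Q < \<infinity>" and S: "S \<in> null_sets M"
  shows "\<exists>x\<in>Q - S. G x * emeasure M Q \<le> (\<integral>\<^sup>+x\<in>Q. G x \<partial>M)"
proof (rule ccontr)
  define T where "T = (\<integral>\<^sup>+x\<in>Q. G x \<partial>M)"
  assume "\<not> (\<exists>x\<in>Q - S. G x * emeasure M Q \<le> (\<integral>\<^sup>+x\<in>Q. G x \<partial>M))"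
  then have gt: "T < G x * emeasure M Q" if "x \<in> Q - S" for x
    using that by (force simp: T_def)
  have not_AE: "\<not> (AE x in M. x \<notin> Q)"
    using Q(1) by (simp add: AE_iff_null_sets[OF assms(2), symmetric] null_sets_def)
  have "T \<noteq> \<infinity>"
  proof
    assume "T = \<infinity>"
    then have "Q \<subseteq> S" using gt by force
    then have "AE x in M. x \<notin> Q" using AE_not_in[OF S] by (auto elim!: eventually_mono)
    then show False using not_AE by simp
  qed
  have T_eq: "T * emeasure M Q = (\<integral>\<^sup>+x\<in>Q. T \<partial>M)"
    by (simp add: nn_integral_cmult_indicator)
  also have "\<dots> < (\<integral>\<^sup>+x\<in>Q. G x * emeasure M Q \<partial>M)"
  proof (rule nn_integral_less)
    show "(\<integral>\<^sup>+x\<in>Q. T \<partial>M) \<noteq> \<infinity>"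
      using \<open>T \<noteq> \<infinity>\<close> Q(2) by (simp flip: T_eq add: ennreal_mult_eq_top_iff)
    show "AE x in M. T * indicator Q x \<le> G x * emeasure M Q * indicator Q x"
      using AE_not_in[OF S] by eventually_elim
        (use gt in \<open>auto simp: indicator_def intro: less_imp_le\<close>)
    show "\<not> (AE x in M. G x * emeasure M Q * indicator Q x \<le> T * indicator Q x)"
    proof
      assume "AE x in M. G x * emeasure M Q * indicator Q x \<le> T * indicator Q x"
      then have "AE x in M. x \<notin> Q"
        using AE_not_in[OF S]
      proof eventually_elim
        case (elim x)
        then show ?case using gt[of x] by (auto simp: indicator_def)
      qed
      then show False using not_AE by simp
    qed
  qed measurable
  also have "\<dots> = (\<integral>\<^sup>+x. emeasure M Q * (G x * indicator Q x) \<partial>M)"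
    by (simp add: ac_simps)
  also have "\<dots> = emeasure M Q * T"
    unfolding T_def by (rule nn_integral_cmult) measurable
  finally show False by (simp add: mult.commute)
qed

lemma N_function_average_bound:
  assumes \<Phi>: "N_function \<Phi>" and "0 \<le> d" "d \<le> \<epsilon> * (a + b)" "0 < \<epsilon>" "0 < c"
  shows "\<Phi> (d / (2 * c * \<epsilon>)) \<le> \<Phi> (a / c) + \<Phi> (b / c)"
proof -
  have "t \<le> max p q" if "t \<le> (p + q) / 2" for t p q :: real
    using that by (simp add: max_def)
  moreover have "d / (2 * c * \<epsilon>) \<le> (a / c + b / c) / 2"
    using assms(3-5) by (simp add: field_simps)
  ultimately have "d / (2 * c * \<epsilon>) \<le> max (a / c) (b / c)" .
  moreover have "0 \<le> d / (2 * c * \<epsilon>)" using assms(2,4,5) by simp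
  ultimately have "\<bar>d / (2 * c * \<epsilon>)\<bar> \<le> \<bar>max (a / c) (b / c)\<bar>"
    by (metis abs_ge_self abs_of_nonneg order_trans)
  then have "\<Phi> (d / (2 * c * \<epsilon>)) \<le> \<Phi> (max (a / c) (b / c))"
    by (rule N_function_mono[OF \<Phi>])
  also have "\<dots> \<le> \<Phi> (a / c) + \<Phi> (b / c)"
    using N_function_nonneg[OF \<Phi>] by (simp add: max_def)
  finally show ?thesis .
qed

lemma hajlasz_cell_integral_le:
  fixes M :: "'x::metric_space measure"
  assumes \<Phi>: "N_function \<Phi>" and g: "g \<in> borel_measurable M" "\<And>x. x \<in> space M \<Longrightarrow> 0 \<le> g x"
    and S: "S \<in> null_sets M" and hajlasz: "\<And>x x'. x \<in> space M - S \<Longrightarrow> x' \<in> space M - S \<Longrightarrow>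
      mdist Y (u x) (u x') \<le> dist x x' * (g x + g x')"
    and Q: "Q \<in> sets M" and diam: "\<And>x x'. x \<in> Q \<Longrightarrow> x' \<in> Q \<Longrightarrow> dist x x' \<le> \<epsilon>"
    and z: "z \<in> Q" "z \<notin> S" and "0 < \<epsilon>" "0 < c"
  shows "(\<integral>\<^sup>+x\<in>Q. ennreal (\<Phi> (mdist Y (u x) (u z) / (2 * c * \<epsilon>))) \<partial>M)
    \<le> (\<integral>\<^sup>+x\<in>Q. ennreal (\<Phi> (g x / c)) \<partial>M) + ennreal (\<Phi> (g z / c)) * emeasure M Q"
proof -
  note [measurable] = N_function_measurable[OF \<Phi>] g(1) Q
  have zM: "z \<in> space M" using z(1) sets.sets_into_space[OF Q] by auto
  have "(\<integral>\<^sup>+x\<in>Q. ennreal (\<Phi> (mdist Y (u x) (u z) / (2 * c * \<epsilon>))) \<partial>M)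
      \<le> (\<integral>\<^sup>+x\<in>Q. ennreal (\<Phi> (g x / c)) + ennreal (\<Phi> (g z / c)) \<partial>M)"
  proof (rule nn_integral_mono_AE, use AE_not_in[OF S] AE_space in eventually_elim)
    case (elim x)
    have "ennreal (\<Phi> (mdist Y (u x) (u z) / (2 * c * \<epsilon>)))
        \<le> ennreal (\<Phi> (g x / c)) + ennreal (\<Phi> (g z / c))"
      if "x \<in> Q"
    proof -
      have "mdist Y (u x) (u z) \<le> dist x z * (g x + g z)"
        using hajlasz elim z zM by simp
      also have "\<dots> \<le> \<epsilon> * (g x + g z)"
        using g(2) elim zM by (intro mult_right_mono diam that z) (auto intro: add_nonneg_nonneg)
      finally show ?thesis
        using N_function_average_bound[OF \<Phi>, of "mdist Y (u x) (u z)" \<epsilon> "g x" "g z" c] \<open>0 < \<epsilon>\<close>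
          \<open>0 < c\<close>
        by (simp add: N_function_nonneg[OF \<Phi>] ennreal_leI flip: ennreal_plus)
    qed
    then show ?case by (simp add: indicator_def)
  qed
  also have "\<dots> = (\<integral>\<^sup>+x\<in>Q. ennreal (\<Phi> (g x / c)) \<partial>M) + ennreal (\<Phi> (g z / c)) * emeasure M Q"
    by (simp add: distrib_right nn_integral_add nn_integral_cmult_indicator)
  finally show ?thesis .
qed

lemma exists_both_le_set_average:
  fixes a b :: "'a \<Rightarrow> ennreal"
  assumes [measurable]: "a \<in> borel_measurable M" "b \<in> borel_measurable M" "Q \<in> sets M"
    and "0 < emeasure M Q" "emeasure M Q < \<infinity>" "S \<in> null_sets M"
  obtains z where "z \<in> Q" "z \<notin> S" "a z * emeasure M Q \<le> (\<integral>\<^sup>+x\<in>Q. a x + b x \<partial>M)"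
    "b z * emeasure M Q \<le> (\<integral>\<^sup>+x\<in>Q. a x + b x \<partial>M)"
proof -
  obtain z where z: "z \<in> Q" "z \<notin> S"
    and average: "(a z + b z) * emeasure M Q \<le> (\<integral>\<^sup>+x\<in>Q. a x + b x \<partial>M)"
    using exists_le_set_average[of "\<lambda>x. a x + b x" M Q S] assms by auto
  have "a z * emeasure M Q \<le> (a z + b z) * emeasure M Q"
    "b z * emeasure M Q \<le> (a z + b z) * emeasure M Q"
    by (auto intro: mult_right_mono)
  then show ?thesis using that[OF z] average order_trans by blast
qed

lemma (in finite_measure) N_function_bound_of_integral:
  assumes \<Phi>: "N_function \<Phi>" and "0 < c" "measure M Q \<noteq> 0"
    and average: "ennreal (\<Phi> (t / c)) * emeasure M Q \<le> (\<integral>\<^sup>+x\<in>Q. h x \<partial>M)"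
    and mass: "(\<integral>\<^sup>+x. h x \<partial>M) \<le> 1"
  shows "\<bar>t\<bar> \<le> c * (1 + 1 / (\<Phi> 1 * measure M Q))"
proof (rule N_function_bound_of_mass[OF \<Phi> \<open>0 < c\<close>])
  have "ennreal (\<Phi> (t / c) * measure M Q) = ennreal (\<Phi> (t / c)) * emeasure M Q"
    by (simp add: emeasure_eq_measure ennreal_mult N_function_nonneg[OF \<Phi>])
  also have "\<dots> \<le> (\<integral>\<^sup>+x\<in>Q. h x \<partial>M)" by (rule average)
  also have "\<dots> \<le> (\<integral>\<^sup>+x. h x \<partial>M)" by (intro nn_integral_mono) (simp add: indicator_def)
  also have "\<dots> \<le> 1" by (rule mass)
  finally show "\<Phi> (t / c) * measure M Q \<le> 1" by simp
qed (use assms(3) in \<open>simp add: zero_less_measure_iff\<close>)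

text \<open>On a null cell the bound on \<open>q\<close> is \<open>c\<close>, because \<open>1 / 0 = 0\<close>.\<close>

lemma hajlasz_cell_value:
  fixes M :: "'x::metric_space measure"
  assumes "finite_measure M" and \<Phi>: "N_function \<Phi>" and u: "u \<in> measurable M (borel_of_metric Y)"
    and y: "y \<in> mspace Y" and g: "hajlasz_inequality M Y u g"
    and Q: "Q \<in> sets M" and diam: "\<And>x x'. x \<in> Q \<Longrightarrow> x' \<in> Q \<Longrightarrow> dist x x' \<le> \<epsilon>" and "0 < \<epsilon>" "0 < c"
    and modular_le: "modular M \<Phi> (\<lambda>x. g x / c) + modular M \<Phi> (\<lambda>x. mdist Y y (u x) / c) \<le> 1"
  shows "\<exists>q\<in>mspace Y. mdist Y y q \<le> c * (1 + 1 / (\<Phi> 1 * measure M Q)) \<and>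
    (\<integral>\<^sup>+x\<in>Q. ennreal (\<Phi> (mdist Y (u x) q / (2 * c * \<epsilon>))) \<partial>M)
      \<le> (\<integral>\<^sup>+x\<in>Q. 2 * ennreal (\<Phi> (g x / c)) + ennreal (\<Phi> (mdist Y y (u x) / c)) \<partial>M)"
proof (cases "measure M Q = 0")
  case True
  interpret finite_measure M by fact
  have "Q \<in> null_sets M" using True Q by (simp add: emeasure_eq_measure null_setsI)
  then have "(\<integral>\<^sup>+x\<in>Q. ennreal (\<Phi> (mdist Y (u x) y / (2 * c * \<epsilon>))) \<partial>M) = 0"
    by (rule nn_integral_null_set)
  then show ?thesis using True \<open>0 < c\<close> by (intro bexI[OF _ y]) (simp add: mdist_self[OF y])
next
  case False
  interpret finite_measure M by fact
  obtain S where g': "g \<in> borel_measurable M" "\<And>x. x \<in> space M \<Longrightarrow> 0 \<le> g x"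
    and S: "S \<in> null_sets M" and hajlasz: "\<And>x x'. x \<in> space M - S \<Longrightarrow> x' \<in> space M - S \<Longrightarrow>
      mdist Y (u x) (u x') \<le> dist x x' * (g x + g x')"
    using hajlasz_inequalityE[OF g] by metis
  note [measurable] = N_function_measurable[OF \<Phi>] measurable_mdist_const[OF u y] g'(1) Q
  define a b where "a x = ennreal (\<Phi> (g x / c))" and "b x = ennreal (\<Phi> (mdist Y y (u x) / c))" for x
  have [measurable]: "a \<in> borel_measurable M" "b \<in> borel_measurable M"
    unfolding a_def b_def by measurable
  obtain z where z: "z \<in> Q" "z \<notin> S"
    and average: "a z * emeasure M Q \<le> (\<integral>\<^sup>+x\<in>Q. a x + b x \<partial>M)"
      "b z * emeasure M Q \<le> (\<integral>\<^sup>+x\<in>Q. a x + b x \<partial>M)"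
    by (rule exists_both_le_set_average[of a M b Q S])
      (use False S that in \<open>auto simp: emeasure_eq_measure zero_less_measure_iff\<close>)
  have "u z \<in> mspace Y"
    using z(1) sets.sets_into_space[OF Q] by (intro measurable_borel_of_metric_mspace[OF u]) auto
  moreover have "(\<integral>\<^sup>+x. a x + b x \<partial>M) \<le> 1"
    using modular_le by (simp add: nn_integral_add modular_def a_def b_def)
  then have "mdist Y y (u z) \<le> c * (1 + 1 / (\<Phi> 1 * measure M Q))"
    using N_function_bound_of_integral[OF \<Phi> \<open>0 < c\<close> False average(2)[unfolded b_def[of z]]] by simp
  moreover have "(\<integral>\<^sup>+x\<in>Q. ennreal (\<Phi> (mdist Y (u x) (u z) / (2 * c * \<epsilon>))) \<partial>M)
      \<le> (\<integral>\<^sup>+x\<in>Q. 2 * a x + b x \<partial>M)"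
  proof -
    have "(\<integral>\<^sup>+x\<in>Q. ennreal (\<Phi> (mdist Y (u x) (u z) / (2 * c * \<epsilon>))) \<partial>M)
        \<le> (\<integral>\<^sup>+x\<in>Q. a x \<partial>M) + a z * emeasure M Q"
      unfolding a_def by (rule hajlasz_cell_integral_le[OF \<Phi> g' S hajlasz Q diam z \<open>0 < \<epsilon>\<close> \<open>0 < c\<close>])
    also have "\<dots> \<le> (\<integral>\<^sup>+x\<in>Q. a x \<partial>M) + (\<integral>\<^sup>+x\<in>Q. a x + b x \<partial>M)" by (intro add_left_mono average)
    also have "\<dots> = (\<integral>\<^sup>+x\<in>Q. 2 * a x + b x \<partial>M)"
      by (simp add: nn_integral_add[symmetric] mult_2 distrib_right add.assoc)
    finally show ?thesis .
  qed
  ultimately show ?thesis unfolding a_def b_def by blast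
qed

lemma hajlasz_step_approximation:
  fixes M :: "'x::metric_space measure"
  assumes "finite_measure M" and \<Phi>: "N_function \<Phi>" and u: "u \<in> measurable M (borel_of_metric Y)"
    and y: "y \<in> mspace Y" and g: "hajlasz_inequality M Y u g"
    and I: "fine_partition M \<epsilon> I n" and "0 < \<epsilon>" "0 < s"
    and u_less: "Orlicz_dist M \<Phi> Y (\<lambda>_. y) u < ennreal s"
    and g_less: "luxemburg_norm M \<Phi> g < ennreal s"
  shows "\<exists>q. (\<forall>i. q i \<in> mspace Y) \<and>
    (\<forall>i. mdist Y y (q i) \<le> 3 * s * (1 + 1 / (\<Phi> 1 * measure M {x \<in> space M. I x = i}))) \<and>
    Orlicz_dist M \<Phi> Y u (\<lambda>x. q (I x)) \<le> ennreal (6 * s * \<epsilon>)"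
proof -
  have I_meas: "I \<in> measurable M (count_space UNIV)" and I_less: "\<And>x. x \<in> space M \<Longrightarrow> I x < n"
    and diam: "x \<in> {x \<in> space M. I x = i} \<Longrightarrow> x' \<in> {x \<in> space M. I x = i} \<Longrightarrow> dist x x' \<le> \<epsilon>" for i x x'
    using I by (auto simp: fine_partition_def)
  note [measurable] = I_meas N_function_measurable[OF \<Phi>] measurable_mdist_const[OF u y]
  have [measurable]: "g \<in> borel_measurable M" using g by (simp add: hajlasz_inequality_def)
  have thirds: "modular M \<Phi> (\<lambda>x. g x / (3 * s)) \<le> ennreal (1/3)"
    "modular M \<Phi> (\<lambda>x. mdist Y y (u x) / (3 * s)) \<le> ennreal (1/3)"
    using modular_le_inverse_of_luxemburg_norm_less[OF \<Phi> _ g_less, of 3]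
      modular_le_inverse_of_luxemburg_norm_less[OF \<Phi> _ u_less, of 3] by simp_all
  have two_thirds:
    "modular M \<Phi> (\<lambda>x. g x / (3 * s)) + modular M \<Phi> (\<lambda>x. mdist Y y (u x) / (3 * s)) \<le> 1"
    by (rule order_trans[OF add_mono[OF thirds]]) (simp flip: ennreal_plus add: ennreal_le_1)
  define h
    where "h x = 2 * ennreal (\<Phi> (g x / (3 * s))) + ennreal (\<Phi> (mdist Y y (u x) / (3 * s)))" for x
  define cell_value where "cell_value i q \<longleftrightarrow> q \<in> mspace Y \<and>
      mdist Y y q \<le> 3 * s * (1 + 1 / (\<Phi> 1 * measure M {x \<in> space M. I x = i})) \<and>
      (\<integral>\<^sup>+x\<in>{x \<in> space M. I x = i}. ennreal (\<Phi> (mdist Y (u x) q / (6 * s * \<epsilon>))) \<partial>M)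
        \<le> (\<integral>\<^sup>+x\<in>{x \<in> space M. I x = i}. h x \<partial>M)" for i q
  have "\<exists>q. cell_value i q" for i
    using hajlasz_cell_value[where Q = "{x \<in> space M. I x = i}" and c = "3 * s",
        OF assms(1) \<Phi> u y g _ diam \<open>0 < \<epsilon>\<close>]
      two_thirds \<open>0 < s\<close>
    by (simp add: cell_value_def h_def Bex_def)
  then obtain q where "\<And>i. cell_value i (q i)" by metis
  then have q: "q i \<in> mspace Y"
      "mdist Y y (q i) \<le> 3 * s * (1 + 1 / (\<Phi> 1 * measure M {x \<in> space M. I x = i}))"
    and cell: "(\<integral>\<^sup>+x\<in>{x \<in> space M. I x = i}. ennreal (\<Phi> (mdist Y (u x) (q i) / (6 * s * \<epsilon>))) \<partial>M)
        \<le> (\<integral>\<^sup>+x\<in>{x \<in> space M. I x = i}. h x \<partial>M)" for i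
    by (simp_all add: cell_value_def)
  have [measurable]: "(\<lambda>x. mdist Y (u x) (q (I x))) \<in> borel_measurable M"
    by (intro countably_valued_measurable_mdist[OF u] countably_valued_compose q I_meas)
  have "modular M \<Phi> (\<lambda>x. mdist Y (u x) (q (I x)) / (6 * s * \<epsilon>)) \<le> (\<integral>\<^sup>+x. h x \<partial>M)"
    unfolding modular_def
  proof (rule nn_integral_cellwise_mono[OF _ _ I_meas I_less cell])
    show "h \<in> borel_measurable M" unfolding h_def by measurable
  qed measurable
  also have "\<dots> = 2 * modular M \<Phi> (\<lambda>x. g x / (3 * s)) + modular M \<Phi> (\<lambda>x. mdist Y y (u x) / (3 * s))"
    unfolding h_def modular_def by (simp add: nn_integral_add nn_integral_cmult)
  also have "\<dots> \<le> 2 * ennreal (1/3) + ennreal (1/3)"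
    by (intro add_mono mult_left_mono thirds) simp
  also have "\<dots> = 1" by (simp add: mult_2 flip: ennreal_plus)
  finally have "Orlicz_dist M \<Phi> Y u (\<lambda>x. q (I x)) \<le> ennreal (6 * s * \<epsilon>)"
    using \<open>0 < s\<close> \<open>0 < \<epsilon>\<close> by (intro luxemburg_norm_le_of_modular) auto
  then show ?thesis using q by blast
qed

section \<open>Limits of step maps\<close>

lemma Orlicz_dist_triangle:
  assumes \<Phi>: "N_function \<Phi>"
    and "(\<lambda>x. mdist Z (a x) (b x)) \<in> borel_measurable M"
      "(\<lambda>x. mdist Z (b x) (c x)) \<in> borel_measurable M"
    and "\<And>x. x \<in> space M \<Longrightarrow> a x \<in> mspace Z" "\<And>x. x \<in> space M \<Longrightarrow> b x \<in> mspace Z"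
      "\<And>x. x \<in> space M \<Longrightarrow> c x \<in> mspace Z"
  shows "Orlicz_dist M \<Phi> Z a c
    \<le> Orlicz_dist M \<Phi> Z a b + Orlicz_dist M \<Phi> Z b c"
  by (rule luxemburg_norm_triangle[OF assms(1-3)], rule AE_I2) (simp add: mdist_triangle assms(4-6))

lemma (in finite_measure) Orlicz_dist_step_maps_tendsto:
  assumes \<Phi>: "N_function \<Phi>" and I: "\<And>x. x \<in> space M \<Longrightarrow> I x < (n::nat)"
    and lim: "\<And>i. (\<lambda>k. mdist Z (q k i) (P i)) \<longlonglongrightarrow> 0"
  shows "(\<lambda>k. Orlicz_dist M \<Phi> Z (\<lambda>x. q k (I x)) (\<lambda>x. P (I x))) \<longlonglongrightarrow> 0"
proof (rule order_tendstoI)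
  fix a :: ennreal assume "0 < a"
  then obtain a' where a': "0 < a'" "a' < a" using dense by blast
  obtain e where e: "0 < e" "ennreal e < a" using a' by (cases a') auto
  define A where "A = 1 + \<Phi> 1 * measure M (space M)"
  have A: "0 < A" by (simp add: A_def add_pos_nonneg N_function_nonneg[OF \<Phi>])
  have "\<forall>\<^sub>F k in sequentially. \<forall>i\<in>{..<n}. mdist Z (q k i) (P i) < e / A"
    using e A by (intro eventually_ball_finite ballI order_tendstoD(2)[OF lim]) auto
  then show "\<forall>\<^sub>F k in sequentially. Orlicz_dist M \<Phi> Z (\<lambda>x. q k (I x)) (\<lambda>x. P (I x)) < a"
  proof eventually_elim
    case (elim k)
    have "Orlicz_dist M \<Phi> Z (\<lambda>x. q k (I x)) (\<lambda>x. P (I x)) \<le> ennreal (e / A * A)"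
      unfolding A_def
      by (rule luxemburg_norm_le_const[OF \<Phi>])
        (use elim I e A in \<open>auto simp: A_def intro: less_imp_le\<close>)
    also have "\<dots> < a" using A e by simp
    finally show ?case .
  qed
qed simp

lemma Orlicz_dist_limits_le:
  assumes \<Phi>: "N_function \<Phi>" and f: "\<And>k. f k \<in> measurable M (borel_of_metric Z)"
    and w: "\<And>k. countably_valued M Z (w k)" and w': "\<And>k. countably_valued M Z (w' k)"
    and l: "\<And>x. x \<in> space M \<Longrightarrow> l x \<in> mspace Z" and l': "\<And>x. x \<in> space M \<Longrightarrow> l' x \<in> mspace Z"
    and lim: "\<And>x. x \<in> space M \<Longrightarrow> (\<lambda>k. mdist Z (w k x) (l x)) \<longlonglongrightarrow> 0"
    and lim': "\<And>x. x \<in> space M \<Longrightarrow> (\<lambda>k. mdist Z (w' k x) (l' x)) \<longlonglongrightarrow> 0"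
    and w_le: "\<And>k. Orlicz_dist M \<Phi> Z (f k) (w k) \<le> A"
    and w'_le: "\<And>k. Orlicz_dist M \<Phi> Z (f k) (w' k) \<le> B"
  shows "Orlicz_dist M \<Phi> Z l l' \<le> A + B"
proof (rule luxemburg_norm_Fatou[OF \<Phi>])
  show "(\<lambda>x. mdist Z (w k x) (w' k x)) \<in> borel_measurable M" for k
    by (rule countably_valued_measurable_mdist[OF countably_valued_measurable[OF w] w'])
  show "AE x in M. (\<lambda>k. mdist Z (w k x) (w' k x)) \<longlonglongrightarrow> mdist Z (l x) (l' x)"
    by (intro AE_I2 tendsto_mdist countably_valued_mspace[OF w] countably_valued_mspace[OF w'] l l'
        lim lim')
  have "Orlicz_dist M \<Phi> Z (w k) (w' k) \<le> A + B" for k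
  proof -
    have "Orlicz_dist M \<Phi> Z (w k) (w' k)
        \<le> Orlicz_dist M \<Phi> Z (w k) (f k) + Orlicz_dist M \<Phi> Z (f k) (w' k)"
      using countably_valued_measurable_mdist[OF f w] countably_valued_measurable_mdist[OF f w']
      by (intro Orlicz_dist_triangle[OF \<Phi>] countably_valued_mspace[OF w]
          countably_valued_mspace[OF w'] measurable_borel_of_metric_mspace[OF f])
        (simp_all add: mdist_commute[of Z "w k _"])
    also have "\<dots> \<le> A + B"
      using w_le[of k] w'_le[of k] by (intro add_mono) (simp_all add: mdist_commute[of Z "w k _"])
    finally show ?thesis .
  qed
  then show "\<forall>\<^sub>F k in sequentially. Orlicz_dist M \<Phi> Z (w k) (w' k) \<le> A + B" by simp
qed

lemma Orlicz_limit_of_approximations: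
  assumes \<Phi>: "N_function \<Phi>" and f: "\<And>k. f k \<in> measurable M (borel_of_metric Z)"
    and w: "\<And>k j. countably_valued M Z (w k j)" and w': "\<And>j. countably_valued M Z (w' j)"
    and v: "strongly_measurable M Z v"
    and w_le: "\<And>k j. Orlicz_dist M \<Phi> Z (f k) (w k j) \<le> \<epsilon> j"
    and w'_le: "\<And>j. Orlicz_dist M \<Phi> Z (w' j) v \<le> \<delta> j"
    and lim: "\<And>j. (\<lambda>k. Orlicz_dist M \<Phi> Z (w k j) (w' j)) \<longlonglongrightarrow> 0"
    and small: "(\<lambda>j. \<epsilon> j + \<delta> j) \<longlonglongrightarrow> 0"
  shows "(\<lambda>k. Orlicz_dist M \<Phi> Z (f k) v) \<longlonglongrightarrow> 0"
proof (rule order_tendstoI)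
  note meas = countably_valued_measurable[OF w] countably_valued_measurable[OF w'] f
  note in_Z = meas[THEN measurable_borel_of_metric_mspace] strongly_measurable_mspace[OF v]
  have triangle: "Orlicz_dist M \<Phi> Z (f k) v \<le> \<epsilon> j + \<delta> j + Orlicz_dist M \<Phi> Z (w k j) (w' j)"
    for k j
  proof -
    have "Orlicz_dist M \<Phi> Z (f k) v
        \<le> Orlicz_dist M \<Phi> Z (f k) (w k j) + Orlicz_dist M \<Phi> Z (w k j) v"
      by (intro Orlicz_dist_triangle[OF \<Phi>] in_Z meas
          countably_valued_measurable_mdist[OF f w] strongly_measurable_measurable_mdist[OF _ v])
    also have "\<dots> \<le> \<epsilon> j + (Orlicz_dist M \<Phi> Z (w k j) (w' j) + Orlicz_dist M \<Phi> Z (w' j) v)"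
      by (intro add_mono w_le Orlicz_dist_triangle[OF \<Phi>] in_Z meas
          countably_valued_measurable_mdist[OF _ w'] strongly_measurable_measurable_mdist[OF _ v])
    also have "\<dots> \<le> \<epsilon> j + (Orlicz_dist M \<Phi> Z (w k j) (w' j) + \<delta> j)"
      by (intro add_left_mono w'_le)
    finally show ?thesis by (simp only: ac_simps)
  qed
  fix a :: ennreal assume "0 < a"
  then obtain j where j: "\<epsilon> j + \<delta> j < a"
    using order_tendstoD(2)[OF small] by (auto simp: eventually_sequentially)
  have "(\<lambda>k. \<epsilon> j + \<delta> j + Orlicz_dist M \<Phi> Z (w k j) (w' j)) \<longlonglongrightarrow> \<epsilon> j + \<delta> j + 0"
    by (intro tendsto_intros lim)
  then have "\<forall>\<^sub>F k in sequentially. \<epsilon> j + \<delta> j + Orlicz_dist M \<Phi> Z (w k j) (w' j) < a"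
    using j by (intro order_tendstoD(2)) auto
  then show "\<forall>\<^sub>F k in sequentially. Orlicz_dist M \<Phi> Z (f k) v < a"
    by eventually_elim (rule le_less_trans[OF triangle])
qed simp

lemma (in finite_measure) Orlicz_limit_of_step_maps:
  fixes I :: "nat \<Rightarrow> 'a \<Rightarrow> nat" and n :: "nat \<Rightarrow> nat"
  assumes \<Phi>: "N_function \<Phi>" and Z: "mcomplete_of Z"
    and I: "\<And>j. I j \<in> measurable M (count_space UNIV)" "\<And>j x. x \<in> space M \<Longrightarrow> I j x < n j"
    and f: "\<And>k. f k \<in> measurable M (borel_of_metric Z)"
    and q: "\<And>k j i. q k j i \<in> mspace Z" and P: "\<And>j i. P j i \<in> mspace Z"
    and lim: "\<And>j i. (\<lambda>k. mdist Z (q k j i) (P j i)) \<longlonglongrightarrow> 0"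
    and approx: "\<And>k j. Orlicz_dist M \<Phi> Z (f k) (\<lambda>x. q k j (I j x)) \<le> ennreal (\<epsilon> j)"
    and \<epsilon>: "summable \<epsilon>" "decseq \<epsilon>" "\<And>j. 0 \<le> \<epsilon> j"
  obtains v where "strongly_measurable M Z v" "(\<lambda>k. Orlicz_dist M \<Phi> Z (f k) v) \<longlonglongrightarrow> 0"
proof -
  define w where "w k j x = q k j (I j x)" for k j x
  define w' where "w' j x = P j (I j x)" for j x
  have w: "countably_valued M Z (w k j)" and w': "countably_valued M Z (w' j)" for k j
    unfolding w_def w'_def by (intro countably_valued_compose q P I)+
  have approx_w: "Orlicz_dist M \<Phi> Z (f k) (w k j) \<le> ennreal (\<epsilon> j)" for k j
    unfolding w_def by (rule approx)
  have cauchy: "Orlicz_dist M \<Phi> Z (w' j) (w' i) \<le> ennreal (2 * \<epsilon> j)" if "j \<le> i" for i j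
  proof -
    have "Orlicz_dist M \<Phi> Z (w' j) (w' i) \<le> ennreal (\<epsilon> j) + ennreal (\<epsilon> i)"
      by (rule Orlicz_dist_limits_le[where w = "\<lambda>k. w k j" and w' = "\<lambda>k. w k i",
            OF \<Phi> f w w _ _ _ _ approx_w approx_w]) (simp_all add: w_def w'_def P lim)
    also have "\<dots> \<le> ennreal (2 * \<epsilon> j)"
      using decseqD[OF \<epsilon>(2) that] \<epsilon>(3) by (simp add: ennreal_leI flip: ennreal_plus)
    finally show ?thesis .
  qed
  obtain v where v: "strongly_measurable M Z v"
    and w'_v: "\<And>j. Orlicz_dist M \<Phi> Z (w' j) v \<le> ennreal (2 * \<epsilon> j)"
    by (rule Orlicz_complete[OF \<Phi> Z w' summable_mult[OF \<epsilon>(1), of 2] _ cauchy])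
      (use \<epsilon>(3) that in auto)
  have "(\<lambda>k. Orlicz_dist M \<Phi> Z (f k) v) \<longlonglongrightarrow> 0"
  proof (rule Orlicz_limit_of_approximations[OF \<Phi> f w w' v approx_w w'_v])
    show "(\<lambda>k. Orlicz_dist M \<Phi> Z (w k j) (w' j)) \<longlonglongrightarrow> 0" for j
      unfolding w_def w'_def by (rule Orlicz_dist_step_maps_tendsto[OF \<Phi> I(2) lim])
    have "(\<lambda>j. ennreal (\<epsilon> j) + ennreal (2 * \<epsilon> j)) \<longlonglongrightarrow> ennreal 0 + ennreal (2 * 0)"
      using summable_LIMSEQ_zero[OF \<epsilon>(1)] by (intro tendsto_ennrealI tendsto_intros)
    then show "(\<lambda>j. ennreal (\<epsilon> j) + ennreal (2 * \<epsilon> j)) \<longlonglongrightarrow> 0" by simp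
  qed
  then show ?thesis by (rule that[OF v])
qed

section \<open>Closedness of the Hajlasz--Orlicz space\<close>

lemma hajlasz_inequality_Orlicz_limit:
  fixes M :: "'x::metric_space measure"
  assumes fin: "finite_measure M" and \<Phi>: "N_function \<Phi>"
    and f: "\<And>k. f k \<in> measurable M (borel_of_metric Z)" and v: "strongly_measurable M Z v"
    and lim: "(\<lambda>k. Orlicz_dist M \<Phi> Z (f k) v) \<longlonglongrightarrow> 0"
    and g: "\<And>k. hajlasz_inequality M Z (f k) (g k)" and norm_le: "\<And>k. luxemburg_norm M \<Phi> (g k) \<le> C"
    and C: "C < \<infinity>"
  obtains h where "hajlasz_inequality M Z v h" "luxemburg_norm M \<Phi> h \<le> C"
proof -
  obtain r :: "nat \<Rightarrow> nat" where r: "AE x in M. (\<lambda>i. mdist Z (f (r i) x) (v x)) \<longlonglongrightarrow> 0"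
    by (rule finite_measure.AE_tendsto_subseq_of_luxemburg_norm[OF fin \<Phi>
          strongly_measurable_measurable_mdist[OF f v] lim]) (rule that)
  show ?thesis
    by (rule hajlasz_inequality_limit[OF fin \<Phi> measurable_borel_of_metric_mspace[OF f]
        strongly_measurable_mspace[OF v] r g norm_le C]) (assumption | rule that)+
qed

lemma M1Phi_isometric_embedding:
  assumes \<Phi>: "N_function \<Phi>" and \<Omega>: "\<Omega> \<in> sets \<mu>" and \<phi>: "isometric_embedding Y Z \<phi>"
    and u: "u \<in> M1Phi \<mu> \<Omega> \<Phi> Y"
  shows "(\<lambda>x. \<phi> (u x)) \<in> M1Phi \<mu> \<Omega> \<Phi> Z"
proof -
  let ?M = "restrict_space \<mu> \<Omega>"
  obtain y g where meas: "u \<in> measurable ?M (borel_of_metric Y)" and y: "y \<in> mspace Y"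
    and y_norm: "Orlicz_dist ?M \<Phi> Y (\<lambda>_. y) u < \<infinity>"
    and g: "hajlasz_inequality ?M Y u g" "luxemburg_norm ?M \<Phi> g < \<infinity>"
    using u unfolding M1Phi_iff[OF \<Phi> \<Omega>] by blast
  have uY: "u x \<in> mspace Y" if "x \<in> space ?M" for x
    by (rule measurable_borel_of_metric_mspace[OF meas that])
  have "Orlicz_dist ?M \<Phi> Z (\<lambda>_. \<phi> y) (\<lambda>x. \<phi> (u x)) \<le> Orlicz_dist ?M \<Phi> Y (\<lambda>_. y) u"
    by (intro luxemburg_norm_mono[OF \<Phi>] AE_I2) (simp add: isometric_embedding_mdist[OF \<phi>] uY y)
  then have "Orlicz_dist ?M \<Phi> Z (\<lambda>_. \<phi> y) (\<lambda>x. \<phi> (u x)) < \<infinity>"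
    using y_norm by (rule le_less_trans)
  moreover have "(\<lambda>x. \<phi> (u x)) \<in> measurable ?M (borel_of_metric Z)"
    by (rule measurable_compose[OF meas isometric_embedding_measurable[OF \<phi>]])
  moreover have "hajlasz_inequality ?M Z (\<lambda>x. \<phi> (u x)) g"
    by (rule hajlasz_inequality_isometric_embedding[OF \<phi> uY g(1)])
  ultimately show ?thesis
    unfolding M1Phi_iff[OF \<Phi> \<Omega>] using isometric_embedding_mspace[OF \<phi> y] g(2) by blast
qed

lemma M1Phi_Orlicz_limit:
  assumes fin: "finite_measure (restrict_space \<mu> \<Omega>)" and \<Phi>: "N_function \<Phi>" and \<Omega>: "\<Omega> \<in> sets \<mu>"
    and f: "\<And>k. f k \<in> M1Phi \<mu> \<Omega> \<Phi> Z" and v: "strongly_measurable (restrict_space \<mu> \<Omega>) Z v"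
    and lim: "(\<lambda>k. Orlicz_dist (restrict_space \<mu> \<Omega>) \<Phi> Z (f k) v) \<longlonglongrightarrow> 0"
    and g: "\<And>k. hajlasz_inequality (restrict_space \<mu> \<Omega>) Z (f k) (g k)"
    and norm_le: "\<And>k. luxemburg_norm (restrict_space \<mu> \<Omega>) \<Phi> (g k) \<le> C" and C: "C < \<infinity>"
  shows "v \<in> M1Phi \<mu> \<Omega> \<Phi> Z"
proof -
  let ?M = "restrict_space \<mu> \<Omega>"
  have f_meas: "f k \<in> measurable ?M (borel_of_metric Z)" for k
    using f[of k] by (simp add: M1Phi_iff[OF \<Phi> \<Omega>])
  obtain h where h: "hajlasz_inequality ?M Z v h" "luxemburg_norm ?M \<Phi> h \<le> C"
    by (rule hajlasz_inequality_Orlicz_limit[OF fin \<Phi> f_meas v lim g norm_le C]) (rule that)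
  obtain k where k: "Orlicz_dist ?M \<Phi> Z (f k) v < \<infinity>"
    using order_tendstoD(2)[OF lim, of \<infinity>] by (auto simp: eventually_sequentially)
  obtain z where z: "z \<in> mspace Z" and z_norm: "Orlicz_dist ?M \<Phi> Z (\<lambda>_. z) (f k) < \<infinity>"
    using f[of k] unfolding M1Phi_iff[OF \<Phi> \<Omega>] by blast
  have "Orlicz_dist ?M \<Phi> Z (\<lambda>_. z) v
      \<le> Orlicz_dist ?M \<Phi> Z (\<lambda>_. z) (f k) + Orlicz_dist ?M \<Phi> Z (f k) v"
    by (intro Orlicz_dist_triangle[OF \<Phi>] measurable_mdist_const[OF f_meas z] z
        strongly_measurable_measurable_mdist[OF f_meas v] strongly_measurable_mspace[OF v]
        measurable_borel_of_metric_mspace[OF f_meas])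
  also have "\<dots> < \<infinity>" using k z_norm by simp
  finally have "Orlicz_dist ?M \<Phi> Z (\<lambda>_. z) v < \<infinity>" .
  then show ?thesis
    unfolding M1Phi_iff[OF \<Phi> \<Omega>]
    using z h le_less_trans[OF h(2) C] strongly_measurable_measurable[OF v] by blast
qed

lemma M1Phi_Orlicz_limit_of_isometric_embeddings:
  assumes "finite_measure (restrict_space \<mu> \<Omega>)" and \<Phi>: "N_function \<Phi>" and \<Omega>: "\<Omega> \<in> sets \<mu>"
    and iso: "\<And>k. isometric_embedding (Y k) Z (\<phi> k)" and u: "\<And>k. u k \<in> M1Phi \<mu> \<Omega> \<Phi> (Y k)"
    and g: "\<And>k. hajlasz_inequality (restrict_space \<mu> \<Omega>) (Y k) (u k) (g k)"
    and less: "\<And>k. luxemburg_norm (restrict_space \<mu> \<Omega>) \<Phi> (g k) < ennreal s"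
    and v: "strongly_measurable (restrict_space \<mu> \<Omega>) Z v"
    and lim: "(\<lambda>k. Orlicz_dist (restrict_space \<mu> \<Omega>) \<Phi> Z (\<lambda>x. \<phi> k (u k x)) v) \<longlonglongrightarrow> 0"
  shows "v \<in> M1Phi \<mu> \<Omega> \<Phi> Z"
proof (rule M1Phi_Orlicz_limit[OF assms(1) \<Phi> \<Omega> M1Phi_isometric_embedding[OF \<Phi> \<Omega> iso u] v lim])
  have "u k \<in> measurable (restrict_space \<mu> \<Omega>) (borel_of_metric (Y k))" for k
    using u[of k] by (simp add: M1Phi_iff[OF \<Phi> \<Omega>])
  then show "hajlasz_inequality (restrict_space \<mu> \<Omega>) Z (\<lambda>x. \<phi> k (u k x)) (g k)" for k
    by (intro hajlasz_inequality_isometric_embedding[OF iso _ g] measurable_borel_of_metric_mspace)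
qed (use less in \<open>auto intro: less_imp_le\<close>)

section \<open>Compactness\<close>

lemma compactin_closure_of_converging_nets:
  fixes Z :: "'z metric" and T :: "nat \<Rightarrow> 'z set"
  assumes Z: "mcomplete_of Z" and T: "\<And>k. T k \<subseteq> mspace Z"
    and nets: "\<And>\<epsilon>. 0 < \<epsilon> \<Longrightarrow> \<exists>n p l. (\<forall>k i. p k i \<in> T k) \<and>
      (\<forall>k. T k \<subseteq> (\<Union>i<n::nat. mball_of Z (p k i) \<epsilon>)) \<and>
      (\<forall>i. l i \<in> mspace Z \<and> (\<lambda>k. mdist Z (p k i) (l i)) \<longlonglongrightarrow> 0)"
  shows "compactin (mtopology_of Z) (mtopology_of Z closure_of (\<Union>k. T k))"
proof -
  interpret Z: Metric_space "mspace Z" "mdist Z" by (rule Metric_space_mspace_mdist)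
  have "Z.mtotally_bounded (\<Union>k. T k)"
    unfolding Z.mtotally_bounded_def
  proof (intro allI impI)
    fix e :: real assume "0 < e"
    then obtain n :: nat and p l where "\<forall>k i. p k i \<in> T k"
      "\<forall>k. T k \<subseteq> (\<Union>i<n. mball_of Z (p k i) (e / 3))"
      "\<forall>i. l i \<in> mspace Z \<and> (\<lambda>k. mdist Z (p k i) (l i)) \<longlonglongrightarrow> 0"
      using nets[of "e / 3"] by auto
    then have p: "p k i \<in> T k" and net: "T k \<subseteq> (\<Union>i<n. mball_of Z (p k i) (e / 3))"
      and l: "l i \<in> mspace Z" and lim: "(\<lambda>k. mdist Z (p k i) (l i)) \<longlonglongrightarrow> 0" for k i
      by blast+
    have pZ: "p k i \<in> mspace Z" for k i using p T by blast
    have "\<forall>\<^sub>F k in sequentially. \<forall>i\<in>{..<n}. mdist Z (p k i) (l i) < e / 3"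
      using \<open>0 < e\<close> by (intro eventually_ball_finite ballI order_tendstoD(2)[OF lim]) auto
    then obtain k\<^sub>0 where k\<^sub>0: "\<And>k i. k\<^sub>0 \<le> k \<Longrightarrow> i < n \<Longrightarrow> mdist Z (p k i) (l i) < e / 3"
      by (auto simp: eventually_sequentially)
    have close: "mdist Z (p (min k k\<^sub>0) i) (p k i) < 2 * (e / 3)" if "i < n" for k i
      using mdist_triangle[of "p k\<^sub>0 i" Z "l i" "p k i", OF pZ l pZ] k\<^sub>0[of k\<^sub>0 i] k\<^sub>0[of k i] that
        \<open>0 < e\<close>
      by (auto simp: min_def mdist_self[OF pZ] mdist_commute[of Z "l i"])
    define C where "C = (\<lambda>(k, i). p k i) ` ({..k\<^sub>0} \<times> {..<n})"
    have "\<exists>x\<in>C. z \<in> Z.mball x e" if z: "z \<in> T k" for z k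
    proof -
      obtain i where i: "i < n" "z \<in> mball_of Z (p k i) (e / 3)" using net[of k] z by blast
      then have "mdist Z (p (min k k\<^sub>0) i) z < e"
        using mdist_triangle[of "p (min k k\<^sub>0) i" Z "p k i" z, OF pZ pZ] close[OF i(1), of k]
        by simp
      moreover have "p (min k k\<^sub>0) i \<in> C" using i(1) by (force simp: C_def)
      ultimately show ?thesis using pZ i(2) by (auto simp: Z.in_mball)
    qed
    moreover have "finite C" "C \<subseteq> (\<Union>k. T k)" using p by (auto simp: C_def)
    ultimately show "\<exists>C. finite C \<and> C \<subseteq> (\<Union>k. T k) \<and> (\<Union>k. T k) \<subseteq> (\<Union>x\<in>C. Z.mball x e)"
      by (intro exI[of _ C]) blast
  qed
  then show ?thesis
    using Z.mtotally_bounded_eq_compact_closure_of Z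
    by (simp add: mcomplete_of_def mtopology_of_def)
qed

lemma compactin_closure_of_isometric_images:
  fixes n :: "nat \<Rightarrow> nat"
  assumes Z: "mcomplete_of Z" and iso: "\<And>k. isometric_embedding (Y k) Z (\<phi> k)"
    and K: "\<And>k. K k \<subseteq> mspace (Y k)"
    and t: "\<And>j k i. t j k i \<in> K k"
    and net: "\<And>j k. K k \<subseteq> (\<Union>i<n j. mball_of (Y k) (t j k i) ((1/2) ^ j))"
    and l: "\<And>j i. l j i \<in> mspace Z" and lim: "\<And>j i. (\<lambda>k. mdist Z (\<phi> k (t j k i)) (l j i)) \<longlonglongrightarrow> 0"
  shows "compactin (mtopology_of Z) (mtopology_of Z closure_of (\<Union>k. \<phi> k ` K k))"
proof (rule compactin_closure_of_converging_nets[OF Z])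
  show "\<phi> k ` K k \<subseteq> mspace Z" for k using isometric_embedding_mspace[OF iso] K by blast
  fix \<epsilon> :: real assume "0 < \<epsilon>"
  then obtain j where j: "(1/2::real) ^ j < \<epsilon>" using real_arch_pow_inv[of \<epsilon> "1/2"] by auto
  have "\<phi> k ` K k \<subseteq> (\<Union>i<n j. mball_of Z (\<phi> k (t j k i)) \<epsilon>)" for k
  proof
    fix z assume "z \<in> \<phi> k ` K k"
    then obtain a where a: "a \<in> K k" "z = \<phi> k a" by blast
    then obtain i where i: "i < n j" "a \<in> mball_of (Y k) (t j k i) ((1/2) ^ j)"
      using net[where j = j and k = k] by blast
    then have "z \<in> mball_of Z (\<phi> k (t j k i)) \<epsilon>"
      using j by (simp add: a(2) isometric_embedding_mspace[OF iso] isometric_embedding_mdist[OF iso])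
    then show "z \<in> (\<Union>i<n j. mball_of Z (\<phi> k (t j k i)) \<epsilon>)" using i(1) by blast
  qed
  then show "\<exists>n p l. (\<forall>k i. p k i \<in> \<phi> k ` K k) \<and>
      (\<forall>k. \<phi> k ` K k \<subseteq> (\<Union>i<n::nat. mball_of Z (p k i) \<epsilon>)) \<and>
      (\<forall>i. l i \<in> mspace Z \<and> (\<lambda>k. mdist Z (p k i) (l i)) \<longlonglongrightarrow> 0)"
    using t l lim by (intro exI[of _ "n j"] exI[of _ "\<lambda>k i. \<phi> k (t j k i)"] exI[of _ "l j"]) simp
qed

lemma uniformly_compact_net:
  assumes unif: "uniformly_compact Y K" and nonempty: "\<And>m. K m \<noteq> {}" and "0 < \<epsilon>"
  shows "\<exists>n p. (\<forall>m i. p m i \<in> K m) \<and> (\<forall>m. K m \<subseteq> (\<Union>i<n::nat. mball_of (Y m) (p m i) \<epsilon>))"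
proof -
  obtain n where n: "\<And>m. \<exists>C. finite C \<and> card C \<le> n \<and> C \<subseteq> K m \<and> K m \<subseteq> (\<Union>c\<in>C. mball_of (Y m) c \<epsilon>)"
    using unif \<open>0 < \<epsilon>\<close> unfolding uniformly_compact_def by meson
  have "\<exists>p. (\<forall>i. p i \<in> K m) \<and> K m \<subseteq> (\<Union>i<n. mball_of (Y m) (p i) \<epsilon>)" for m
  proof -
    obtain C where C: "finite C" "card C \<le> n" "C \<subseteq> K m" "K m \<subseteq> (\<Union>c\<in>C. mball_of (Y m) c \<epsilon>)"
      using n[of m] by blast
    obtain h where h: "C = h ` {..<card C}"
      using ex_bij_betw_nat_finite[OF C(1)] by (auto simp: bij_betw_def lessThan_atLeast0)
    obtain y where y: "y \<in> K m" using nonempty by blast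
    define p where "p i = (if i < card C then h i else y)" for i
    have "C \<subseteq> p ` {..<n}" using C(2) by (subst h) (auto simp: p_def)
    then have "K m \<subseteq> (\<Union>i<n. mball_of (Y m) (p i) \<epsilon>)" using C(4) by blast
    moreover have "p i \<in> K m" for i using h C(3) y by (auto simp: p_def)
    ultimately show ?thesis by blast
  qed
  then show ?thesis by metis
qed

lemma gluing_subsequence_uniformly_compact:
  fixes Y :: "nat \<Rightarrow> 'y metric" and q :: "nat \<Rightarrow> 'a::countable \<Rightarrow> 'y"
  assumes unif: "uniformly_compact Y K" and K: "\<And>m. K m \<subseteq> mspace (Y m)" and y: "\<And>m. y m \<in> K m"
    and q: "\<And>m a. q m a \<in> mspace (Y m)" and q_bounded: "\<And>a. \<exists>B. \<forall>m. mdist (Y m) (y m) (q m a) \<le> B"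
  obtains \<sigma> :: "nat \<Rightarrow> nat" and Z :: "(nat \<times> 'y \<Rightarrow> real) metric" and \<phi> KZ P where
    "strict_mono \<sigma>" "mcomplete_of Z" "\<And>k. isometric_embedding (Y (\<sigma> k)) Z (\<phi> k)"
    "compactin (mtopology_of Z) KZ" "\<And>k. \<phi> k ` K (\<sigma> k) \<subseteq> KZ"
    "\<And>a. P a \<in> mspace Z" "\<And>a. (\<lambda>k. mdist Z (\<phi> k (q (\<sigma> k) a)) (P a)) \<longlonglongrightarrow> 0"
proof -
  have "\<exists>n p. (\<forall>m i. p m i \<in> K m) \<and> (\<forall>m. K m \<subseteq> (\<Union>i<n::nat. mball_of (Y m) (p m i) ((1/2) ^ j)))"
    for j :: nat
    using y by (intro uniformly_compact_net[OF unif]) auto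
  then obtain n :: "nat \<Rightarrow> nat" and t where t: "\<And>j m i. t j m i \<in> K m"
    and t_net: "\<And>j m. K m \<subseteq> (\<Union>i<n j. mball_of (Y m) (t j m i) ((1/2) ^ j))"
    by metis
  obtain D where D: "\<And>m a b. a \<in> K m \<Longrightarrow> b \<in> K m \<Longrightarrow> mdist (Y m) a b \<le> D"
    using unif unfolding uniformly_compact_def by blast
  define p where "p m l = (case l of Inl (j, i) \<Rightarrow> t j m i | Inr a \<Rightarrow> q m a)"
    for m and l :: "(nat \<times> nat) + 'a"
  have p: "p m l \<in> mspace (Y m)" for m l
    using subsetD[OF K t] q by (simp add: p_def split: sum.split)
  have "\<exists>B. \<forall>m. mdist (Y m) (y m) (p m l) \<le> B" for l
  proof (cases l)
    case (Inl c)
    then show ?thesis using D[OF y t] by (intro exI[of _ D]) (simp add: p_def split: prod.split)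
  next
    case (Inr a)
    then show ?thesis using q_bounded[of a] by (simp add: p_def)
  qed
  then obtain B where B: "\<And>m l. mdist (Y m) (y m) (p m l) \<le> B l" by metis
  have p_bounded: "mdist (Y m) (p m a) (p m b) \<le> B a + B b" for m a b
    using mdist_triangle[of "p m a" "Y m" "y m" "p m b", OF p subsetD[OF K y] p] B[of m a] B[of m b]
      mdist_commute[of "Y m" "y m" "p m a"] by linarith
  then have "\<exists>B. \<forall>m. mdist (Y m) (p m a) (p m b) \<le> B" for a b by blast
  from p this obtain \<sigma> :: "nat \<Rightarrow> nat" and Z :: "(nat \<times> 'y \<Rightarrow> real) metric" and \<phi> \<psi> where
    \<sigma>: "strict_mono \<sigma>" and Z: "mcomplete_of Z" and iso: "\<And>k. isometric_embedding (Y (\<sigma> k)) Z (\<phi> k)"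
    and \<psi>: "\<And>l. \<psi> l \<in> mspace Z" and lim: "\<And>l. (\<lambda>k. mdist Z (\<phi> k (p (\<sigma> k) l)) (\<psi> l)) \<longlonglongrightarrow> 0"
    by (rule gluing_subsequence) (rule that)
  define KZ where "KZ = mtopology_of Z closure_of (\<Union>k. \<phi> k ` K (\<sigma> k))"
  have "compactin (mtopology_of Z) KZ"
    unfolding KZ_def
  proof (rule compactin_closure_of_isometric_images[OF Z iso K t t_net])
    show "(\<lambda>k. mdist Z (\<phi> k (t j (\<sigma> k) i)) (\<psi> (Inl (j, i)))) \<longlonglongrightarrow> 0" for j i
      using lim[of "Inl (j, i)"] by (simp add: p_def)
  qed (rule \<psi>)
  moreover have "(\<Union>k. \<phi> k ` K (\<sigma> k)) \<subseteq> KZ"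
    unfolding KZ_def using isometric_embedding_mspace[OF iso] K by (intro closure_of_subset) force
  then have "\<phi> k ` K (\<sigma> k) \<subseteq> KZ" for k by blast
  moreover have "(\<lambda>k. mdist Z (\<phi> k (q (\<sigma> k) a)) (\<psi> (Inr a))) \<longlonglongrightarrow> 0" for a
    using lim[of "Inr a"] by (simp add: p_def)
  ultimately show ?thesis
    using that[of \<sigma> Z \<phi> KZ "\<lambda>a. \<psi> (Inr a)", OF \<sigma> Z iso] \<psi> by blast
qed

lemma hajlasz_uniform_step_approximation:
  fixes M :: "'x::metric_space measure"
  assumes fin: "finite_measure M" and tb: "totally_bounded (space M)"
    and balls: "\<And>x r. {y \<in> space M. dist x y < r} \<in> sets M" and \<Phi>: "N_function \<Phi>"
    and u: "\<And>m. u m \<in> measurable M (borel_of_metric (Y m))" and y: "\<And>m. y m \<in> mspace (Y m)"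
    and g: "\<And>m. hajlasz_inequality M (Y m) (u m) (g m)" and s: "0 < s"
    and u_less: "\<And>m. Orlicz_dist M \<Phi> (Y m) (\<lambda>_. y m) (u m) < ennreal s"
    and g_less: "\<And>m. luxemburg_norm M \<Phi> (g m) < ennreal s"
  obtains I n q where "\<And>j. fine_partition M ((1/2) ^ j) (I j) (n j)"
    "\<And>m j i. q m j i \<in> mspace (Y m)"
    "\<And>j i. \<exists>B. \<forall>m. mdist (Y m) (y m) (q m j i) \<le> B"
    "\<And>m j. Orlicz_dist M \<Phi> (Y m) (u m) (\<lambda>x. q m j (I j x)) \<le> ennreal (6 * s * (1/2) ^ j)"
proof -
  have "\<exists>I n. fine_partition M ((1/2) ^ j) I n" for j :: nat
    by (rule totally_bounded_imp_fine_partition[OF tb balls]) simp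
  then obtain I n where I: "\<And>j::nat. fine_partition M ((1/2) ^ j) (I j) (n j)" by metis
  define B where "B j i = 3 * s * (1 + 1 / (\<Phi> 1 * measure M {x \<in> space M. I j x = i}))" for j i
  define step_values where "step_values m j q \<longleftrightarrow> (\<forall>i. q i \<in> mspace (Y m)) \<and>
      (\<forall>i. mdist (Y m) (y m) (q i) \<le> B j i) \<and>
      Orlicz_dist M \<Phi> (Y m) (u m) (\<lambda>x. q (I j x)) \<le> ennreal (6 * s * (1/2) ^ j)" for m j q
  have "\<exists>q. step_values m j q" for m j
    unfolding step_values_def B_def
    by (rule hajlasz_step_approximation[OF fin \<Phi> u y g I _ s u_less g_less]) simp
  then obtain q where "\<And>m j. step_values m j (q m j)" by metis
  then show ?thesis by (intro that[of I n q] I) (auto simp: step_values_def)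
qed

theorem hajlasz_compactness:
  fixes M :: "'x::metric_space measure" and Y :: "nat \<Rightarrow> 'y metric"
  assumes fin: "finite_measure M" and tb: "totally_bounded (space M)"
    and balls: "\<And>x r. {y \<in> space M. dist x y < r} \<in> sets M" and \<Phi>: "N_function \<Phi>"
    and unif: "uniformly_compact Y K" and K: "\<And>m. K m \<subseteq> mspace (Y m)" and y: "\<And>m. y m \<in> K m"
    and u: "\<And>m. u m \<in> measurable M (borel_of_metric (Y m))"
    and g: "\<And>m. hajlasz_inequality M (Y m) (u m) (g m)" and s: "0 < s"
    and u_less: "\<And>m. Orlicz_dist M \<Phi> (Y m) (\<lambda>_. y m) (u m) < ennreal s"
    and g_less: "\<And>m. luxemburg_norm M \<Phi> (g m) < ennreal s"
  obtains \<sigma> :: "nat \<Rightarrow> nat" and Z :: "(nat \<times> 'y \<Rightarrow> real) metric" and \<phi> KZ v where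
    "strict_mono \<sigma>" "mcomplete_of Z" "\<And>k. isometric_embedding (Y (\<sigma> k)) Z (\<phi> k)"
    "compactin (mtopology_of Z) KZ" "\<And>k. \<phi> k ` K (\<sigma> k) \<subseteq> KZ" "strongly_measurable M Z v"
    "(\<lambda>k. Orlicz_dist M \<Phi> Z (\<lambda>x. \<phi> k (u (\<sigma> k) x)) v) \<longlonglongrightarrow> 0"
proof -
  have yY: "y m \<in> mspace (Y m)" for m using K y by blast
  obtain I n q where I: "\<And>j. fine_partition M ((1/2) ^ j) (I j) (n j)"
    and q: "\<And>m j i. q m j i \<in> mspace (Y m)"
    and q_bounded: "\<And>j i. \<exists>B. \<forall>m. mdist (Y m) (y m) (q m j i) \<le> B"
    and approx: "\<And>m j. Orlicz_dist M \<Phi> (Y m) (u m) (\<lambda>x. q m j (I j x))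
        \<le> ennreal (6 * s * (1/2) ^ j)"
    by (rule hajlasz_uniform_step_approximation[OF fin tb balls \<Phi> u yY g s u_less g_less])
      (rule that)
  define q' where "q' m = (\<lambda>(j, i). q m j i)" for m
  obtain \<sigma> :: "nat \<Rightarrow> nat" and Z :: "(nat \<times> 'y \<Rightarrow> real) metric" and \<phi> KZ P where
    \<sigma>: "strict_mono \<sigma>" and Z: "mcomplete_of Z" and iso: "\<And>k. isometric_embedding (Y (\<sigma> k)) Z (\<phi> k)"
    and KZ: "compactin (mtopology_of Z) KZ" "\<And>k. \<phi> k ` K (\<sigma> k) \<subseteq> KZ"
    and P: "\<And>a. P a \<in> mspace Z" and lim: "\<And>a. (\<lambda>k. mdist Z (\<phi> k (q' (\<sigma> k) a)) (P a)) \<longlonglongrightarrow> 0"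
  proof (rule gluing_subsequence_uniformly_compact[OF unif K y, of q'])
    show "q' m a \<in> mspace (Y m)" for m a by (cases a) (simp add: q'_def q)
    show "\<exists>B. \<forall>m. mdist (Y m) (y m) (q' m a) \<le> B" for a by (cases a) (simp add: q'_def q_bounded)
  qed (rule that)
  have uY: "u m x \<in> mspace (Y m)" if "x \<in> space M" for m x
    by (rule measurable_borel_of_metric_mspace[OF u that])
  have approx_\<phi>: "Orlicz_dist M \<Phi> Z (\<lambda>x. \<phi> k (u (\<sigma> k) x)) (\<lambda>x. \<phi> k (q (\<sigma> k) j (I j x)))
      \<le> ennreal (6 * s * (1/2) ^ j)" for k j
    by (rule order_trans[OF luxemburg_norm_mono[OF \<Phi> AE_I2] approx[of "\<sigma> k"]])
      (simp add: isometric_embedding_mdist[OF iso] uY q)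
  obtain v where "strongly_measurable M Z v"
    "(\<lambda>k. Orlicz_dist M \<Phi> Z (\<lambda>x. \<phi> k (u (\<sigma> k) x)) v) \<longlonglongrightarrow> 0"
  proof (rule finite_measure.Orlicz_limit_of_step_maps[OF fin \<Phi> Z _ _ _ _ _ _ approx_\<phi>])
    show "I j \<in> measurable M (count_space UNIV)" "x \<in> space M \<Longrightarrow> I j x < n j" for j x
      using I[of j] by (auto simp: fine_partition_def)
    show "(\<lambda>x. \<phi> k (u (\<sigma> k) x)) \<in> measurable M (borel_of_metric Z)" for k
      by (rule measurable_compose[OF u isometric_embedding_measurable[OF iso]])
    show "\<phi> k (q (\<sigma> k) j i) \<in> mspace Z" for k j i by (rule isometric_embedding_mspace[OF iso q])
    show "(\<lambda>k. mdist Z (\<phi> k (q (\<sigma> k) j i)) (P (j, i))) \<longlonglongrightarrow> 0" for j i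
      using lim[of "(j, i)"] by (simp add: q'_def)
    show "summable (\<lambda>j. 6 * s * (1/2) ^ j)" by (intro summable_mult summable_geometric) simp
    show "decseq (\<lambda>j. 6 * s * (1/2) ^ j)"
      using s by (intro decseq_SucI) (simp add: mult_left_mono)
  qed (use s P that in auto)
  with \<sigma> Z iso KZ show ?thesis by (rule that)
qed

theorem theorem3p1:
  fixes \<mu> :: "'x::complete_space measure"
    and \<Omega> :: "'x set"
    and \<Phi> :: "real \<Rightarrow> real"
    and Y :: "nat \<Rightarrow> 'y metric"
    and K :: "nat \<Rightarrow> 'y set"
    and u :: "nat \<Rightarrow> 'x \<Rightarrow> 'y"
  assumes space: "space \<mu> = UNIV" and borel: "sets \<mu> = sets borel"
    and doubling: "doubling_measure \<mu>"
    and domain: "open \<Omega>" "connected \<Omega>" "bounded \<Omega>" "\<Omega> \<noteq> {}"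
    and Nfun: "N_function \<Phi>" and Dp: "Delta_prime \<Phi>" and N2: "nabla2 \<Phi>"
    and PI: "supports_Phi_Poincare \<mu> \<Omega> \<Phi>"
    and Ycomplete: "\<And>m. mcomplete_of (Y m)"
    and Kcompact: "\<And>m. compactin (mtopology_of (Y m)) (K m)"
    and uM: "\<And>m. u m \<in> M1Phi \<mu> \<Omega> \<Phi> (Y m)"
    and unif: "uniformly_compact Y K"
    and bound: "\<exists>y. (\<forall>m. y m \<in> K m) \<and>
       (SUP m. lux_norm \<mu> \<Omega> \<Phi> (\<lambda>x. mdist (Y m) (y m) (u m x)) + E_H \<mu> \<Omega> \<Phi> (Y m) (u m)) < \<infinity>"
  shows "\<exists>(\<sigma>::nat \<Rightarrow> nat) (Z :: ((nat \<times> 'y) \<Rightarrow> real) metric) \<phi> KZ v.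
     strict_mono \<sigma> \<and> mcomplete_of Z \<and>
     (\<forall>k. isometric_embedding (Y (\<sigma> k)) Z (\<phi> k)) \<and>
     compactin (mtopology_of Z) KZ \<and>
     v \<in> M1Phi \<mu> \<Omega> \<Phi> Z \<and>
     (\<forall>k. \<phi> k ` K (\<sigma> k) \<subseteq> KZ) \<and>
     ((\<lambda>k. lux_norm \<mu> \<Omega> \<Phi> (\<lambda>x. mdist Z (\<phi> k (u (\<sigma> k) x)) (v x))) \<longlongrightarrow> 0) sequentially"
proof -
  let ?M = "restrict_space \<mu> \<Omega>"
  have \<Omega>: "\<Omega> \<in> sets \<mu>" using domain(1) by (simp add: borel)
  note M = doubling_measure_restrict_bounded[OF borel doubling \<Omega> domain(3)]
  note lux = lux_norm_eq_luxemburg_norm[OF Nfun \<Omega>]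
  obtain y where y: "\<And>m. y m \<in> K m" and bounded: "(SUP m. Orlicz_dist ?M \<Phi> (Y m) (\<lambda>_. y m) (u m)
      + E_H \<mu> \<Omega> \<Phi> (Y m) (u m)) < \<infinity>"
    using bound unfolding lux by blast
  obtain s g where s: "0 < s" and u_less: "\<And>m. Orlicz_dist ?M \<Phi> (Y m) (\<lambda>_. y m) (u m) < ennreal s"
    and g: "\<And>m. hajlasz_inequality ?M (Y m) (u m) (g m)"
    and g_less: "\<And>m. luxemburg_norm ?M \<Phi> (g m) < ennreal s"
    by (rule bounded_energies_imp_hajlasz_gradients[OF Nfun \<Omega> bounded]) (rule that)
  have K: "K m \<subseteq> mspace (Y m)" for m
    using compactin_subset_topspace[OF Kcompact[of m]] by simp
  have u: "u m \<in> measurable ?M (borel_of_metric (Y m))" for m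
    using uM[of m] by (simp add: M1Phi_iff[OF Nfun \<Omega>])
  obtain \<sigma> :: "nat \<Rightarrow> nat" and Z :: "(nat \<times> 'y \<Rightarrow> real) metric" and \<phi> KZ v where
    glued: "strict_mono \<sigma>" "mcomplete_of Z" and iso: "\<And>k. isometric_embedding (Y (\<sigma> k)) Z (\<phi> k)"
    and KZ: "compactin (mtopology_of Z) KZ" "\<And>k. \<phi> k ` K (\<sigma> k) \<subseteq> KZ"
    and v: "strongly_measurable ?M Z v"
    and lim: "(\<lambda>k. Orlicz_dist ?M \<Phi> Z (\<lambda>x. \<phi> k (u (\<sigma> k) x)) v) \<longlonglongrightarrow> 0"
    by (rule hajlasz_compactness[OF M Nfun unif K y u g s u_less g_less]) (rule that)
  have "v \<in> M1Phi \<mu> \<Omega> \<Phi> Z"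
    by (rule M1Phi_Orlicz_limit_of_isometric_embeddings[OF M(1) Nfun \<Omega> iso uM g g_less v lim])
  then show ?thesis using glued iso KZ lim unfolding lux by blast
qed

end
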